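(* Assume there exists $c\in\mathcal C$ such that $e\cdot m_c<0$. Then there exist preemptive resume scheduling control policies (P-SCPs) $f^n$, $n\in\mathbb N$, under which, for every $\varepsilon$ and $T$ satisfying $0<\varepsilon<T<\infty$, $$\lim_{n\to\infty}P\big(Y^n(t)=0\text{ for all }t\in[\varepsilon,T]\big)=1.$$
   Context: Parameters and fluid model. Let $I,J\ge 2$, $\mathcal I=\{1,\dots,I\}$ (customer classes), $\mathcal J=\{I+1,\dots,I+J\}$ (service stations). For each $n\in\mathbb N$ there are arrival rates $\lambda_i^n>0$, service rates $\mu_{ij}^n\ge 0$ and numbers of servers $N_j^n\in\mathbb N$. The set $\mathcal E=\{(i,j):\mu_{ij}^n>0\}$ does not depend on $n$; write $i\sim j$ if $(i,j)\in\mathcal E$. Elements of $\mathcal E$ are called activities, and $\mathcal G$ is the graph with vertex set $\mathcal I\cup\mathcal J$ and edge set $\mathcal E$. There are constants $\lambda_i,\nu_j\in(0,\infty)$, $\mu_{ij}\in(0,\infty)$ for $(i,j)\in\mathcal E$, $\mu_{ij}=0$ for $(i,j)\notin\mathcal E$, and $\hat\lambda_i,\hat\mu_{ij}\in\mathbb R$ such that $n^{-1}\lambda_i^n\to\lambda_i$, $\mu_{ij}^n\to\mu_{ij}$, $n^{-1}N_j^n\to\nu_j$ and $$n^{1/2}(n^{-1}\lambda_i^n-\lambda_i)\to\hat\lambda_i,\quad n^{1/2}(\mu_{ij}^n-\mu_{ij})\to\hat\mu_{ij},\quad n^{1/2}(n^{-1}N_j^n-\nu_j)\to0 .$$ Let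 $\bar\mu_{ij}=\nu_j\mu_{ij}$ and consider the linear program: minimize $\rho\in\mathbb R_+$ subject to $\sum_{j}\bar\mu_{ij}\xi_{ij}=\lambda_i$, $\sum_i\xi_{ij}\le\rho$, $\xi_{ij}\ge0$ for all $i\in\mathcal I,j\in\mathcal J$. Standing assumption (heavy traffic): it has a unique optimal solution $(\xi^*,\rho^* )$, and $\sum_i\xi^*_{ij}=1$ for all $j\in\mathcal J$ (so $\rho^*=1$). Put $x_i^*=\sum_j\xi_{ij}^*\nu_j$. An activity is basic if $\xi^*_{ij}>0$; $\mathcal E_b$ is the set of basic activities, other activities are nonbasic. Standing assumption (complete resource pooling): the graph $\mathcal G_b$ with vertex set $\mathcal I\cup\mathcal J$ and edge set $\mathcal E_b$ is a tree. Simple cycles. $\mathcal C$ is the set of cycles that are subgraphs of $\mathcal G$ with exactly one edge being a nonbasic activity. If $c\in\mathcal C$ has nonbasic edge $(i_0,j_0)$, orient $c$ cyclically so that this edge is directed from $i_0$ to $j_0$: $i_0\to j_0\to i_1\to j_1\to\cdots\to i_k\to j_k\to i_0$. For an edge $(i,j)$ of $c$ (written $(i,j)\in c$), $s(c,i,j)=-1$ if in $c$ it is directed from $i$ to $j$, and $s(c,i,j)=1$ if directed from $j$ to $i$. Let $m_{i,c}=\sum_{j:(i,j)\in c}s(c,i,j)\mu_{ij}$, $m_c=(m_{i,c})_{i\in\mathcal I}\in\mathbb R^I$, and $e=(1,\dots,1)'$. Queueing model. On a complete probability space, let $\{\check U_i(k)\}_{k\in\mathbb N}$, $i\in\mathcal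 I$, be independent sequences of strictly positive i.i.d. random variables with mean $1$ and finite variance, and $A_i^n(t)=\sup\{l\ge0:\sum_{k=1}^l\check U_i(k)/\lambda_i^n\le t\}$ (arrivals). Let $S_{ij}^n$ be Poisson processes of rate $\mu_{ij}^n$ (the zero process if the rate is $0$), mutually independent and independent of the arrival processes. $A^n,S^n$ are the primitive processes. Initial data $X^{0,n}\in\mathbb Z_+^I$ are deterministic and satisfy $n^{-1/2}(X_i^{0,n}-nx_i^* )\to x_i$ for some constants $x_i\in\mathbb R$. The processes $X_i^n$ (class-$i$ customers in the system), $Y_i^n$ (class-$i$ customers in queue), $Z_j^n$ (idle servers at station $j$), $\Psi_{ij}^n$ (class-$i$ customers in service at station $j$) have cadlag paths and satisfy, for all $t\ge 0$, $i\in\mathcal I$, $j\in\mathcal J$: (a) $\Psi_{ij}^n(t)=0$ for $i\not\sim j$; (b) $X_i^n(t)=X_i^{0,n}+A_i^n(t)-\sum_{j}S_{ij}^n\big(\int_0^t\Psi_{ij}^n(s)ds\big)$; (c) $Y_i^n(t)+\sum_j\Psi_{ij}^n(t)=X_i^n(t)$; (d) $Z_j^n(t)+\sum_i\Psi_{ij}^n(t)=N_j^n$; (e) $Y_i^n(t)\ge0$, $Z_j^n(t)\ge0$, $\Psi_{ij}^n(t)\ge0$. Write $Y^n=(Y_i^n)_{i\in\mathcal I}$. P-SCP. A map $f^n:\mathbb Z_+^I\to\mathbb Z_+^{IJ}$ is a preemptive resume scheduling control policy (P-SCP), and $X^n$ is the controlled process corresponding to $f^n$, initial data $X^{0,n}$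 and primitive processes $A^n,S^n$, if $\Psi^n(t)=f^n(X^n(t))$ for all $t$ and (a)–(e) hold. *)

theory Defs
  imports "HOL-Probability.Probability"
begin

text \<open>
  Customer classes are the elements of a finite type \<open>'i\<close>, service stations those of a finite type
  \<open>'j\<close>. A set of activities is a relation \<open>E :: ('i \<times> 'j) set\<close>; it is also the edge set of a
  bipartite graph on the vertex type \<open>'i + 'j\<close>.
\<close>

definition rate_asymptotics ::
  "('i \<times> 'j) set \<Rightarrow> (nat \<Rightarrow> 'i \<Rightarrow> real) \<Rightarrow> (nat \<Rightarrow> 'i \<Rightarrow> 'j \<Rightarrow> real) \<Rightarrow> (nat \<Rightarrow> 'j \<Rightarrow> nat) \<Rightarrow>
   ('i \<Rightarrow> real) \<Rightarrow> ('i \<Rightarrow> 'j \<Rightarrow> real) \<Rightarrow> ('j \<Rightarrow> real) \<Rightarrow> ('i \<Rightarrow> real) \<Rightarrow> ('i \<Rightarrow> 'j \<Rightarrow> real) \<Rightarrow> bool"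
where
  "rate_asymptotics E lamn mun Nn lam mu nu lamhat muhat \<longleftrightarrow>
     (\<forall>n i. lamn n i > 0) \<and>
     (\<forall>n i j. mun n i j \<ge> 0) \<and>
     (\<forall>n. E = {(i, j). mun n i j > 0}) \<and>
     (\<forall>i. lam i > 0) \<and>
     (\<forall>j. nu j > 0) \<and>
     (\<forall>i j. if (i, j) \<in> E then mu i j > 0 else mu i j = 0) \<and>
     (\<forall>i. (\<lambda>n. lamn n i / real n) \<longlonglongrightarrow> lam i) \<and>
     (\<forall>i j. (\<lambda>n. mun n i j) \<longlonglongrightarrow> mu i j) \<and>
     (\<forall>j. (\<lambda>n. real (Nn n j) / real n) \<longlonglongrightarrow> nu j) \<and>
     (\<forall>i. (\<lambda>n. sqrt (real n) * (lamn n i / real n - lam i)) \<longlonglongrightarrow> lamhat i) \<and>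
     (\<forall>i j. (\<lambda>n. sqrt (real n) * (mun n i j - mu i j)) \<longlonglongrightarrow> muhat i j) \<and>
     (\<forall>j. (\<lambda>n. sqrt (real n) * (real (Nn n j) / real n - nu j)) \<longlonglongrightarrow> 0)"

definition lp_feasible ::
  "('i::finite \<Rightarrow> real) \<Rightarrow> ('i \<Rightarrow> 'j::finite \<Rightarrow> real) \<Rightarrow> ('j \<Rightarrow> real) \<Rightarrow> ('i \<Rightarrow> 'j \<Rightarrow> real) \<Rightarrow> real \<Rightarrow> bool"
where
  "lp_feasible lam mu nu xi \<rho> \<longleftrightarrow>
     \<rho> \<ge> 0 \<and>
     (\<forall>i. (\<Sum>j\<in>UNIV. (nu j * mu i j) * xi i j) = lam i) \<and>
     (\<forall>j. (\<Sum>i\<in>UNIV. xi i j) \<le> \<rho>) \<and>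
     (\<forall>i j. xi i j \<ge> 0)"

definition lp_optimal ::
  "('i::finite \<Rightarrow> real) \<Rightarrow> ('i \<Rightarrow> 'j::finite \<Rightarrow> real) \<Rightarrow> ('j \<Rightarrow> real) \<Rightarrow> ('i \<Rightarrow> 'j \<Rightarrow> real) \<Rightarrow> real \<Rightarrow> bool"
where
  "lp_optimal lam mu nu xi \<rho> \<longleftrightarrow>
     lp_feasible lam mu nu xi \<rho> \<and> (\<forall>xi' \<rho>'. lp_feasible lam mu nu xi' \<rho>' \<longrightarrow> \<rho> \<le> \<rho>')"

definition heavy_traffic ::
  "('i::finite \<Rightarrow> real) \<Rightarrow> ('i \<Rightarrow> 'j::finite \<Rightarrow> real) \<Rightarrow> ('j \<Rightarrow> real) \<Rightarrow> ('i \<Rightarrow> 'j \<Rightarrow> real) \<Rightarrow> real \<Rightarrow> bool"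
where
  "heavy_traffic lam mu nu xi \<rho> \<longleftrightarrow>
     lp_optimal lam mu nu xi \<rho> \<and>
     (\<forall>xi' \<rho>'. lp_optimal lam mu nu xi' \<rho>' \<longrightarrow> xi' = xi \<and> \<rho>' = \<rho>) \<and>
     (\<forall>j. (\<Sum>i\<in>UNIV. xi i j) = 1)"

definition fluid_state :: "('j::finite \<Rightarrow> real) \<Rightarrow> ('i \<Rightarrow> 'j \<Rightarrow> real) \<Rightarrow> 'i \<Rightarrow> real" where
  "fluid_state nu xi i = (\<Sum>j\<in>UNIV. xi i j * nu j)"

definition basic_activities :: "('i \<times> 'j) set \<Rightarrow> ('i \<Rightarrow> 'j \<Rightarrow> real) \<Rightarrow> ('i \<times> 'j) set" where
  "basic_activities E xi = {(i, j) \<in> E. xi i j > 0}"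

text \<open>
  A cycle of the bipartite graph, with an orientation and a starting edge, is written as the list
  \<open>[(i\<^sub>0, j\<^sub>0), \<dots>, (i\<^sub>k, j\<^sub>k)]\<close> of its edges directed from a class to a station; it stands for
  \<open>i\<^sub>0 \<rightarrow> j\<^sub>0 \<rightarrow> i\<^sub>1 \<rightarrow> j\<^sub>1 \<rightarrow> \<dots> \<rightarrow> i\<^sub>k \<rightarrow> j\<^sub>k \<rightarrow> i\<^sub>0\<close>. The remaining edges of the cycle are the pairs
  \<open>(i\<^sub>l\<^sub>+\<^sub>1, j\<^sub>l)\<close> (index \<open>l + 1\<close> modulo \<open>k + 1\<close>), directed from the station to the class.
\<close>

definition forward_edges :: "('i \<times> 'j) list \<Rightarrow> ('i \<times> 'j) set" where
  "forward_edges c = {c ! l | l. l < length c}"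

definition backward_edges :: "('i \<times> 'j) list \<Rightarrow> ('i \<times> 'j) set" where
  "backward_edges c = {(fst (c ! (Suc l mod length c)), snd (c ! l)) | l. l < length c}"

definition cycle_edges :: "('i \<times> 'j) list \<Rightarrow> ('i \<times> 'j) set" where
  "cycle_edges c = forward_edges c \<union> backward_edges c"

text \<open>The graph has no multiple edges, so a cycle visits at least two classes.\<close>

definition is_cycle :: "('i \<times> 'j) set \<Rightarrow> ('i \<times> 'j) list \<Rightarrow> bool" where
  "is_cycle E c \<longleftrightarrow>
     2 \<le> length c \<and> distinct (map fst c) \<and> distinct (map snd c) \<and> cycle_edges c \<subseteq> E"

definition adjacency :: "('i \<times> 'j) set \<Rightarrow> (('i + 'j) \<times> ('i + 'j)) set" where
  "adjacency E = {(Inl i, Inr j) | i j. (i, j) \<in> E} \<union> {(Inr j, Inl i) | i j. (i, j) \<in> E}"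

definition is_tree :: "('i \<times> 'j) set \<Rightarrow> bool" where
  "is_tree E \<longleftrightarrow> (\<forall>u v. (u, v) \<in> (adjacency E)\<^sup>*) \<and> (\<nexists>c. is_cycle E c)"

text \<open>
  Each subgraph cycle with exactly one nonbasic edge has exactly one representing list headed by
  that edge; this list carries the required orientation.
\<close>

definition simple_cycles :: "('i \<times> 'j) set \<Rightarrow> ('i \<times> 'j) set \<Rightarrow> ('i \<times> 'j) list set" where
  "simple_cycles E Eb = {c. is_cycle E c \<and> cycle_edges c - Eb = {hd c}}"

definition edge_sign :: "('i \<times> 'j) list \<Rightarrow> 'i \<Rightarrow> 'j \<Rightarrow> real" where
  "edge_sign c i j = (if (i, j) \<in> forward_edges c then - 1 else 1)"

definition cycle_vec ::
  "('i::finite \<Rightarrow> 'j::finite \<Rightarrow> real) \<Rightarrow> ('i \<times> 'j) list \<Rightarrow> real ^ 'i"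
where
  "cycle_vec mu c = (\<chi> i. \<Sum>j | (i, j) \<in> cycle_edges c. edge_sign c i j * mu i j)"

text \<open>All processes are indexed by real time; only times \<open>t \<ge> 0\<close> are meaningful.\<close>

definition cadlag :: "(real \<Rightarrow> 'a::topological_space) \<Rightarrow> bool" where
  "cadlag g \<longleftrightarrow>
     (\<forall>t\<ge>0. (g \<longlongrightarrow> g t) (at_right t)) \<and> (\<forall>t>0. \<exists>l. (g \<longlongrightarrow> l) (at_left t))"

definition interarrival_times :: "'w measure \<Rightarrow> ('i \<Rightarrow> nat \<Rightarrow> 'w \<Rightarrow> real) \<Rightarrow> bool" where
  "interarrival_times M U \<longleftrightarrow>
     prob_space.indep_vars M (\<lambda>_. borel) (\<lambda>(i, k). U i k) (UNIV \<times> {1..}) \<and>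
     (\<forall>i. \<forall>k\<ge>1. distr M borel (U i k) = distr M borel (U i 1)) \<and>
     (\<forall>i. \<forall>k\<ge>1. AE \<omega> in M. U i k \<omega> > 0) \<and>
     (\<forall>i. \<forall>k\<ge>1. integrable M (U i k) \<and> prob_space.expectation M (U i k) = 1) \<and>
     (\<forall>i. \<forall>k\<ge>1. integrable M (\<lambda>\<omega>. (U i k \<omega>)\<^sup>2))"

text \<open>
  Almost surely the set below is finite, so that the supremum on type \<open>nat\<close> is its maximum.
\<close>

definition arrivals :: "(nat \<Rightarrow> 'w \<Rightarrow> real) \<Rightarrow> real \<Rightarrow> real \<Rightarrow> 'w \<Rightarrow> nat" where
  "arrivals u r t \<omega> = Sup {l. (\<Sum>k=1..l. u k \<omega> / r) \<le> t}"

text \<open>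
  Paths are almost surely monotone, hence the truncated subtraction on \<open>nat\<close> is the increment.
  The rate \<open>0\<close> is separate because \<^const>\<open>poisson_pmf\<close> is specified for positive rates only.
\<close>

definition poisson_process :: "'w measure \<Rightarrow> real \<Rightarrow> (real \<Rightarrow> 'w \<Rightarrow> nat) \<Rightarrow> bool" where
  "poisson_process M r S \<longleftrightarrow>
     (\<forall>t\<ge>0. S t \<in> M \<rightarrow>\<^sub>M count_space UNIV) \<and>
     (AE \<omega> in M. S 0 \<omega> = 0 \<and> mono_on {0..} (\<lambda>t. S t \<omega>) \<and> cadlag (\<lambda>t. S t \<omega>)) \<and>
     (if r = 0 then AE \<omega> in M. \<forall>t\<ge>0. S t \<omega> = 0
      else
        (\<forall>s t. 0 \<le> s \<longrightarrow> s < t \<longrightarrow>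
           distr M (count_space UNIV) (\<lambda>\<omega>. S t \<omega> - S s \<omega>) = measure_pmf (poisson_pmf (r * (t - s)))) \<and>
        (\<forall>(\<tau> :: nat \<Rightarrow> real) m. 0 \<le> \<tau> 0 \<longrightarrow> mono \<tau> \<longrightarrow>
           prob_space.indep_vars M (\<lambda>_. count_space UNIV)
             (\<lambda>k \<omega>. S (\<tau> (Suc k)) \<omega> - S (\<tau> k) \<omega>) {..<m}))"

text \<open>
  Joint independence of the arrival processes (index \<open>Inl i\<close>) and the service processes (index
  \<open>Inr (i, j)\<close>), each regarded as one random element of the space of \<open>nat\<close>-valued paths on
  \<open>[0, \<infinity>)\<close>.
\<close>

definition independent_primitives ::
  "'w measure \<Rightarrow> ('i \<Rightarrow> real \<Rightarrow> 'w \<Rightarrow> nat) \<Rightarrow> ('i \<Rightarrow> 'j \<Rightarrow> real \<Rightarrow> 'w \<Rightarrow> nat) \<Rightarrow> bool"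
where
  "independent_primitives M A S \<longleftrightarrow>
     prob_space.indep_vars M (\<lambda>_. Pi\<^sub>M {0..} (\<lambda>_. count_space UNIV))
       (\<lambda>p \<omega>. \<lambda>t\<in>{0..}. (case p of Inl i \<Rightarrow> A i t \<omega> | Inr (i, j) \<Rightarrow> S i j t \<omega>)) UNIV"

text \<open>
  Nonnegativity of queue lengths, idle servers and customers in service is enforced by the type
  \<open>nat\<close>; equation (b) is stated over the integers, since it involves subtraction.
\<close>

definition system_equations ::
  "('i \<times> 'j::finite) set \<Rightarrow> ('j \<Rightarrow> nat) \<Rightarrow> ('i::finite \<Rightarrow> nat) \<Rightarrow>
   ('i \<Rightarrow> real \<Rightarrow> nat) \<Rightarrow> ('i \<Rightarrow> 'j \<Rightarrow> real \<Rightarrow> nat) \<Rightarrow>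
   ('i \<Rightarrow> real \<Rightarrow> nat) \<Rightarrow> ('i \<Rightarrow> real \<Rightarrow> nat) \<Rightarrow> ('j \<Rightarrow> real \<Rightarrow> nat) \<Rightarrow> ('i \<Rightarrow> 'j \<Rightarrow> real \<Rightarrow> nat) \<Rightarrow> bool"
where
  "system_equations E N X0 A S X Y Z \<Psi> \<longleftrightarrow>
     (\<forall>i. cadlag (X i)) \<and> (\<forall>i. cadlag (Y i)) \<and> (\<forall>j. cadlag (Z j)) \<and> (\<forall>i j. cadlag (\<Psi> i j)) \<and>
     (\<forall>t\<ge>0.
        (\<forall>i j. (i, j) \<notin> E \<longrightarrow> \<Psi> i j t = 0) \<and>
        (\<forall>i. int (X i t) = int (X0 i) + int (A i t)
               - (\<Sum>j\<in>UNIV. int (S i j (integral {0..t} (\<lambda>s. real (\<Psi> i j s)))))) \<and>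
        (\<forall>i. Y i t + (\<Sum>j\<in>UNIV. \<Psi> i j t) = X i t) \<and>
        (\<forall>j. Z j t + (\<Sum>i\<in>UNIV. \<Psi> i j t) = N j))"

definition controlled_process ::
  "'w measure \<Rightarrow> ('i \<times> 'j::finite) set \<Rightarrow> ('j \<Rightarrow> nat) \<Rightarrow> ('i::finite \<Rightarrow> nat) \<Rightarrow>
   ('i \<Rightarrow> real \<Rightarrow> 'w \<Rightarrow> nat) \<Rightarrow> ('i \<Rightarrow> 'j \<Rightarrow> real \<Rightarrow> 'w \<Rightarrow> nat) \<Rightarrow>
   (('i \<Rightarrow> nat) \<Rightarrow> 'i \<Rightarrow> 'j \<Rightarrow> nat) \<Rightarrow>
   ('i \<Rightarrow> real \<Rightarrow> 'w \<Rightarrow> nat) \<Rightarrow> ('i \<Rightarrow> real \<Rightarrow> 'w \<Rightarrow> nat) \<Rightarrow> ('j \<Rightarrow> real \<Rightarrow> 'w \<Rightarrow> nat) \<Rightarrow>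
   ('i \<Rightarrow> 'j \<Rightarrow> real \<Rightarrow> 'w \<Rightarrow> nat) \<Rightarrow> bool"
where
  "controlled_process M E N X0 A S f X Y Z \<Psi> \<longleftrightarrow>
     (\<forall>i. \<forall>t\<ge>0. X i t \<in> M \<rightarrow>\<^sub>M count_space UNIV) \<and>
     (\<forall>i. \<forall>t\<ge>0. Y i t \<in> M \<rightarrow>\<^sub>M count_space UNIV) \<and>
     (\<forall>j. \<forall>t\<ge>0. Z j t \<in> M \<rightarrow>\<^sub>M count_space UNIV) \<and>
     (\<forall>i j. \<forall>t\<ge>0. \<Psi> i j t \<in> M \<rightarrow>\<^sub>M count_space UNIV) \<and>
     (AE \<omega> in M.
        system_equations E N X0 (\<lambda>i t. A i t \<omega>) (\<lambda>i j t. S i j t \<omega>)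
          (\<lambda>i t. X i t \<omega>) (\<lambda>i t. Y i t \<omega>) (\<lambda>j t. Z j t \<omega>) (\<lambda>i j t. \<Psi> i j t \<omega>) \<and>
        (\<forall>t\<ge>0. \<forall>i j. \<Psi> i j t \<omega> = f (\<lambda>i'. X i' t \<omega>) i j))"

text \<open>
  Being a preemptive resume policy is relative to the model data: the map must admit a controlled
  process.
\<close>

definition P_SCP ::
  "'w measure \<Rightarrow> ('i \<times> 'j::finite) set \<Rightarrow> ('j \<Rightarrow> nat) \<Rightarrow> ('i::finite \<Rightarrow> nat) \<Rightarrow>
   ('i \<Rightarrow> real \<Rightarrow> 'w \<Rightarrow> nat) \<Rightarrow> ('i \<Rightarrow> 'j \<Rightarrow> real \<Rightarrow> 'w \<Rightarrow> nat) \<Rightarrow>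
   (('i \<Rightarrow> nat) \<Rightarrow> 'i \<Rightarrow> 'j \<Rightarrow> nat) \<Rightarrow> bool"
where
  "P_SCP M E N X0 A S f \<longleftrightarrow> (\<exists>X Y Z \<Psi>. controlled_process M E N X0 A S f X Y Z \<Psi>)"

end

theory Submission
  imports Defs
begin

text \<open>
  Write \<open>x\<^sup>*\<close> for the fluid state, \<open>\<psi>\<^sup>*\<close> for the fluid allocation \<open>\<xi>\<^sup>*\<^sub>i\<^sub>j \<nu>\<^sub>j\<close> and \<open>D\<close> for the excess of the
  total population over \<open>n e \<cdot> x\<^sup>*\<close>. Adding \<open>a\<close> units along the cycle \<open>c\<close>, with the sign opposite to
  \<open>s(c, i, j)\<close>, changes neither the number of customers of a class that are in service nor the number
  of busy servers at a station, and it is feasible because it is positive on the only edge of \<open>c\<close> that carries no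
  fluid. It changes the total departure rate by \<open>- a (e \<cdot> m\<^sub>c) > 0\<close>. Thus a system without idle servers
  can serve faster than customers arrive, and the total population becomes controllable.

  The policy compares \<open>D\<close> with a threshold \<open>- \<theta>\<close>. Above the threshold the cycle is used with strength
  \<open>a\<close>, below it the cycle is not used. If \<open>D \<le> - \<theta> / 2\<close>, then there are at least \<open>\<theta> / 2\<close> more servers
  than customers up to lower order terms; since the basic activities connect all classes and stations, the
  allocation \<open>n \<psi>\<^sup>*\<close> can be corrected by a flow along basic activities so that all customers are in service and the
  surplus of servers is spread evenly over the stations, which leaves room for rounding
  (\<open>steering_allocation_exists\<close>).

  The scales are \<open>\<surd>n \<lless> b = n\<^bsup>12/16\<^esup> \<lless> \<theta> = n\<^bsup>13/16\<^esup> \<lless> a = n\<^bsup>15/16\<^esup> \<lless> n\<close>. The bound \<open>b\<close> dominates, with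
  probability tending to \<open>1\<close>, the deviation of all primitive processes from their means. It is so much
  larger than the diffusion scale that Chebyshev's inequality on a grid proves it, with no functional limit
  theorem. On this event everything is deterministic (\<open>control_drives_total_negative\<close>): since the
  cycle is used only while \<open>D > - \<theta>\<close>, the accumulated control is at most of order \<open>\<theta>\<close> plus the drift
  caused by the deviation itself, and Gronwall's inequality keeps the deviation of every class of order
  \<open>\<theta>\<close> on the finite horizon. The drift of \<open>D\<close> under control is of order \<open>- a\<close>, so \<open>D\<close> falls
  below \<open>- \<theta>\<close> in a time of order \<open>\<theta> / a \<rightarrow> 0\<close>; to rise from \<open>- \<theta>\<close> to \<open>- \<theta> / 2\<close> afterwards it would need
  noise of order \<open>\<theta>\<close>. Hence \<open>D \<le> - \<theta> / 2\<close> on \<open>[\<epsilon>, T]\<close>, and no customer waits.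

  A map is a policy only if it admits a controlled process. The system equations are a time-change
  equation for finitely many counting paths, and it is solved from one event to the next
  (\<open>clock_path_solves\<close>); the solution is measurable because
  every event time is
  (\<open>measurable_clock_path\<close>), and populations stay nonnegative because Poisson paths have unit jumps
  (\<open>feasible_policy_is_P_SCP\<close>).
\<close>

section \<open>Step paths\<close>

text \<open>
  For paths with values in a discrete space this is the cadlag property. In this form it passes to
  arbitrary functions of the path, in particular to the indicator that switches the control.
\<close>

definition step_path :: "(real \<Rightarrow> 'a) \<Rightarrow> bool" where
  "step_path g \<longleftrightarrow>
     (\<forall>t\<ge>0. \<forall>\<^sub>F s in at_right t. g s = g t) \<and> (\<forall>t>0. \<exists>l. \<forall>\<^sub>F s in at_left t. g s = l)"

lemma cadlag_nat_iff_step_path: "cadlag (g :: real \<Rightarrow> nat) \<longleftrightarrow> step_path g"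
  by (simp add: cadlag_def step_path_def tendsto_discrete)

lemma step_path_comp: "step_path g \<Longrightarrow> step_path (\<lambda>t. F (g t))"
  unfolding step_path_def by (fastforce elim: eventually_mono)

lemma step_path_family:
  fixes g :: "'i::finite \<Rightarrow> real \<Rightarrow> 'a"
  assumes "\<And>i. step_path (g i)"
  shows "step_path (\<lambda>t i. g i t)"
  unfolding step_path_def
proof (intro conjI allI impI)
  fix t :: real assume "t \<ge> 0"
  then have "\<forall>\<^sub>F s in at_right t. \<forall>i. g i s = g i t"
    using assms by (intro eventually_all_finite) (auto simp: step_path_def)
  then show "\<forall>\<^sub>F s in at_right t. (\<lambda>i. g i s) = (\<lambda>i. g i t)"
    by (simp add: fun_eq_iff)
next
  fix t :: real assume "t > 0"
  then have "\<forall>i. \<exists>l. \<forall>\<^sub>F s in at_left t. g i s = l"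
    using assms by (auto simp: step_path_def)
  then obtain l where "\<And>i. \<forall>\<^sub>F s in at_left t. g i s = l i" by metis
  then have "\<forall>\<^sub>F s in at_left t. \<forall>i. g i s = l i"
    by (intro eventually_all_finite)
  then show "\<exists>l. \<forall>\<^sub>F s in at_left t. (\<lambda>i. g i s) = l"
    by (auto simp: fun_eq_iff)
qed

text \<open>
  Near each point the path is constant on either side, so bisection (\<open>Bolzano\<close>) makes it
  piecewise constant on compact intervals.
\<close>

lemma step_path_integrable:
  fixes g :: "real \<Rightarrow> real"
  assumes g: "step_path g" and "0 \<le> a"
  shows "g integrable_on {a..b}"
proof (cases "a \<le> b")
  case True
  have const: "g integrable_on {c..d}" if "\<forall>s\<in>{c<..<d}. g s = l" for c d l
    using integrable_spike_finite[of "{c,d}" "{c..d}" g "\<lambda>_. l"] that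
    by (force intro: integrable_const_ivl)
  from True have "g integrable_on {max 0 a..max 0 b}"
  proof (induct rule: Bolzano)
    case (trans a b c)
    then show ?case
      by (intro Henstock_Kurzweil_Integration.integrable_combine[of "max 0 a" "max 0 b" "max 0 c"]) auto
  next
    case (local x)
    then have x: "x \<ge> 0" using \<open>0 \<le> a\<close> by simp
    obtain d1 where d1: "d1 > x" "\<And>s. x < s \<Longrightarrow> s < d1 \<Longrightarrow> g s = g x"
      using g x by (auto simp: step_path_def eventually_at_right_field)
    obtain d2 l where d2: "d2 < x" "\<And>s. d2 < s \<Longrightarrow> s < x \<Longrightarrow> 0 \<le> s \<Longrightarrow> g s = l"
    proof (cases "x = 0")
      case True
      then show ?thesis using that[of "-1"] by auto
    next
      case False
      then have "\<exists>l. \<forall>\<^sub>F s in at_left x. g s = l"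
        using g x by (simp add: step_path_def)
      then show ?thesis using that
        by (auto simp: eventually_at_left_field)
    qed
    show ?case
    proof (intro exI[of _ "min (d1 - x) (x - d2)"] conjI allI impI)
      show "0 < min (d1 - x) (x - d2)" using d1 d2 by simp
    next
      fix p q assume pq: "p \<le> x \<and> x \<le> q \<and> q - p < min (d1 - x) (x - d2)"
      then have "g integrable_on {max 0 p..x}"
        by (intro const[of _ _ l] ballI d2) auto
      moreover have "g integrable_on {x..max 0 q}"
        using pq x by (intro const[of _ _ "g x"] ballI d1) auto
      ultimately show "g integrable_on {max 0 p..max 0 q}"
        using pq x by (intro Henstock_Kurzweil_Integration.integrable_combine[of "max 0 p" x "max 0 q"]) auto
    qed
  qed
  then show ?thesis using \<open>0 \<le> a\<close> True by simp
next
  case False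
  then show ?thesis by (simp add: integrable_on_empty)
qed

section \<open>Steering the total population\<close>

text \<open>
  The supremum \<open>H\<close> of \<open>h r exp (- 2 K r)\<close> satisfies \<open>H \<le> A + H / 2\<close>: the weight has rate \<open>2 K\<close>, so that
  integration gains a factor \<open>1 / 2\<close>. No continuity of \<open>h\<close> is involved, which matters for paths with jumps.
\<close>

lemma gronwall_sup:
  fixes h :: "real \<Rightarrow> real"
  assumes "0 \<le> t" "0 \<le> A" "0 < K"
    and int: "h integrable_on {0..t}"
    and bd: "\<And>r. r \<in> {0..t} \<Longrightarrow> 0 \<le> h r \<and> h r \<le> M"
    and ineq: "\<And>r. r \<in> {0..t} \<Longrightarrow> h r \<le> A + K * integral {0..r} h"
  shows "h t \<le> 2 * A * exp (2 * K * t)"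
proof -
  define w where "w r = h r * exp (- (2 * K * r))" for r
  define H where "H = (SUP r\<in>{0..t}. w r)"
  have "w r \<le> M" if "r \<in> {0..t}" for r
  proof -
    have "w r \<le> h r * 1" unfolding w_def
      using bd[OF that] that assms by (intro mult_left_mono) auto
    then show ?thesis using bd[OF that] by simp
  qed
  then have bdd: "bdd_above (w ` {0..t})" by (intro bdd_aboveI2[of _ _ M])
  have le_H: "w r \<le> H" if "r \<in> {0..t}" for r
    unfolding H_def by (intro cSUP_upper that bdd)
  have "0 \<le> w 0" using bd[of 0] assms by (simp add: w_def)
  with le_H[of 0] have "0 \<le> H" using assms by auto
  have h_le: "h r \<le> H * exp (2 * K * r)" if "r \<in> {0..t}" for r
    using le_H[OF that] by (simp add: w_def exp_minus divide_simps)
  have "w r \<le> A + H / 2" if r: "r \<in> {0..t}" for r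
  proof -
    have hi: "((\<lambda>s. H * exp (2 * K * s)) has_integral
        (H / (2 * K)) * exp (2 * K * r) - (H / (2 * K)) * exp (2 * K * 0)) {0..r}"
      using r \<open>0 < K\<close>
      by (intro fundamental_theorem_of_calculus)
         (auto intro!: derivative_eq_intros simp: has_real_derivative_iff_has_vector_derivative[symmetric])
    have "integral {0..r} h \<le> integral {0..r} (\<lambda>s. H * exp (2 * K * s))"
      using r by (intro integral_le integrable_subinterval_real[OF int] has_integral_integrable[OF hi] h_le) auto
    also have "\<dots> = (H / (2 * K)) * exp (2 * K * r) - (H / (2 * K))"
      unfolding integral_unique[OF hi] by simp
    also have "\<dots> \<le> (H / (2 * K)) * exp (2 * K * r)" using \<open>0 \<le> H\<close> \<open>0 < K\<close> by simp
    finally have "K * integral {0..r} h \<le> K * ((H / (2 * K)) * exp (2 * K * r))"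
      using \<open>0 < K\<close> by (intro mult_left_mono) auto
    also have "\<dots> = H / 2 * exp (2 * K * r)" using \<open>0 < K\<close> by (simp add: field_simps)
    finally have "h r \<le> A + H / 2 * exp (2 * K * r)" using ineq[OF r] by simp
    then have "w r \<le> (A + H / 2 * exp (2 * K * r)) * exp (- (2 * K * r))"
      unfolding w_def by (intro mult_right_mono) auto
    also have "\<dots> = A * exp (- (2 * K * r)) + H / 2"
      by (simp add: algebra_simps flip: exp_add)
    also have "\<dots> \<le> A * 1 + H / 2"
      using assms r by (intro add_right_mono mult_left_mono) auto
    finally show ?thesis by simp
  qed
  then have "H \<le> A + H / 2" unfolding H_def using assms by (intro cSUP_least) auto
  then have "H \<le> 2 * A" by simp
  have "h t \<le> H * exp (2 * K * t)" using h_le assms by simp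
  also have "\<dots> \<le> 2 * A * exp (2 * K * t)" using \<open>H \<le> 2 * A\<close> by (intro mult_right_mono) auto
  finally show ?thesis .
qed

text \<open>
  An integral can grow only where its integrand is nonzero; after the last time at which it is at
  most \<open>B\<close> it is constant.
\<close>

lemma integral_saturates:
  fixes u :: "real \<Rightarrow> real"
  assumes "0 \<le> t" "0 \<le> B"
    and int: "u integrable_on {0..t}"
    and zero: "\<And>r. r \<in> {0..t} \<Longrightarrow> u r \<noteq> 0 \<Longrightarrow> integral {0..r} u \<le> B"
  shows "integral {0..t} u \<le> B"
proof (rule ccontr)
  define V where "V r = integral {0..r} u" for r
  assume "\<not> integral {0..t} u \<le> B"
  then have Vt: "V t > B" by (simp add: V_def)
  have cont: "continuous_on {0..t} V"
    unfolding V_def by (intro indefinite_integral_continuous_1 int)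
  have V0: "V 0 = 0" by (simp add: V_def)
  define L where "L = {0..t} \<inter> V -` {..B}"
  have "closed L" unfolding L_def
    by (intro continuous_closed_preimage cont) auto
  then have "compact L" unfolding L_def
    by (metis bounded_Int bounded_closed_interval compact_eq_bounded_closed)
  moreover have "L \<noteq> {}" using assms V0 by (auto simp: L_def)
  ultimately obtain \<sigma> where \<sigma>: "\<sigma> \<in> L" "\<And>s. s \<in> L \<Longrightarrow> s \<le> \<sigma>"
    by (meson compact_attains_sup)
  then have \<sigma>t: "0 \<le> \<sigma>" "\<sigma> \<le> t" "V \<sigma> \<le> B" by (auto simp: L_def)
  have "u r = 0" if "\<sigma> < r" "r \<le> t" for r
    using zero[of r] \<sigma>(2)[of r] that \<sigma>t by (force simp: L_def V_def)
  then have "(u has_integral 0) {\<sigma>..t}"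
    by (intro has_integral_spike_finite[of "{\<sigma>}" _ u "\<lambda>_. 0"]) auto
  then have "integral {\<sigma>..t} u = 0" by (rule integral_unique)
  moreover have "V \<sigma> + integral {\<sigma>..t} u = V t"
    unfolding V_def using \<sigma>t by (intro Henstock_Kurzweil_Integration.integral_combine int) auto
  ultimately show False using Vt \<sigma>t by simp
qed

text \<open>
  Here \<open>d\<close> is the vector of deviations of the class populations. While it is of size at most \<open>a\<close>, it
  moves in the direction \<open>m\<close> at speed \<open>a\<close> as long as its total exceeds \<open>- \<theta>\<close>, up to noise \<open>b\<close> and a drift
  that is at most linear in \<open>d\<close> and \<open>\<theta>\<close>.
\<close>

definition steered_increments ::
  "('i::finite \<Rightarrow> real) \<Rightarrow> real \<Rightarrow> real \<Rightarrow> real \<Rightarrow> real \<Rightarrow> real \<Rightarrow> (real \<Rightarrow> 'i \<Rightarrow> real) \<Rightarrow> bool" where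
  "steered_increments m C T b \<theta> a d \<longleftrightarrow>
     (\<forall>s t i. 0 \<le> s \<longrightarrow> s \<le> t \<longrightarrow> t \<le> T \<longrightarrow> (\<forall>r\<in>{0..<t}. (\<Sum>k\<in>UNIV. \<bar>d r k\<bar>) \<le> a) \<longrightarrow>
       \<bar>d t i - d s i - a * m i * integral {s..t} (\<lambda>r. if (\<Sum>k\<in>UNIV. d r k) > - \<theta> then 1 else 0)\<bar>
         \<le> C * (b + integral {s..t} (\<lambda>r. (\<Sum>k\<in>UNIV. \<bar>d r k\<bar>) + \<theta>)))"

text \<open>
  Let \<open>U\<close> be the time during which the control has acted. It has lowered the total by \<open>\<kappa> a U\<close>, but whenever
  it acts the total still exceeds \<open>- \<theta>\<close>; so \<open>\<kappa> a U\<close> is bounded by \<open>\<theta>\<close>, the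
  noise and the integrated drift. Inserted into the equation of each coordinate this gives a Gronwall inequality and
  \<open>\<bar>d\<bar> \<le> K\<^sub>2 \<theta>\<close>. With \<open>\<bar>d\<bar>\<close> of order \<open>\<theta> \<lless> a\<close> the control dominates the drift, and it
  suffices to look back to the last time at which the total was at most \<open>- \<theta>\<close>. The constant \<open>K\<close> depends only on \<open>m\<close>, \<open>C\<close>, \<open>T\<close> and \<open>\<epsilon>\<close>, so
  that the lemma applies to all large systems at once.
\<close>

lemma control_drives_total_negative:
  fixes m :: "'i::finite \<Rightarrow> real" and \<kappa> C T \<epsilon> :: real
  assumes m: "(\<Sum>i\<in>UNIV. m i) = - \<kappa>" and "0 < \<kappa>" "0 < C" "0 < T" "0 < \<epsilon>"
  shows "\<exists>K>0. \<forall>(d :: real \<Rightarrow> 'i \<Rightarrow> real) b \<theta> a.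
     step_path d \<longrightarrow> 0 < b \<longrightarrow> K * b \<le> \<theta> \<longrightarrow> K * \<theta> \<le> a \<longrightarrow> (\<forall>i. \<bar>d 0 i\<bar> \<le> C * b) \<longrightarrow>
     steered_increments m C T b \<theta> a d \<longrightarrow>
     (\<forall>t\<in>{\<epsilon>..T}. (\<Sum>k\<in>UNIV. d t k) \<le> - \<theta> / 2 \<and> (\<Sum>k\<in>UNIV. \<bar>d t k\<bar>) \<le> a)"
proof -
  define c where "c = real CARD('i) * C"
  define mm where "mm = (\<Sum>i\<in>UNIV. \<bar>m i\<bar>)"
  define K1 where "K1 = 1 + 2 * c + (mm / \<kappa>) * (1 + 3 * c)"
  define K2 where "K2 = 2 * K1 * exp (2 * K1 * T)"
  \<comment> \<open>in this order the summands give \<open>b \<le> \<theta> \<le> a\<close>, noise below \<open>\<theta> / 4\<close>, \<open>\<bar>d\<bar> \<le> a\<close>, a descent within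
    time \<open>\<epsilon>\<close>, and a control stronger than the drift\<close>
  define K where "K = 1 + 4 * c + K2 + (1 + 2 * c + c * K2 * T) / (\<kappa> * \<epsilon>) + c * K2 / \<kappa>"
  have c: "c > 0" using assms by (simp add: c_def)
  have mm: "mm \<ge> 0" by (simp add: mm_def sum_nonneg)
  have K1: "K1 \<ge> 1" using c mm assms by (auto simp: K1_def intro!: add_nonneg_nonneg)
  then have K2: "K2 > 0" by (simp add: K2_def)
  have parts: "0 < (1 + 2 * c + c * K2 * T) / (\<kappa> * \<epsilon>)" "0 < c * K2 / \<kappa>"
    using c K2 assms by (auto intro!: divide_pos_pos add_pos_pos)
  have K: "K \<ge> 1" "K \<ge> 4 * c" "K \<ge> K2" "K \<ge> (1 + 2 * c + c * K2 * T) / (\<kappa> * \<epsilon>)" "K \<ge> c * K2 / \<kappa>"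
    using parts c K2 unfolding K_def by linarith+
  show ?thesis
  proof (intro exI[of _ K] conjI allI impI ballI)
    show "K > 0" using K by simp
  next
    fix d :: "real \<Rightarrow> 'i \<Rightarrow> real" and b \<theta> a
    assume d: "step_path d" and b: "0 < b" "K * b \<le> \<theta>" and a: "K * \<theta> \<le> a"
      and d0: "\<forall>i. \<bar>d 0 i\<bar> \<le> C * b"
      and incr: "steered_increments m C T b \<theta> a d"
    define D where "D r = (\<Sum>k\<in>UNIV. d r k)" for r
    define N where "N r = (\<Sum>k\<in>UNIV. \<bar>d r k\<bar>)" for r
    define h where "h r = N r + \<theta>" for r
    define u :: "real \<Rightarrow> real" where "u r = (if D r > - \<theta> then 1 else 0)" for r
    have b\<theta>: "b \<le> \<theta>" "4 * c * b \<le> \<theta>"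
      using b mult_right_mono[OF K(1), of b] mult_right_mono[OF K(2), of b] by linarith+
    have \<theta>: "\<theta> > 0" using b\<theta> b by simp
    have \<theta>a: "\<theta> \<le> a" "K2 * \<theta> \<le> a" using a \<theta> mult_right_mono[OF K(1), of \<theta>] mult_right_mono[OF K(3), of \<theta>]
      by linarith+
    have a1: "(1 + 2 * c + c * K2 * T) * \<theta> \<le> \<kappa> * \<epsilon> * a"
    proof -
      have "(1 + 2 * c + c * K2 * T) / (\<kappa> * \<epsilon>) * \<theta> \<le> a"
        using mult_right_mono[OF K(4), of \<theta>] a \<theta> by linarith
      then show ?thesis using assms by (simp add: divide_simps mult_ac split: if_splits)
    qed
    have a2: "c * K2 * \<theta> \<le> \<kappa> * a"
    proof -
      have "c * K2 / \<kappa> * \<theta> \<le> a" using mult_right_mono[OF K(5), of \<theta>] a \<theta> by linarith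
      then show ?thesis using assms by (simp add: divide_simps mult_ac split: if_splits)
    qed
    have N0: "N r \<ge> 0" for r by (simp add: N_def sum_nonneg)
    have h\<theta>: "h r \<ge> \<theta>" for r using N0 by (simp add: h_def)
    have hint: "h integrable_on {s..t}" if "0 \<le> s" for s t
    proof (rule step_path_integrable[OF _ that])
      show "step_path h"
        using step_path_comp[OF d, of "\<lambda>x. (\<Sum>k\<in>UNIV. \<bar>x k\<bar>) + \<theta>"] by (simp add: h_def[abs_def] N_def)
    qed
    have uint: "u integrable_on {s..t}" if "0 \<le> s" for s t
    proof (rule step_path_integrable[OF _ that])
      show "step_path u"
        using step_path_comp[OF d, of "\<lambda>x. if (\<Sum>k\<in>UNIV. x k) > - \<theta> then 1 else (0::real)"]
        by (simp add: u_def[abs_def] D_def)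
    qed
    have hpos: "integral {s..t} h \<ge> 0" if "0 \<le> s" for s t
      using hint[OF that] h\<theta> \<theta> by (intro integral_nonneg) (auto intro: order_trans[OF less_imp_le])
    have upos: "integral {s..t} u \<ge> 0" if "0 \<le> s" for s t
      using uint[OF that] by (intro integral_nonneg) (auto simp: u_def)
    have hmono: "integral {0..s} h \<le> integral {0..t} h" if "0 \<le> s" "s \<le> t" for s t
      using hint[of 0] h\<theta> \<theta> that
      by (intro integral_subset_le) (auto intro: order_trans[OF less_imp_le])
    have inc: "\<bar>d t i - d s i - a * m i * integral {s..t} u\<bar> \<le> C * (b + integral {s..t} h)"
      if "0 \<le> s" "s \<le> t" "t \<le> T" "\<forall>r\<in>{0..<t}. N r \<le> a" for s t i
      using incr[unfolded steered_increments_def, rule_format, of s t i] that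
      unfolding u_def[abs_def] h_def[abs_def] D_def[abs_def] N_def[abs_def] by simp
    have incD: "\<bar>D t - D s + \<kappa> * a * integral {s..t} u\<bar> \<le> c * (b + integral {s..t} h)"
      if "0 \<le> s" "s \<le> t" "t \<le> T" "\<forall>r\<in>{0..<t}. N r \<le> a" for s t
    proof -
      have "D t - D s + \<kappa> * a * integral {s..t} u
          = (\<Sum>i\<in>UNIV. d t i - d s i - a * m i * integral {s..t} u)"
        using m by (simp add: D_def sum_subtractf flip: sum_distrib_left sum_distrib_right)
      also have "\<bar>\<dots>\<bar> \<le> (\<Sum>i\<in>(UNIV::'i set). C * (b + integral {s..t} h))"
        by (intro order_trans[OF sum_abs] sum_mono inc that)
      finally show ?thesis by (simp add: c_def mult_ac)
    qed
    have N0b: "N 0 \<le> c * b"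
      unfolding N_def using sum_mono[of UNIV "\<lambda>i. \<bar>d 0 i\<bar>" "\<lambda>_. C * b"] d0 by (simp add: c_def mult_ac)
    have D0: "\<bar>D 0\<bar> \<le> c * b"
      using sum_abs[of "d 0" UNIV] N0b unfolding N_def D_def by linarith
    \<comment> \<open>the accumulated control is paid for by the total, which exceeds \<open>- \<theta>\<close> whenever the control acts\<close>
    have effort: "\<kappa> * a * integral {0..t} u \<le> \<theta> + 2 * c * b + c * integral {0..t} h"
      if t: "0 \<le> t" "t \<le> T" "\<forall>r\<in>{0..<t}. N r \<le> a" for t
    proof -
      have "\<kappa> * a > 0" using assms \<theta> \<theta>a by simp
      have "integral {0..t} u \<le> (\<theta> + 2 * c * b + c * integral {0..t} h) / (\<kappa> * a)"
      proof (rule integral_saturates)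
        show "0 \<le> (\<theta> + 2 * c * b + c * integral {0..t} h) / (\<kappa> * a)"
          using \<open>\<kappa> * a > 0\<close> \<theta> c b hpos[of 0 t] by (intro divide_nonneg_pos) auto
        fix r assume r: "r \<in> {0..t}" "u r \<noteq> 0"
        then have "D r > - \<theta>" by (simp add: u_def split: if_splits)
        moreover have "\<bar>D r - D 0 + \<kappa> * a * integral {0..r} u\<bar> \<le> c * (b + integral {0..r} h)"
          using r t by (intro incD) auto
        moreover have "c * (b + integral {0..r} h) \<le> c * (b + integral {0..t} h)"
          using hmono[of r t] r c by (intro mult_left_mono) auto
        ultimately have "\<kappa> * a * integral {0..r} u \<le> \<theta> + 2 * c * b + c * integral {0..t} h"
          using D0 by (simp add: algebra_simps)
        then show "integral {0..r} u \<le> (\<theta> + 2 * c * b + c * integral {0..t} h) / (\<kappa> * a)"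
          using \<open>\<kappa> * a > 0\<close> by (simp add: pos_le_divide_eq mult_ac)
      qed (use t uint in auto)
      then show ?thesis using \<open>\<kappa> * a > 0\<close> by (simp add: pos_le_divide_eq mult_ac)
    qed
    have pre: "h t \<le> K1 * \<theta> + K1 * integral {0..t} h"
      if t: "0 \<le> t" "t \<le> T" "\<forall>r\<in>{0..<t}. N r \<le> a" for t
    proof -
      let ?H = "integral {0..t} h" and ?U = "integral {0..t} u"
      have "\<bar>d t i\<bar> \<le> \<bar>d 0 i\<bar> + \<bar>m i\<bar> * (a * ?U) + C * (b + ?H)" for i
      proof -
        have "\<bar>a * m i * ?U\<bar> = \<bar>m i\<bar> * (a * ?U)"
          using upos[of 0 t] \<theta> \<theta>a by (simp add: abs_mult)
        then show ?thesis using inc[of 0 t i] t by linarith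
      qed
      then have "N t \<le> (\<Sum>i\<in>UNIV. \<bar>d 0 i\<bar> + \<bar>m i\<bar> * (a * ?U) + C * (b + ?H))"
        unfolding N_def by (rule sum_mono)
      also have "\<dots> = N 0 + mm * (a * ?U) + c * (b + ?H)"
        by (simp add: sum.distrib N_def mm_def c_def sum_distrib_right)
      finally have 1: "N t \<le> c * b + mm * (a * ?U) + c * (b + ?H)" using N0b by simp
      have "a * ?U \<le> (\<theta> + 2 * c * b + c * ?H) / \<kappa>"
        using effort[OF t] assms by (simp add: pos_le_divide_eq mult_ac)
      also have "\<dots> \<le> (\<theta> + 2 * c * \<theta> + c * ?H) / \<kappa>"
        using c b\<theta> assms by (intro divide_right_mono) auto
      also have "\<dots> \<le> ((1 + 3 * c) * \<theta> + (1 + 3 * c) * ?H) / \<kappa>"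
        using c \<theta> assms hpos[of 0 t] by (intro divide_right_mono) (auto simp: algebra_simps)
      finally have "mm * (a * ?U) \<le> mm * (((1 + 3 * c) * \<theta> + (1 + 3 * c) * ?H) / \<kappa>)"
        using mm by (intro mult_left_mono)
      also have "\<dots> = (mm / \<kappa>) * (1 + 3 * c) * \<theta> + (mm / \<kappa>) * (1 + 3 * c) * ?H"
        by (simp add: add_divide_distrib algebra_simps)
      finally have 2: "mm * (a * ?U) \<le> (mm / \<kappa>) * (1 + 3 * c) * \<theta> + (mm / \<kappa>) * (1 + 3 * c) * ?H" .
      have 3: "c * b \<le> c * \<theta>" using b\<theta> c by simp
      have "0 \<le> c * ?H" "0 \<le> ?H" using c hpos[of 0 t] by auto
      then show ?thesis using 1 2 3 unfolding h_def[of t] K1_def by (simp add: algebra_simps)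
    qed
    have hbound: "h t \<le> K2 * \<theta>" if t: "0 \<le> t" "t \<le> T" "\<forall>r\<in>{0..<t}. N r \<le> a" for t
    proof -
      have "h t \<le> 2 * (K1 * \<theta>) * exp (2 * K1 * t)"
      proof (rule gronwall_sup[where M = "max (a + \<theta>) (h t)"])
        fix r assume "r \<in> {0..t}"
        then show "0 \<le> h r \<and> h r \<le> max (a + \<theta>) (h t)"
          using t h\<theta>[of r] \<theta> by (cases "r = t") (force simp: h_def)+
        show "h r \<le> K1 * \<theta> + K1 * integral {0..r} h"
          using \<open>r \<in> {0..t}\<close> t by (intro pre) auto
      qed (use t K1 \<theta> hint in auto)
      also have "\<dots> \<le> 2 * (K1 * \<theta>) * exp (2 * K1 * T)"
        using t K1 \<theta> by (intro mult_left_mono) auto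
      finally show ?thesis by (simp add: K2_def mult_ac)
    qed
    \<comment> \<open>first exit: at the infimum of the exit times \<open>hbound\<close> still applies, and the path is constant just afterwards\<close>
    have Na: "N t \<le> a" if "t \<in> {0..T}" for t
    proof (rule ccontr)
      assume "\<not> N t \<le> a"
      define B where "B = {r\<in>{0..T}. N r > a}"
      have B: "B \<noteq> {}" "bdd_below B" using that \<open>\<not> N t \<le> a\<close> by (auto simp: B_def)
      define \<sigma> where "\<sigma> = Inf B"
      have "t \<in> B" using that \<open>\<not> N t \<le> a\<close> by (simp add: B_def)
      then have "\<sigma> \<le> t" unfolding \<sigma>_def using B by (intro cInf_lower)
      moreover have "0 \<le> \<sigma>" unfolding \<sigma>_def using B by (intro cInf_greatest) (auto simp: B_def)
      ultimately have \<sigma>: "0 \<le> \<sigma>" "\<sigma> \<le> T" using that by auto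
      have before: "\<forall>r\<in>{0..<\<sigma>}. N r \<le> a"
      proof
        fix r assume r: "r \<in> {0..<\<sigma>}"
        then have "r \<notin> B" using cInf_lower[OF _ B(2), of r] unfolding \<sigma>_def[symmetric] by auto
        then show "N r \<le> a" using r \<sigma> by (auto simp: B_def)
      qed
      have "N \<sigma> \<le> a" using hbound[OF \<sigma> before] \<theta>a \<theta> by (simp add: h_def)
      obtain q where q: "q > \<sigma>" "\<And>s. \<sigma> < s \<Longrightarrow> s < q \<Longrightarrow> d s = d \<sigma>"
        using d \<sigma> by (auto simp: step_path_def eventually_at_right_field)
      obtain r where r: "r \<in> B" "r < q"
        using q(1) B unfolding \<sigma>_def by (meson cInf_lessD)
      have "\<sigma> \<le> r" unfolding \<sigma>_def using r B by (intro cInf_lower)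
      then have "N r = N \<sigma>" using q r by (cases "r = \<sigma>") (auto simp: N_def)
      then show False using r \<open>N \<sigma> \<le> a\<close> by (simp add: B_def)
    qed
    have incD': "D t - D s \<le> - (\<kappa> * a * integral {s..t} u) + c * b + c * K2 * \<theta> * (t - s)"
      if "0 \<le> s" "s \<le> t" "t \<le> T" for s t
    proof -
      have "integral {s..t} h \<le> integral {s..t} (\<lambda>_. K2 * \<theta>)"
        using that hint by (intro integral_le hbound) (auto intro!: Na)
      then have "c * integral {s..t} h \<le> c * (K2 * \<theta> * (t - s))"
        using c that by (intro mult_left_mono) (auto simp: mult_ac)
      moreover have "\<bar>D t - D s + \<kappa> * a * integral {s..t} u\<bar> \<le> c * (b + integral {s..t} h)"
        using that by (intro incD) (auto intro!: Na)
      ultimately show ?thesis by (simp add: algebra_simps)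
    qed
    fix t assume t: "t \<in> {\<epsilon>..T}"
    then have t0: "0 < t" using assms by simp
    have "D t \<le> - \<theta> / 2"
    proof (cases "\<exists>s\<in>{0..<t}. D s \<le> - \<theta>")
      \<comment> \<open>the control has acted without pause, for a time of at least \<open>\<epsilon>\<close>\<close>
      case False
      then have "integral {0..t} u = integral {0..t} (\<lambda>_. 1)"
        by (intro integral_spike[of "{t}"]) (auto simp: u_def not_le)
      then have U: "integral {0..t} u = t" using t0 by simp
      have "D t \<le> c * b - \<kappa> * a * t + c * b + c * K2 * \<theta> * t"
      proof -
        have "D t - D 0 \<le> - (\<kappa> * a * t) + c * b + c * K2 * \<theta> * (t - 0)"
          using incD'[of 0 t] t t0 unfolding U by auto
        then show ?thesis using D0 by (simp only: diff_0_right abs_le_iff) linarith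
      qed
      also have "\<dots> \<le> c * \<theta> - \<kappa> * a * \<epsilon> + c * \<theta> + c * K2 * \<theta> * T"
        using t c K2 \<theta> \<theta>a b\<theta> assms
        by (intro add_mono diff_mono mult_left_mono mult_right_mono) auto
      also have "\<dots> \<le> - \<theta>" using a1 by (simp add: algebra_simps)
      finally show ?thesis using \<theta> by simp
    next
      case True
      define L where "L = {s\<in>{0..<t}. D s \<le> - \<theta>}"
      have L: "L \<noteq> {}" "bdd_above L" using True by (auto simp: L_def intro!: bdd_aboveI[of _ t])
      define l where "l = Sup L"
      \<comment> \<open>the supremum \<open>l\<close> need not be attained; starting at most \<open>\<eta>\<close> before it costs a drift of \<open>\<theta> / 8\<close>\<close>
      define \<eta> where "\<eta> = 1 / (8 * c * K2)"
      have \<eta>: "\<eta> > 0" using c K2 by (simp add: \<eta>_def)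
      obtain s where s: "s \<in> L" "l - \<eta> < s"
        using less_cSupD[OF L(1), of "l - \<eta>"] \<eta> unfolding l_def by auto
      have sl: "s \<le> l" unfolding l_def using s L by (intro cSup_upper)
      have lt: "l \<le> t" unfolding l_def using L(1) by (intro cSup_least) (auto simp: L_def)
      have s0: "0 \<le> s" "D s \<le> - \<theta>" using s by (auto simp: L_def)
      have u1: "u r = 1" if "l < r" "r < t" for r
      proof -
        have "r \<notin> L" using that cSup_upper[OF _ L(2), of r] by (auto simp: l_def)
        then show ?thesis using that s0 sl by (auto simp: L_def u_def)
      qed
      have "integral {l..t} u = integral {l..t} (\<lambda>_. 1)"
        using u1 by (intro integral_spike[of "{l, t}"]) auto
      then have "integral {l..t} u = t - l" using lt by simp
      moreover have "integral {l..t} u \<le> integral {s..t} u"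
        using sl s0 uint by (intro integral_subset_le) (auto simp: u_def)
      ultimately have U: "t - l \<le> integral {s..t} u" by simp
      have "\<kappa> * a * (t - l) \<le> \<kappa> * a * integral {s..t} u"
        using U assms \<theta> \<theta>a by (intro mult_left_mono) auto
      then have "D t \<le> - \<theta> - \<kappa> * a * (t - l) + c * b + c * K2 * \<theta> * (t - s)"
      proof -
        have "D t - D s \<le> - (\<kappa> * a * integral {s..t} u) + c * b + c * K2 * \<theta> * (t - s)"
          using s0 sl lt t by (intro incD') auto
        then show ?thesis using s0 \<open>\<kappa> * a * (t - l) \<le> _\<close> by linarith
      qed
      also have "\<dots> = - \<theta> - (\<kappa> * a - c * K2 * \<theta>) * (t - l) + c * b + c * K2 * \<theta> * (l - s)"
        by (simp add: algebra_simps)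
      also have "\<dots> \<le> - \<theta> - 0 + c * b + c * K2 * \<theta> * \<eta>"
        using a2 lt s sl c K2 \<theta> by (intro add_mono diff_mono mult_left_mono mult_nonneg_nonneg) auto
      also have "c * K2 * \<theta> * \<eta> = \<theta> / 8" using c K2 by (simp add: \<eta>_def)
      also have "- \<theta> - 0 + c * b + \<theta> / 8 \<le> - \<theta> / 2" using b\<theta> \<theta> by simp
      finally show ?thesis .
    qed
    then show "(\<Sum>k\<in>UNIV. d t k) \<le> - \<theta> / 2" by (simp add: D_def)
    show "(\<Sum>k\<in>UNIV. \<bar>d t k\<bar>) \<le> a" using Na[of t] t t0 by (simp add: N_def)
  qed
qed

section \<open>Cycles, flows and allocations\<close>

definition cycle_sign :: "('i \<times> 'j) list \<Rightarrow> 'i \<Rightarrow> 'j \<Rightarrow> real" where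
  "cycle_sign c i j = (if (i, j) \<in> cycle_edges c then edge_sign c i j else 0)"

lemma bij_betw_cyclic_shift: "bij_betw (\<lambda>l. Suc l mod n) {..<n} {..<n}"
proof -
  have "inj_on (\<lambda>l. Suc l mod n) {..<n}"
    by (auto simp: inj_on_def mod_Suc split: if_splits)
  moreover have "(\<lambda>l. Suc l mod n) ` {..<n} \<subseteq> {..<n}" by auto
  ultimately show ?thesis
    by (simp add: bij_betw_def endo_inj_surj)
qed

text \<open>
  Each edge of a cycle occurs exactly once, either forward or backward, because the classes and the
  stations of the list are distinct and there are at least two of them. In the form of a sum the
  balance at each vertex becomes a cancellation.
\<close>

lemma cycle_sign_eq_sum:
  assumes "is_cycle E c"
  shows "cycle_sign c i j = (\<Sum>l<length c.
    of_bool (i = fst (c ! (Suc l mod length c)) \<and> j = snd (c ! l)) - of_bool (i = fst (c ! l) \<and> j = snd (c ! l)))"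
proof -
  let ?n = "length c"
  let ?b = "\<lambda>l. i = fst (c ! (Suc l mod ?n)) \<and> j = snd (c ! l)"
  let ?f = "\<lambda>l. i = fst (c ! l) \<and> j = snd (c ! l)"
  have n: "2 \<le> ?n" and df: "distinct (map fst c)" and ds: "distinct (map snd c)"
    using assms by (auto simp: is_cycle_def)
  have snd_inj: "l = l'" if "l < ?n" "l' < ?n" "snd (c ! l) = snd (c ! l')" for l l'
    using ds that by (simp add: distinct_conv_nth) metis
  have fst_inj: "l = l'" if "l < ?n" "l' < ?n" "fst (c ! l) = fst (c ! l')" for l l'
    using df that by (simp add: distinct_conv_nth) metis
  have shift: "Suc l mod ?n \<noteq> l" if "l < ?n" for l
    using n that by (auto simp: mod_Suc)
  have single: "(\<Sum>l<?n. of_bool (P l) :: real) = of_bool (\<exists>l<?n. P l)"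
    if "\<And>l. P l \<Longrightarrow> j = snd (c ! l)" for P
  proof (cases "\<exists>l<?n. P l")
    case True
    then obtain k where k: "k < ?n" "P k" by blast
    have uniq: "P l \<longleftrightarrow> l = k" if "l < ?n" for l
      using snd_inj[OF that k(1)] k \<open>\<And>l. P l \<Longrightarrow> j = snd (c ! l)\<close> by metis
    have "of_bool (P l) = (if l = k then 1 else 0 :: real)" if "l < ?n" for l
      by (simp add: uniq[OF that])
    then have "(\<Sum>l<?n. of_bool (P l) :: real) = (\<Sum>l<?n. if l = k then 1 else 0)"
      by (intro sum.cong) auto
    then show ?thesis using k by (auto simp: sum.delta)
  qed (auto intro!: sum.neutral)
  have fwd: "(i, j) \<in> forward_edges c \<longleftrightarrow> (\<exists>l<?n. ?f l)"
    by (auto simp: forward_edges_def prod_eq_iff)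
  have bwd: "(i, j) \<in> backward_edges c \<longleftrightarrow> (\<exists>l<?n. ?b l)"
    by (auto simp: backward_edges_def)
  have disj: "\<not> ((\<exists>l<?n. ?f l) \<and> (\<exists>l<?n. ?b l))"
  proof
    assume "(\<exists>l<?n. ?f l) \<and> (\<exists>l<?n. ?b l)"
    then obtain l k where lk: "l < ?n" "k < ?n" "?f l" "?b k" by blast
    then have "l = k" using snd_inj by metis
    moreover have "Suc l mod ?n < ?n" using lk by (intro mod_less_divisor) auto
    ultimately have "Suc l mod ?n = l" using lk by (intro fst_inj) auto
    then show False using shift lk by blast
  qed
  have "(\<Sum>l<?n. of_bool (?b l) - of_bool (?f l) :: real)
      = of_bool (\<exists>l<?n. ?b l) - of_bool (\<exists>l<?n. ?f l)"
  proof -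
    have "(\<Sum>l<?n. of_bool (?b l) :: real) = of_bool (\<exists>l<?n. ?b l)" by (rule single) auto
    moreover have "(\<Sum>l<?n. of_bool (?f l) :: real) = of_bool (\<exists>l<?n. ?f l)" by (rule single) auto
    ultimately show ?thesis by (simp only: sum_subtractf)
  qed
  also have "\<dots> = cycle_sign c i j"
    using disj by (auto simp: cycle_sign_def cycle_edges_def edge_sign_def fwd bwd)
  finally show ?thesis by simp
qed

lemma cycle_sign_row_sum:
  fixes i :: "'i::finite" and c :: "('i \<times> 'j::finite) list"
  assumes "is_cycle E c"
  shows "(\<Sum>j\<in>UNIV. cycle_sign c i j) = 0"
proof -
  let ?n = "length c"
  have one: "(\<Sum>j\<in>UNIV. of_bool (P \<and> j = q) :: real) = of_bool P" for P and q :: 'j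
    by (cases P) (simp_all add: of_bool_def)
  have "(\<Sum>j\<in>UNIV. cycle_sign c i j)
     = (\<Sum>l<?n. of_bool (i = fst (c ! (Suc l mod ?n)))) - (\<Sum>l<?n. of_bool (i = fst (c ! l)))"
    unfolding cycle_sign_eq_sum[OF assms]
    by (subst sum.swap) (simp add: sum_subtractf one)
  also have "(\<Sum>l<?n. of_bool (i = fst (c ! (Suc l mod ?n)))) = (\<Sum>l<?n. of_bool (i = fst (c ! l)) :: real)"
    using sum.reindex_bij_betw[OF bij_betw_cyclic_shift, of "\<lambda>l. of_bool (i = fst (c ! l)) :: real" ?n] .
  finally show ?thesis by simp
qed

lemma cycle_sign_column_sum:
  fixes j :: "'j::finite" and c :: "('i::finite \<times> 'j) list"
  assumes "is_cycle E c"
  shows "(\<Sum>i\<in>UNIV. cycle_sign c i j) = 0"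
proof -
  have one: "(\<Sum>i\<in>UNIV. of_bool (i = q \<and> P) :: real) = of_bool P" for P and q :: 'i
    by (cases P) (simp_all add: of_bool_def)
  show ?thesis
    unfolding cycle_sign_eq_sum[OF assms]
    by (subst sum.swap) (simp add: sum_subtractf one)
qed

lemma cycle_vec_eq_cycle_sign:
  "cycle_vec mu c $ i = (\<Sum>j\<in>UNIV. cycle_sign c i j * mu i j)"
  unfolding cycle_vec_def cycle_sign_def
  by (simp add: if_distrib[of "\<lambda>x. x * _"] sum.If_cases cong: if_cong)

text \<open>
  A path from class \<open>i\<close> to a vertex \<open>v\<close> carries one unit of flow: an edge passed from its class to its station
  gets \<open>1\<close>, an edge passed in the other direction gets \<open>- 1\<close>.
\<close>

lemma unit_flow_along_path:
  fixes B :: "('i::finite \<times> 'j::finite) set"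
  assumes "(Inl i, v) \<in> (adjacency B)\<^sup>*"
  shows "\<exists>p :: 'i \<Rightarrow> 'j \<Rightarrow> real. (\<forall>k l. (k, l) \<notin> B \<longrightarrow> p k l = 0) \<and>
    (\<forall>k. (\<Sum>l\<in>UNIV. p k l) = of_bool (k = i) - of_bool (Inl k = v)) \<and>
    (\<forall>l. (\<Sum>k\<in>UNIV. p k l) = of_bool (Inr l = v))"
  using assms
proof (induction rule: rtrancl_induct)
  case base
  show ?case by (intro exI[of _ "\<lambda>_ _. 0"]) auto
next
  case (step v w)
  obtain p :: "'i \<Rightarrow> 'j \<Rightarrow> real" where p: "\<And>k l. (k, l) \<notin> B \<Longrightarrow> p k l = 0"
    "\<And>k. (\<Sum>l\<in>UNIV. p k l) = of_bool (k = i) - of_bool (Inl k = v)"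
    "\<And>l. (\<Sum>k\<in>UNIV. p k l) = of_bool (Inr l = v)"
    using step.IH by blast
  obtain i' j' where e: "(i', j') \<in> B" "v = Inl i' \<and> w = Inr j' \<or> v = Inr j' \<and> w = Inl i'"
    using step.hyps(2) by (auto simp: adjacency_def)
  define \<sigma> :: real where "\<sigma> = (if v = Inl i' then 1 else - 1)"
  define q where "q k l = p k l + \<sigma> * of_bool (k = i' \<and> l = j')" for k l
  have 1: "(\<Sum>l\<in>UNIV. of_bool (k = i' \<and> l = j') :: real) = of_bool (k = i')" for k
    by (cases "k = i'") (simp_all add: of_bool_def)
  have 2: "(\<Sum>k\<in>UNIV. of_bool (k = i' \<and> l = j') :: real) = of_bool (l = j')" for l
    by (cases "l = j'") (simp_all add: of_bool_def)
  show ?case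
    by (rule exI[of _ q])
       (use e in \<open>auto simp: q_def p 1 2 \<sigma>_def sum.distrib simp flip: sum_distrib_left\<close>)
qed

text \<open>
  Average the unit flows from class \<open>k\<close> to all stations and superpose them with weights \<open>d k\<close>. The result
  depends linearly on \<open>d\<close>, whence the bound, and it loads all stations equally.
\<close>

lemma balanced_flow_exists:
  fixes B :: "('i::finite \<times> 'j::finite) set"
  assumes "\<forall>u v. (u, v) \<in> (adjacency B)\<^sup>*"
  shows "\<exists>(F :: ('i \<Rightarrow> real) \<Rightarrow> 'i \<Rightarrow> 'j \<Rightarrow> real) C. 0 \<le> C \<and> (\<forall>d.
    (\<forall>i j. (i, j) \<notin> B \<longrightarrow> F d i j = 0) \<and>
    (\<forall>i. (\<Sum>j\<in>UNIV. F d i j) = d i) \<and>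
    (\<forall>j. (\<Sum>i\<in>UNIV. F d i j) = (\<Sum>i\<in>UNIV. d i) / CARD('j)) \<and>
    (\<forall>i j. \<bar>F d i j\<bar> \<le> C * (\<Sum>i\<in>UNIV. \<bar>d i\<bar>)))"
proof -
  have "\<forall>k l. \<exists>p :: 'i \<Rightarrow> 'j \<Rightarrow> real. (\<forall>i j. (i, j) \<notin> B \<longrightarrow> p i j = 0) \<and>
    (\<forall>i. (\<Sum>j\<in>UNIV. p i j) = of_bool (i = k)) \<and> (\<forall>j. (\<Sum>i\<in>UNIV. p i j) = of_bool (j = l))"
    using unit_flow_along_path[of _ "Inr _" B] assms by simp
  then obtain p :: "'i \<Rightarrow> 'j \<Rightarrow> 'i \<Rightarrow> 'j \<Rightarrow> real" where p:
    "\<And>k l i j. (i, j) \<notin> B \<Longrightarrow> p k l i j = 0"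
    "\<And>k l i. (\<Sum>j\<in>UNIV. p k l i j) = of_bool (i = k)"
    "\<And>k l j. (\<Sum>i\<in>UNIV. p k l i j) = of_bool (j = l)"
    by metis
  define J where "J = real CARD('j)"
  have J: "J > 0" by (simp add: J_def)
  define P where "P k i j = (\<Sum>l\<in>UNIV. p k l i j) / J" for k i j
  have P: "(i, j) \<notin> B \<Longrightarrow> P k i j = 0" "(\<Sum>j\<in>UNIV. P k i j) = of_bool (i = k)"
    "(\<Sum>i\<in>UNIV. P k i j) = 1 / J" for k i j
  proof -
    show "P k i j = 0" if "(i, j) \<notin> B" using that by (simp add: P_def p)
    have "(\<Sum>j\<in>UNIV. P k i j) = (\<Sum>l\<in>UNIV. \<Sum>j\<in>UNIV. p k l i j) / J"
      unfolding P_def by (subst sum.swap) (simp add: sum_divide_distrib)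
    then show "(\<Sum>j\<in>UNIV. P k i j) = of_bool (i = k)" using J by (simp add: p J_def)
    have "(\<Sum>i\<in>UNIV. P k i j) = (\<Sum>l\<in>UNIV. \<Sum>i\<in>UNIV. p k l i j) / J"
      unfolding P_def by (subst sum.swap) (simp add: sum_divide_distrib)
    then show "(\<Sum>i\<in>UNIV. P k i j) = 1 / J" using J by (simp add: p of_bool_def)
  qed
  define F :: "('i \<Rightarrow> real) \<Rightarrow> 'i \<Rightarrow> 'j \<Rightarrow> real" where "F d i j = (\<Sum>k\<in>UNIV. d k * P k i j)" for d i j
  define C where "C = (\<Sum>k\<in>UNIV. \<Sum>i\<in>UNIV. \<Sum>j\<in>UNIV. \<bar>P k i j\<bar>)"
  have PC: "\<bar>P k i j\<bar> \<le> C" for k i j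
  proof -
    have "\<bar>P k i j\<bar> \<le> (\<Sum>j\<in>UNIV. \<bar>P k i j\<bar>)" by (rule member_le_sum) auto
    also have "\<dots> \<le> (\<Sum>i\<in>UNIV. \<Sum>j\<in>UNIV. \<bar>P k i j\<bar>)"
      by (rule member_le_sum) (auto intro: sum_nonneg)
    also have "\<dots> \<le> C" unfolding C_def by (rule member_le_sum) (auto intro!: sum_nonneg)
    finally show ?thesis .
  qed
  show ?thesis
  proof (intro exI[of _ F] exI[of _ C] conjI allI impI)
    show "0 \<le> C" unfolding C_def by (intro sum_nonneg) auto
    fix d :: "'i \<Rightarrow> real" and i j
    show "F d i j = 0" if "(i, j) \<notin> B" using that by (simp add: F_def P)
    have "(\<Sum>j\<in>UNIV. F d i j) = (\<Sum>k\<in>UNIV. d k * (\<Sum>j\<in>UNIV. P k i j))"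
      unfolding F_def by (subst sum.swap) (simp add: sum_distrib_left)
    then show "(\<Sum>j\<in>UNIV. F d i j) = d i" by (simp add: P of_bool_def if_distrib[of "\<lambda>x. _ * x"] cong: if_cong)
    have "(\<Sum>i\<in>UNIV. F d i j) = (\<Sum>k\<in>UNIV. d k * (\<Sum>i\<in>UNIV. P k i j))"
      unfolding F_def by (subst sum.swap) (simp add: sum_distrib_left)
    then show "(\<Sum>i\<in>UNIV. F d i j) = (\<Sum>i\<in>UNIV. d i) / CARD('j)"
      by (simp add: P J_def sum_divide_distrib)
    have "\<bar>F d i j\<bar> \<le> (\<Sum>k\<in>UNIV. \<bar>d k\<bar> * C)"
      unfolding F_def
      by (intro order_trans[OF sum_abs] sum_mono) (auto simp: abs_mult intro!: mult_left_mono PC)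
    then show "\<bar>F d i j\<bar> \<le> C * (\<Sum>i\<in>UNIV. \<bar>d i\<bar>)" by (simp add: sum_distrib_left mult.commute)
  qed
qed

text \<open>
  Round every entry down and give what is missing to one positive entry. Entries that vanish stay
  zero, so that rounding creates no forbidden activities.
\<close>

lemma round_preserving_sum:
  fixes r :: "'j::finite \<Rightarrow> real"
  assumes r: "\<And>j. 0 \<le> r j"
  shows "\<exists>k :: 'j \<Rightarrow> nat. (\<forall>j. \<bar>real (k j) - r j\<bar> \<le> CARD('j)) \<and> (\<forall>j. r j = 0 \<longrightarrow> k j = 0) \<and>
     (\<Sum>j\<in>UNIV. k j) = nat \<lfloor>\<Sum>j\<in>UNIV. r j\<rfloor>"
proof -
  define f where "f j = nat \<lfloor>r j\<rfloor>" for j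
  have f: "real (f j) \<le> r j" "r j < real (f j) + 1" for j
    using r[of j] unfolding f_def by linarith+
  define R where "R = nat \<lfloor>\<Sum>j\<in>UNIV. r j\<rfloor>"
  have R: "real R \<le> (\<Sum>j\<in>UNIV. r j)" "(\<Sum>j\<in>UNIV. r j) < real R + 1"
  proof -
    have "0 \<le> (\<Sum>j\<in>UNIV. r j)" by (intro sum_nonneg r)
    then show "real R \<le> (\<Sum>j\<in>UNIV. r j)" "(\<Sum>j\<in>UNIV. r j) < real R + 1"
      unfolding R_def by linarith+
  qed
  have le: "(\<Sum>j\<in>UNIV. f j) \<le> R"
  proof -
    have "real (\<Sum>j\<in>UNIV. f j) \<le> (\<Sum>j\<in>UNIV. r j)" using f by (simp add: sum_mono)
    then show ?thesis using R by linarith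
  qed
  define m where "m = R - (\<Sum>j\<in>UNIV. f j)"
  have "(\<Sum>j\<in>UNIV. r j) \<le> (\<Sum>j\<in>UNIV. real (f j) + 1)"
    using f by (intro sum_mono) (auto intro: less_imp_le)
  then have m: "real m \<le> CARD('j)" using R le by (simp add: m_def sum.distrib of_nat_diff)
  show ?thesis
  proof (cases "m = 0")
    case True
    have "\<bar>real (f j) - r j\<bar> \<le> CARD('j)" for j
    proof -
      have "1 \<le> real CARD('j)" by simp
      then show ?thesis using f[of j] by linarith
    qed
    then show ?thesis
      using True le by (intro exI[of _ f]) (auto simp: m_def R_def f_def)
  next
    case False
    have "\<exists>j0. r j0 \<noteq> 0"
    proof (rule ccontr)
      assume "\<nexists>j0. r j0 \<noteq> 0"
      then have "R = 0" by (simp add: R_def)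
      then show False using False by (simp add: m_def)
    qed
    then obtain j0 where j0: "r j0 \<noteq> 0" by blast
    define k where "k j = f j + (if j = j0 then m else 0)" for j
    have "\<bar>real (k j) - r j\<bar> \<le> CARD('j)" for j
    proof -
      have "1 \<le> real CARD('j)" by simp
      moreover have "real (f j) \<le> real (k j)" "real (k j) \<le> real (f j) + real m"
        by (simp_all add: k_def)
      ultimately show ?thesis using f[of j] m by linarith
    qed
    moreover have "(\<Sum>j\<in>UNIV. k j) = R" using le by (simp add: k_def sum.distrib m_def)
    ultimately show ?thesis using j0
      by (intro exI[of _ k]) (auto simp: R_def k_def f_def)
  qed
qed

definition feasible_allocation ::
  "('i \<times> 'j) set \<Rightarrow> ('j \<Rightarrow> nat) \<Rightarrow> ('i::finite \<Rightarrow> nat) \<Rightarrow> ('i \<Rightarrow> 'j::finite \<Rightarrow> nat) \<Rightarrow> bool" where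
  "feasible_allocation E N x \<Psi> \<longleftrightarrow> (\<forall>i j. (i, j) \<notin> E \<longrightarrow> \<Psi> i j = 0) \<and>
     (\<forall>i. (\<Sum>j\<in>UNIV. \<Psi> i j) \<le> x i) \<and> (\<forall>j. (\<Sum>i\<in>UNIV. \<Psi> i j) \<le> N j)"

definition deviation :: "('i \<Rightarrow> 'j::finite \<Rightarrow> real) \<Rightarrow> real \<Rightarrow> ('i \<Rightarrow> nat) \<Rightarrow> 'i \<Rightarrow> real" where
  "deviation p n x i = real (x i) - n * (\<Sum>j\<in>UNIV. p i j)"

text \<open>
  The property that the policy has to secure in state \<open>x\<close>: nobody waits if the total is clearly below the
  threshold, and the allocation is the fluid one, shifted by \<open>- a s\<close> along the cycle while the total is above
  the threshold, up to an error that the drift term of \<open>steered_increments\<close> absorbs.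
\<close>

definition steering_allocation ::
  "('i \<Rightarrow> 'j \<Rightarrow> real) \<Rightarrow> ('i \<Rightarrow> 'j \<Rightarrow> real) \<Rightarrow> real \<Rightarrow> real \<Rightarrow> real \<Rightarrow> real \<Rightarrow>
   ('i::finite \<Rightarrow> nat) \<Rightarrow> ('i \<Rightarrow> 'j::finite \<Rightarrow> nat) \<Rightarrow> bool" where
  "steering_allocation p s C n \<theta> a x \<Psi> \<longleftrightarrow>
     ((\<Sum>i\<in>UNIV. deviation p n x i) \<le> - \<theta> / 2 \<longrightarrow> (\<forall>i. (\<Sum>j\<in>UNIV. \<Psi> i j) = x i)) \<and>
     (\<forall>i j. \<bar>real (\<Psi> i j) - n * p i j
         + (if (\<Sum>k\<in>UNIV. deviation p n x k) > - \<theta> then a * s i j else 0)\<bar>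
       \<le> C * ((\<Sum>k\<in>UNIV. \<bar>deviation p n x k\<bar>) + \<theta>))"

text \<open>
  First remove \<open>w = max 0 (D + \<theta> / 2)\<close> customers, equally from all classes: these have to wait. The
  remaining deviation \<open>d'\<close> has total at most \<open>- \<theta> / 2\<close>, so that the flow which realizes it leaves at least
  \<open>\<theta> / (2 J)\<close> servers idle at each of the \<open>J\<close> stations. This slack pays for rounding and for the
  discrepancy \<open>q\<close> between \<open>n \<nu>\<close> and the actual number of servers. No entry becomes negative: in \<open>B\<close> the
  fluid part \<open>n \<delta>\<close> outweighs the flow and the shift, and outside of \<open>B\<close> the shift \<open>- a s\<close> is nonnegative.
\<close>

lemma steering_allocation_exists:
  fixes p s :: "'i::finite \<Rightarrow> 'j::finite \<Rightarrow> real" and B E :: "('i \<times> 'j) set"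
    and F :: "('i \<Rightarrow> real) \<Rightarrow> 'i \<Rightarrow> 'j \<Rightarrow> real" and x :: "'i \<Rightarrow> nat" and N :: "'j \<Rightarrow> nat"
  assumes F_supp: "\<And>d i j. (i, j) \<notin> B \<Longrightarrow> F d i j = 0"
    and F_row: "\<And>d i. (\<Sum>j\<in>UNIV. F d i j) = d i"
    and F_col: "\<And>d j. (\<Sum>i\<in>UNIV. F d i j) = (\<Sum>i\<in>UNIV. d i) / CARD('j)"
    and F_bd: "\<And>d i j. \<bar>F d i j\<bar> \<le> C * (\<Sum>i\<in>UNIV. \<bar>d i\<bar>)"
    and C: "0 \<le> C"
    and BE: "B \<subseteq> E"
    and p_pos: "\<And>i j. (i, j) \<in> B \<Longrightarrow> \<delta> \<le> p i j"
    and p_zero: "\<And>i j. (i, j) \<notin> B \<Longrightarrow> p i j = 0"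
    and p_col: "\<And>j. (\<Sum>i\<in>UNIV. p i j) = \<nu> j"
    and s_row: "\<And>i. (\<Sum>j\<in>UNIV. s i j) = 0" and s_col: "\<And>j. (\<Sum>i\<in>UNIV. s i j) = 0"
    and s_supp: "\<And>i j. (i, j) \<notin> E \<Longrightarrow> s i j = 0"
    and s_neg: "\<And>i j. (i, j) \<notin> B \<Longrightarrow> s i j \<le> 0"
    and s_le: "\<And>i j. s i j \<le> 1"
    and n: "0 \<le> n" and \<theta>: "1 \<le> \<theta>" and a: "0 \<le> a"
    and big: "C * (2 * a + \<theta>) + a \<le> n * \<delta>"
    and N: "\<And>j. n * \<nu> j \<le> real (N j) + q"
    and slack: "q + real CARD('i) * real CARD('j) \<le> \<theta> / (2 * real CARD('j))"
    and near: "(\<Sum>i\<in>UNIV. \<bar>deviation p n x i\<bar>) \<le> a"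
  shows "\<exists>\<Psi>. feasible_allocation E N x \<Psi> \<and> steering_allocation p s (2 * C + CARD('j)) n \<theta> a x \<Psi>"
proof -
  let ?I = "real CARD('i)" and ?J = "real CARD('j)"
  define d where "d = deviation p n x"
  define D where "D = (\<Sum>i\<in>UNIV. d i)"
  define w where "w = max 0 (D + \<theta> / 2)"
  define d' where "d' i = d i - w / ?I" for i
  define v where "v = (if D > - \<theta> then a else 0)"
  define y where "y i j = n * p i j + F d' i j - v * s i j" for i j
  have v: "0 \<le> v" "v \<le> a" using a by (simp_all add: v_def)
  have IJ: "?I > 0" "?J > 0" by simp_all
  have w0: "w \<ge> 0" by (simp add: w_def)
  have absD: "\<bar>D\<bar> \<le> (\<Sum>i\<in>UNIV. \<bar>d i\<bar>)" unfolding D_def by (rule sum_abs)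
  have w_le: "w \<le> (\<Sum>i\<in>UNIV. \<bar>d i\<bar>) + \<theta>" using absD \<theta> by (auto simp: w_def)
  have "(\<Sum>i\<in>UNIV. d' i) = D - w" using IJ by (simp add: d'_def sum_subtractf D_def)
  then have D'_le: "(\<Sum>i\<in>UNIV. d' i) \<le> - \<theta> / 2" by (simp add: w_def)
  have "(\<Sum>i\<in>UNIV. \<bar>d' i\<bar>) \<le> (\<Sum>i\<in>UNIV. \<bar>d i\<bar> + w / ?I)"
    using w0 IJ unfolding d'_def by (intro sum_mono order_trans[OF abs_triangle_ineq4]) auto
  also have "\<dots> = (\<Sum>i\<in>UNIV. \<bar>d i\<bar>) + w" using IJ by (simp add: sum.distrib)
  finally have d'_le: "(\<Sum>i\<in>UNIV. \<bar>d' i\<bar>) \<le> 2 * (\<Sum>i\<in>UNIV. \<bar>d i\<bar>) + \<theta>" using w_le by simp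
  have F_le: "\<bar>F d' i j\<bar> \<le> C * (2 * (\<Sum>i\<in>UNIV. \<bar>d i\<bar>) + \<theta>)" for i j
    using F_bd[of d' i j] mult_left_mono[OF d'_le C] by linarith
  have near': "(\<Sum>i\<in>UNIV. \<bar>d i\<bar>) \<le> a" using near by (simp add: d_def)
  have F_le_a: "\<bar>F d' i j\<bar> \<le> C * (2 * a + \<theta>)" for i j
    using F_le[of i j] mult_left_mono[OF _ C, of "2 * (\<Sum>i\<in>UNIV. \<bar>d i\<bar>) + \<theta>" "2 * a + \<theta>"] near'
    by linarith
  have y0: "0 \<le> y i j" for i j
  proof (cases "(i, j) \<in> B")
    case True
    have "n * \<delta> \<le> n * p i j" using p_pos[OF True] n by (intro mult_left_mono)
    moreover have "v * s i j \<le> a" using mult_left_mono[OF s_le v(1), of i j] v by simp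
    ultimately show ?thesis using F_le_a[of i j] big unfolding y_def by linarith
  next
    case False
    then show ?thesis using mult_nonneg_nonpos[OF v(1) s_neg[OF False]]
      by (simp add: y_def p_zero F_supp)
  qed
  have y_row: "(\<Sum>j\<in>UNIV. y i j) = real (x i) - w / ?I" for i
    by (simp add: y_def sum.distrib sum_subtractf F_row s_row d'_def d_def deviation_def
        flip: sum_distrib_left)
  have y_col: "(\<Sum>i\<in>UNIV. y i j) \<le> n * \<nu> j - \<theta> / (2 * ?J)" for j
  proof -
    have "(\<Sum>i\<in>UNIV. y i j) = n * \<nu> j + (\<Sum>i\<in>UNIV. d' i) / ?J"
      by (simp add: y_def sum.distrib sum_subtractf F_col s_col p_col flip: sum_distrib_left)
    then show ?thesis using divide_right_mono[OF D'_le, of ?J] by simp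
  qed
  have "\<forall>i. \<exists>k :: 'j \<Rightarrow> nat. (\<forall>j. \<bar>real (k j) - y i j\<bar> \<le> CARD('j)) \<and> (\<forall>j. y i j = 0 \<longrightarrow> k j = 0) \<and>
     (\<Sum>j\<in>UNIV. k j) = nat \<lfloor>\<Sum>j\<in>UNIV. y i j\<rfloor>"
    by (intro allI round_preserving_sum y0)
  then obtain \<Psi> :: "'i \<Rightarrow> 'j \<Rightarrow> nat" where \<Psi>: "\<And>i j. \<bar>real (\<Psi> i j) - y i j\<bar> \<le> ?J"
    "\<And>i j. y i j = 0 \<Longrightarrow> \<Psi> i j = 0" "\<And>i. (\<Sum>j\<in>UNIV. \<Psi> i j) = nat \<lfloor>\<Sum>j\<in>UNIV. y i j\<rfloor>"
    by metis
  have "feasible_allocation E N x \<Psi>"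
    unfolding feasible_allocation_def
  proof (intro conjI allI impI)
    fix i j assume "(i, j) \<notin> E"
    moreover from this have "(i, j) \<notin> B" using BE by blast
    ultimately show "\<Psi> i j = 0" by (intro \<Psi>(2)) (simp add: y_def p_zero F_supp s_supp)
  next
    fix i
    have "0 \<le> w / ?I" using w0 IJ by simp
    then have "\<lfloor>\<Sum>j\<in>UNIV. y i j\<rfloor> \<le> int (x i)" unfolding y_row by linarith
    then show "(\<Sum>j\<in>UNIV. \<Psi> i j) \<le> x i" unfolding \<Psi>(3) by linarith
  next
    fix j
    have "(\<Sum>i\<in>UNIV. real (\<Psi> i j)) \<le> (\<Sum>i\<in>UNIV. y i j + ?J)"
    proof (rule sum_mono)
      fix i show "real (\<Psi> i j) \<le> y i j + ?J" using \<Psi>(1)[of i j] by linarith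
    qed
    also have "\<dots> = (\<Sum>i\<in>UNIV. y i j) + ?I * ?J" by (simp add: sum.distrib)
    also have "\<dots> \<le> real (N j)" using y_col[of j] N[of j] slack by linarith
    finally show "(\<Sum>i\<in>UNIV. \<Psi> i j) \<le> N j" by (simp flip: of_nat_sum)
  qed
  moreover have "steering_allocation p s (2 * C + CARD('j)) n \<theta> a x \<Psi>"
    unfolding steering_allocation_def d_def[symmetric] D_def[symmetric]
  proof (intro conjI allI impI)
    fix i assume "D \<le> - \<theta> / 2"
    then have "w = 0" by (simp add: w_def)
    then show "(\<Sum>j\<in>UNIV. \<Psi> i j) = x i" by (simp add: \<Psi>(3) y_row)
  next
    fix i j
    let ?d = "\<Sum>k\<in>UNIV. \<bar>d k\<bar>"
    have d0: "0 \<le> ?d" by (intro sum_nonneg) auto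
    have "\<bar>real (\<Psi> i j) - n * p i j + (if - \<theta> < D then a * s i j else 0)\<bar>
        \<le> \<bar>real (\<Psi> i j) - y i j\<bar> + \<bar>F d' i j\<bar>"
      unfolding y_def v_def by (simp split: if_split) linarith
    also have "\<dots> \<le> ?J + C * (2 * ?d + \<theta>)" using \<Psi>(1)[of i j] F_le[of i j] by linarith
    also have "\<dots> \<le> ?J * (?d + \<theta>) + C * (2 * ?d + 2 * \<theta>)"
    proof -
      have "?J * 1 \<le> ?J * (?d + \<theta>)" using \<theta> d0 by (intro mult_left_mono) linarith+
      moreover have "C * (2 * ?d + \<theta>) \<le> C * (2 * ?d + 2 * \<theta>)" using \<theta> C by (intro mult_left_mono) linarith+
      ultimately show ?thesis by linarith
    qed
    also have "\<dots> = (2 * C + ?J) * (?d + \<theta>)" by (simp add: algebra_simps)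
    finally show "\<bar>real (\<Psi> i j) - n * p i j + (if - \<theta> < D then a * s i j else 0)\<bar>
      \<le> (2 * C + ?J) * (?d + \<theta>)" .
  qed
  ultimately show ?thesis by blast
qed

section \<open>Time-change equations for counting paths\<close>

definition counting_path :: "(real \<Rightarrow> nat) \<Rightarrow> bool" where
  "counting_path g \<longleftrightarrow> mono_on {0..} g \<and> (\<forall>t\<ge>0. \<forall>\<^sub>F s in at_right t. g s = g t)"

definition unit_jumps :: "(real \<Rightarrow> nat) \<Rightarrow> bool" where
  "unit_jumps g \<longleftrightarrow> (\<forall>t>0. \<forall>\<^sub>F s in at_left t. g t \<le> g s + 1)"

text \<open>
  Clock \<open>p\<close> runs on its own internal time \<open>R p\<close> and shows \<open>N p (R p)\<close>. The speed of the clocks is a function \<open>r\<close>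
  of all the readings. The equation to solve is \<open>R p t = \<integral>\<^sub>0\<^sup>t r (readings at time u) p du\<close>.
\<close>

definition readings :: "('p \<Rightarrow> real \<Rightarrow> nat) \<Rightarrow> ('p \<Rightarrow> real) \<Rightarrow> 'p \<Rightarrow> nat" where
  "readings N R p = N p (R p)"

definition advance ::
  "('p \<Rightarrow> real \<Rightarrow> nat) \<Rightarrow> (('p \<Rightarrow> nat) \<Rightarrow> 'p \<Rightarrow> real) \<Rightarrow> ('p \<Rightarrow> real) \<Rightarrow> real \<Rightarrow> 'p \<Rightarrow> real" where
  "advance N r R s p = R p + r (readings N R) p * s"

text \<open>
  The waiting time until some reading changes, cut off at \<open>1\<close> so that it is finite even if no reading ever
  changes.
\<close>

definition next_event ::
  "('p \<Rightarrow> real \<Rightarrow> nat) \<Rightarrow> (('p \<Rightarrow> nat) \<Rightarrow> 'p \<Rightarrow> real) \<Rightarrow> ('p \<Rightarrow> real) \<Rightarrow> real" where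
  "next_event N r R = Inf {s. 0 < s \<and> (1 \<le> s \<or> readings N (advance N r R s) \<noteq> readings N R)}"

primrec clock_state ::
  "('p \<Rightarrow> real \<Rightarrow> nat) \<Rightarrow> (('p \<Rightarrow> nat) \<Rightarrow> 'p \<Rightarrow> real) \<Rightarrow> nat \<Rightarrow> real \<times> ('p \<Rightarrow> real)" where
  "clock_state N r 0 = (0, \<lambda>_. 0)"
| "clock_state N r (Suc k) =
     (let (t, R) = clock_state N r k; \<delta> = next_event N r R in (t + \<delta>, advance N r R \<delta>))"

declare clock_state.simps(2) [simp del]

definition clock_path ::
  "('p \<Rightarrow> real \<Rightarrow> nat) \<Rightarrow> (('p \<Rightarrow> nat) \<Rightarrow> 'p \<Rightarrow> real) \<Rightarrow> real \<Rightarrow> 'p \<Rightarrow> nat" where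
  "clock_path N r t = readings N (snd (clock_state N r (LEAST k. t < fst (clock_state N r (Suc k)))))"

context
  fixes N :: "'p::finite \<Rightarrow> real \<Rightarrow> nat" and r :: "('p \<Rightarrow> nat) \<Rightarrow> 'p \<Rightarrow> real" and b :: real
  assumes N: "\<And>p. counting_path (N p)" and r: "\<And>c p. 0 \<le> r c p \<and> r c p \<le> b"
begin

lemma counting_mono: "0 \<le> s \<Longrightarrow> s \<le> t \<Longrightarrow> N p s \<le> N p t"
  using N[of p] by (auto simp: counting_path_def mono_on_def)

lemma readings_advance_mono:
  assumes "\<forall>p. 0 \<le> R p" "0 \<le> s" "s \<le> t"
  shows "readings N (advance N r R s) \<le> readings N (advance N r R t)"
  using assms r by (auto simp: readings_def advance_def le_fun_def intro!: counting_mono mult_left_mono)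

lemma advance_zero: "advance N r R 0 = R"
  by (simp add: advance_def fun_eq_iff)

lemma readings_advance_right:
  assumes R: "\<forall>p. 0 \<le> R p" and "0 \<le> s"
  shows "\<forall>\<^sub>F s' in at_right s. readings N (advance N r R s') = readings N (advance N r R s)"
proof -
  have "\<forall>\<^sub>F s' in at_right s. \<forall>p. N p (advance N r R s' p) = N p (advance N r R s p)"
  proof (intro eventually_all_finite)
    fix p
    let ?a = "advance N r R s p" and ?q = "r (readings N R) p"
    have "0 \<le> ?a" using R r[of "readings N R" p] \<open>0 \<le> s\<close> by (simp add: advance_def)
    then obtain e where e: "e > ?a" "\<And>u. ?a < u \<Longrightarrow> u < e \<Longrightarrow> N p u = N p ?a"
      using N[of p] by (auto simp: counting_path_def eventually_at_right_field)
    have "((\<lambda>s'. advance N r R s' p) \<longlongrightarrow> ?a) (at_right s)"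
      unfolding advance_def by (intro tendsto_intros)
    then have "\<forall>\<^sub>F s' in at_right s. advance N r R s' p < e"
      using e(1) by (rule order_tendstoD)
    moreover have "\<forall>\<^sub>F s' in at_right s. s < s'" by (simp add: eventually_at_right_less)
    ultimately show "\<forall>\<^sub>F s' in at_right s. N p (advance N r R s' p) = N p ?a"
    proof eventually_elim
      case (elim s')
      have "?a \<le> advance N r R s' p"
        using r[of "readings N R" p] elim by (auto simp: advance_def intro!: mult_left_mono)
      then show ?case using e(2)[of "advance N r R s' p"] elim by (cases "?a = advance N r R s' p") auto
    qed
  qed
  then show ?thesis by (simp add: readings_def[abs_def] fun_eq_iff)
qed

text \<open>
  Readings are monotone and right-continuous along a step, so the infimum is attained. This gives the
  distribution function of the waiting time in terms of readings at fixed durations, from which measurability follows.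
\<close>

lemma next_event_le_iff:
  assumes R: "\<forall>p. 0 \<le> R p" and s: "0 \<le> s" "s < 1"
  shows "next_event N r R \<le> s \<longleftrightarrow> readings N (advance N r R s) \<noteq> readings N R"
proof -
  define A where "A = {s. 0 < s \<and> (1 \<le> s \<or> readings N (advance N r R s) \<noteq> readings N R)}"
  have A: "next_event N r R = Inf A" "1 \<in> A" "bdd_below A"
    by (auto simp: next_event_def A_def intro!: bdd_belowI[of _ 0])
  show ?thesis
  proof
    assume "readings N (advance N r R s) \<noteq> readings N R"
    then have "s \<in> A" using s advance_zero[of R] by (cases "s = 0") (auto simp: A_def)
    then show "next_event N r R \<le> s" unfolding A by (intro cInf_lower A)
  next
    assume le: "next_event N r R \<le> s"
    show "readings N (advance N r R s) \<noteq> readings N R"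
    proof
      assume eq: "readings N (advance N r R s) = readings N R"
      have before: "readings N (advance N r R s') = readings N R" if "0 \<le> s'" "s' \<le> s" for s'
        using readings_advance_mono[of R 0 s'] readings_advance_mono[of R s' s] that R eq
        by (simp add: advance_zero)
      obtain e where e: "e > s" "\<And>s'. s < s' \<Longrightarrow> s' < e \<Longrightarrow> readings N (advance N r R s') = readings N R"
        using readings_advance_right[OF R s(1)] eq by (auto simp: eventually_at_right_field)
      have "min e 1 \<le> Inf A"
      proof (rule cInf_greatest)
        show "A \<noteq> {}" using A by auto
        fix s' assume s': "s' \<in> A"
        show "min e 1 \<le> s'"
        proof (rule ccontr)
          assume "\<not> min e 1 \<le> s'"
          then show False using s' before[of s'] e(2)[of s'] by (cases "s' \<le> s") (auto simp: A_def)
        qed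
      qed
      then show False using le A e s by auto
    qed
  qed
qed

lemma next_event_bounds:
  assumes R: "\<forall>p. 0 \<le> R p"
  shows "0 < next_event N r R" "next_event N r R \<le> 1"
proof -
  show "0 < next_event N r R"
    using next_event_le_iff[OF R, of 0] by (simp add: advance_zero)
  show "next_event N r R \<le> 1"
    unfolding next_event_def by (intro cInf_lower bdd_belowI[of _ 0]) auto
qed

lemma readings_before_next_event:
  assumes R: "\<forall>p. 0 \<le> R p" and "0 \<le> s" "s < next_event N r R"
  shows "readings N (advance N r R s) = readings N R"
  using next_event_le_iff[OF R, of s] next_event_bounds[OF R] assms by auto

abbreviation event_time :: "nat \<Rightarrow> real" where "event_time k \<equiv> fst (clock_state N r k)"
abbreviation clocks :: "nat \<Rightarrow> 'p \<Rightarrow> real" where "clocks k \<equiv> snd (clock_state N r k)"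
abbreviation event_count :: "nat \<Rightarrow> 'p \<Rightarrow> nat" where "event_count k \<equiv> readings N (clocks k)"

lemma event_time_Suc: "event_time (Suc k) = event_time k + next_event N r (clocks k)"
  and clocks_Suc: "clocks (Suc k) = advance N r (clocks k) (next_event N r (clocks k))"
  by (simp_all add: clock_state.simps(2) case_prod_beta Let_def)

lemma clocks_nonneg: "\<forall>p. 0 \<le> clocks k p"
proof (induction k)
  case (Suc k)
  then show ?case using next_event_bounds[OF Suc] r
    unfolding clocks_Suc advance_def by (auto intro!: add_nonneg_nonneg mult_nonneg_nonneg)
qed simp

lemma event_time_less_Suc: "event_time k < event_time (Suc k)"
  using next_event_bounds(1)[OF clocks_nonneg[of k]] by (simp add: event_time_Suc)

lemma event_time_mono: "k \<le> l \<Longrightarrow> event_time k \<le> event_time l"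
  by (rule lift_Suc_mono_le[of event_time]) (auto intro: less_imp_le[OF event_time_less_Suc])

lemma clocks_le: "clocks k p \<le> b * event_time k"
proof (induction k)
  case (Suc k)
  have "clocks (Suc k) p = clocks k p + r (event_count k) p * next_event N r (clocks k)"
    by (simp only: clocks_Suc advance_def)
  also have "\<dots> \<le> b * event_time k + b * next_event N r (clocks k)"
    using Suc r[of "event_count k" p] next_event_bounds[OF clocks_nonneg[of k]]
    by (intro add_mono mult_right_mono) auto
  finally show ?case by (simp only: event_time_Suc distrib_left)
qed simp

lemma event_count_le_Suc: "event_count k p \<le> event_count (Suc k) p"
  using readings_advance_mono[of "clocks k" 0 "next_event N r (clocks k)"] clocks_nonneg
    next_event_bounds[OF clocks_nonneg[of k]]
  by (simp add: clocks_Suc advance_zero le_fun_def less_imp_le)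

text \<open>
  Each step either lasts one time unit or raises some reading, so real time plus the sum of
  the readings grows by at least one. On a bounded time interval the internal times, hence the readings, are
  bounded.
\<close>

lemma event_time_unbounded: "\<exists>k. t < event_time k"
proof (rule ccontr)
  assume "\<not> ?thesis"
  then have bd: "event_time k \<le> t" for k by (simp add: not_less)
  have "t \<ge> 0" using bd[of 0] by simp
  have step: "real (Suc k) \<le> event_time (Suc k) + real (\<Sum>p\<in>UNIV. event_count (Suc k) p)"
    if k: "real k \<le> event_time k + real (\<Sum>p\<in>UNIV. event_count k p)" for k
  proof (cases "next_event N r (clocks k) < 1")
    case True
    have "event_count (Suc k) \<noteq> event_count k"
      using next_event_le_iff[OF clocks_nonneg[of k], of "next_event N r (clocks k)"] True
        next_event_bounds[OF clocks_nonneg[of k]] by (simp only: clocks_Suc) simp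
    then have "(\<Sum>p\<in>UNIV. event_count k p) < (\<Sum>p\<in>UNIV. event_count (Suc k) p)"
      using event_count_le_Suc[of k]
      by (intro sum_strict_mono_ex1) (auto simp: fun_eq_iff nat_less_le, metis)
    then show ?thesis using k event_time_less_Suc[of k] by linarith
  next
    case False
    have "(\<Sum>p\<in>UNIV. event_count k p) \<le> (\<Sum>p\<in>UNIV. event_count (Suc k) p)"
      using event_count_le_Suc[of k] by (intro sum_mono)
    then show ?thesis using k False unfolding event_time_Suc by linarith
  qed
  have potential: "real k \<le> event_time k + real (\<Sum>p\<in>UNIV. event_count k p)" for k
  proof (induction k)
    case 0
    show ?case by (simp add: sum_nonneg)
  next
    case (Suc k)
    then show ?case by (rule step)
  qed
  have "event_count k p \<le> N p (b * t)" for k p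
  proof -
    have "b \<ge> 0" using r[of undefined p] by linarith
    then have "clocks k p \<le> b * t" using clocks_le[of k p] mult_left_mono[OF bd[of k], of b] by linarith
    then show ?thesis unfolding readings_def by (intro counting_mono clocks_nonneg[rule_format])
  qed
  then have "(\<Sum>p\<in>UNIV. event_count k p) \<le> (\<Sum>p\<in>UNIV. N p (b * t))" for k by (intro sum_mono)
  then have "real k \<le> t + real (\<Sum>p\<in>UNIV. N p (b * t))" for k
    using potential[of k] bd[of k] by (smt (verit) of_nat_le_iff)
  then show False using reals_Archimedean2 not_le by blast
qed

lemma clock_path_eq:
  assumes "event_time k \<le> t" "t < event_time (Suc k)"
  shows "clock_path N r t = event_count k"
proof -
  have "(LEAST k. t < event_time (Suc k)) = k"
  proof (rule Least_equality)
    fix l assume "t < event_time (Suc l)"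
    show "k \<le> l"
    proof (rule ccontr)
      assume "\<not> k \<le> l"
      then have "event_time (Suc l) \<le> event_time k" by (intro event_time_mono) auto
      then show False using \<open>t < event_time (Suc l)\<close> assms by linarith
    qed
  qed (fact assms)
  then show ?thesis by (simp only: clock_path_def)
qed

lemma piece_exists:
  assumes "0 \<le> t"
  shows "\<exists>k. event_time k \<le> t \<and> t < event_time (Suc k)"
proof -
  define K where "K = (LEAST k. t < event_time k)"
  have K: "t < event_time K" unfolding K_def using event_time_unbounded by (rule LeastI_ex)
  then obtain k where k: "K = Suc k" using assms by (cases K) auto
  have "\<not> t < event_time k" using not_less_Least[of k "\<lambda>k. t < event_time k"] k K_def by auto
  then show ?thesis using K k by (intro exI[of _ k]) auto
qed

lemma step_path_clock_path: "step_path (clock_path N r)"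
  unfolding step_path_def
proof (intro conjI allI impI)
  fix t :: real assume "t \<ge> 0"
  then obtain k where k: "event_time k \<le> t" "t < event_time (Suc k)" using piece_exists by blast
  then have "clock_path N r s = clock_path N r t" if "t < s" "s < event_time (Suc k)" for s
    using that clock_path_eq[of k s] clock_path_eq[of k t] by auto
  then show "\<forall>\<^sub>F s in at_right t. clock_path N r s = clock_path N r t"
    using k unfolding eventually_at_right_field by blast
next
  fix t :: real assume t: "t > 0"
  then obtain k where k: "event_time k \<le> t" "t < event_time (Suc k)" using piece_exists[of t] by auto
  have "\<exists>l. event_time l < t \<and> t \<le> event_time (Suc l)"
  proof (cases "event_time k = t")
    case True
    then obtain l where "k = Suc l" using t by (cases k) auto
    then show ?thesis using event_time_less_Suc[of l] True by auto
  next
    case False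
    then show ?thesis using k by (intro exI[of _ k]) auto
  qed
  then obtain l where l: "event_time l < t" "t \<le> event_time (Suc l)" by blast
  then have "clock_path N r s = event_count l" if "event_time l < s" "s < t" for s
    using that by (intro clock_path_eq) auto
  then show "\<exists>c. \<forall>\<^sub>F s in at_left t. clock_path N r s = c"
    using l unfolding eventually_at_left_field by blast
qed

lemma clock_path_integral_piece:
  assumes "event_time k \<le> t" "t \<le> event_time (Suc k)"
  shows "((\<lambda>s. r (clock_path N r s) p) has_integral clocks k p + r (event_count k) p * (t - event_time k)) {0..t}"
  using assms
proof (induction k arbitrary: t)
  case 0
  have int: "((\<lambda>s. r (event_count 0) p) has_integral r (event_count 0) p * (t - 0)) {0..t}"
    using has_integral_const_real[of "r (event_count 0) p" 0 t] 0 by (simp add: mult.commute)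
  have eq: "r (clock_path N r s) p = r (event_count 0) p" if "s \<in> {0..t} - {t}" for s
  proof -
    have "event_time 0 \<le> s" "s < event_time (Suc 0)" using that 0 by auto
    then show ?thesis by (simp only: clock_path_eq)
  qed
  have "((\<lambda>s. r (clock_path N r s) p) has_integral r (event_count 0) p * (t - 0)) {0..t}"
    by (rule has_integral_spike_finite[of "{t}", OF _ eq int]) simp
  then show ?case by simp
next
  case (Suc k)
  have piece1: "((\<lambda>s. r (clock_path N r s) p) has_integral clocks (Suc k) p) {0..event_time (Suc k)}"
  proof -
    have "clocks k p + r (event_count k) p * (event_time (Suc k) - event_time k) = clocks (Suc k) p"
      unfolding clocks_Suc event_time_Suc advance_def by simp
    then show ?thesis using Suc.IH[of "event_time (Suc k)"] event_time_less_Suc[of k] by (simp only: less_imp_le order_refl)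
  qed
  have int: "((\<lambda>s. r (event_count (Suc k)) p) has_integral r (event_count (Suc k)) p * (t - event_time (Suc k))) {event_time (Suc k)..t}"
    using has_integral_const_real[of "r (event_count (Suc k)) p" "event_time (Suc k)" t] Suc.prems
    by (simp add: mult.commute)
  have eq: "r (clock_path N r s) p = r (event_count (Suc k)) p" if "s \<in> {event_time (Suc k)..t} - {t}" for s
  proof -
    have "event_time (Suc k) \<le> s" "s < event_time (Suc (Suc k))" using that Suc.prems by auto
    then show ?thesis by (simp only: clock_path_eq)
  qed
  have piece2: "((\<lambda>s. r (clock_path N r s) p) has_integral
      r (event_count (Suc k)) p * (t - event_time (Suc k))) {event_time (Suc k)..t}"
    by (rule has_integral_spike_finite[of "{t}", OF _ eq int]) simp
  show ?case
    using Suc.prems event_time_mono[of 0 "Suc k"]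
    by (intro has_integral_combine[OF _ _ piece1 piece2]) (auto)
qed

lemma clock_path_solves:
  assumes "0 \<le> t"
  shows "clock_path N r t p = N p (integral {0..t} (\<lambda>s. r (clock_path N r s) p))"
proof -
  obtain k where k: "event_time k \<le> t" "t < event_time (Suc k)" using piece_exists[OF assms] by blast
  have "integral {0..t} (\<lambda>s. r (clock_path N r s) p) = advance N r (clocks k) (t - event_time k) p"
    unfolding advance_def using k by (intro integral_unique clock_path_integral_piece) auto
  moreover have "readings N (advance N r (clocks k) (t - event_time k)) = event_count k"
    using k unfolding event_time_Suc by (intro readings_before_next_event clocks_nonneg) auto
  ultimately show ?thesis using clock_path_eq[OF k] by (simp add: readings_def fun_eq_iff)
qed

text \<open>
  Readings with unit jumps move by at most one per event even if several clocks ring simultaneously, and a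
  clock at rest does not move; that is why populations cannot become negative.
\<close>

lemma clock_path_invariant:
  assumes init: "P (\<lambda>p. N p 0)"
    and step: "\<And>c c'. P c \<Longrightarrow> (\<And>p. c p \<le> c' p) \<Longrightarrow> (\<And>p. r c p = 0 \<Longrightarrow> c' p = c p) \<Longrightarrow>
      (\<And>p. unit_jumps (N p) \<Longrightarrow> c' p \<le> c p + 1) \<Longrightarrow> P c'"
    and "0 \<le> t"
  shows "P (clock_path N r t)"
proof -
  have "P (event_count k)" for k
  proof (induction k)
    case 0
    then show ?case using init by (simp add: readings_def[abs_def])
  next
    case (Suc k)
    then show ?case
    proof (rule step)
      fix p
      show "event_count k p \<le> event_count (Suc k) p" by (rule event_count_le_Suc)
      show zero: "event_count (Suc k) p = event_count k p" if "r (event_count k) p = 0"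
        unfolding clocks_Suc using that by (simp add: readings_def advance_def)
      show "event_count (Suc k) p \<le> event_count k p + 1" if "unit_jumps (N p)"
      proof (cases "r (event_count k) p = 0")
        case False
        let ?q = "r (event_count k) p" and ?\<delta> = "next_event N r (clocks k)"
        have q: "?q > 0" using False r[of "event_count k" p] by linarith
        have less: "clocks k p < clocks (Suc k) p"
          unfolding clocks_Suc advance_def using q next_event_bounds[OF clocks_nonneg[of k]] by simp
        have "0 < clocks (Suc k) p" using less clocks_nonneg[rule_format, of k p] by linarith
        then have "\<forall>\<^sub>F s in at_left (clocks (Suc k) p). N p (clocks (Suc k) p) \<le> N p s + 1"
          using that unfolding unit_jumps_def by blast
        moreover have "\<forall>\<^sub>F s in at_left (clocks (Suc k) p). s \<in> {clocks k p<..<clocks (Suc k) p}"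
          using less by (rule eventually_at_left_real)
        ultimately have "\<forall>\<^sub>F s in at_left (clocks (Suc k) p).
            N p (clocks (Suc k) p) \<le> N p s + 1 \<and> s \<in> {clocks k p<..<clocks (Suc k) p}"
          by eventually_elim blast
        then have "\<exists>s. N p (clocks (Suc k) p) \<le> N p s + 1 \<and> s \<in> {clocks k p<..<clocks (Suc k) p}"
          by (rule eventually_happens'[OF trivial_limit_at_left_real])
        then obtain s where s: "N p (clocks (Suc k) p) \<le> N p s + 1" "clocks k p < s" "s < clocks (Suc k) p"
          unfolding greaterThanLessThan_iff by blast
        define \<sigma> where "\<sigma> = (s - clocks k p) / ?q"
        have s_eq: "s = clocks k p + ?q * \<sigma>" using q by (simp add: \<sigma>_def)
        have "?q * \<sigma> < ?q * ?\<delta>" using s(3) s_eq unfolding clocks_Suc advance_def by linarith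
        then have "\<sigma> < ?\<delta>" using mult_less_cancel_left_pos[OF q] by blast
        moreover have "0 \<le> \<sigma>" using s q by (simp add: \<sigma>_def)
        ultimately have "readings N (advance N r (clocks k) \<sigma>) = event_count k"
          by (intro readings_before_next_event clocks_nonneg)
        then have "N p (advance N r (clocks k) \<sigma> p) = event_count k p" unfolding readings_def by (rule fun_cong)
        then have "N p s = event_count k p" unfolding s_eq advance_def .
        then show ?thesis using s(1) unfolding readings_def by linarith
      next
        case True
        then show ?thesis by (simp only: zero le_add1)
      qed
    qed
  qed
  moreover obtain k where "event_time k \<le> t" "t < event_time (Suc k)" using piece_exists[OF \<open>0 \<le> t\<close>] by blast
  ultimately show ?thesis using clock_path_eq by simp
qed

end

text \<open>
  Approximate the random time from the right by dyadic times, which take countably many values.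
\<close>

lemma measurable_counting_path_compose:
  fixes N :: "real \<Rightarrow> 'w \<Rightarrow> nat"
  assumes N: "\<And>t. 0 \<le> t \<Longrightarrow> N t \<in> M \<rightarrow>\<^sub>M count_space UNIV"
    and right: "\<And>\<omega>. counting_path (\<lambda>t. N t \<omega>)"
    and \<rho>: "\<rho> \<in> borel_measurable M" and pos: "\<And>\<omega>. 0 \<le> \<rho> \<omega>"
  shows "(\<lambda>\<omega>. N (\<rho> \<omega>) \<omega>) \<in> M \<rightarrow>\<^sub>M count_space UNIV"
proof -
  define \<rho>' where "\<rho>' n \<omega> = (real (nat \<lfloor>\<rho> \<omega> * 2 ^ n\<rfloor>) + 1) / 2 ^ n" for n :: nat and \<omega>
  have meas: "(\<lambda>\<omega>. N (\<rho>' n \<omega>) \<omega>) \<in> M \<rightarrow>\<^sub>M count_space UNIV" for n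
    unfolding \<rho>'_def
    by (rule measurable_compose_countable[of "\<lambda>i \<omega>. N ((real i + 1) / 2 ^ n) \<omega>" M _ "\<lambda>\<omega>. nat \<lfloor>\<rho> \<omega> * 2 ^ n\<rfloor>"])
       (use N \<rho> in \<open>auto intro!: N\<close>)
  have lim: "(\<lambda>n. real (N (\<rho>' n \<omega>) \<omega>)) \<longlonglongrightarrow> real (N (\<rho> \<omega>) \<omega>)" for \<omega>
  proof -
    have gt: "\<rho>' n \<omega> > \<rho> \<omega>" for n
      using pos[of \<omega>] unfolding \<rho>'_def pos_less_divide_eq[OF zero_less_power[OF zero_less_numeral]] by linarith
    have le: "\<rho>' n \<omega> \<le> \<rho> \<omega> + (1 / 2) ^ n" for n
    proof -
      have "real (nat \<lfloor>\<rho> \<omega> * 2 ^ n\<rfloor>) + 1 \<le> \<rho> \<omega> * 2 ^ n + 1" using pos[of \<omega>] by simp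
      then have "\<rho>' n \<omega> \<le> (\<rho> \<omega> * 2 ^ n + 1) / 2 ^ n" unfolding \<rho>'_def by (intro divide_right_mono) auto
      then show ?thesis by (simp add: add_divide_distrib power_one_over)
    qed
    have ge: "\<rho> \<omega> \<le> \<rho>' n \<omega>" for n using gt[of n] by simp
    have "(\<lambda>n. \<rho> \<omega> + (1 / 2) ^ n) \<longlonglongrightarrow> \<rho> \<omega> + 0"
      by (intro tendsto_intros LIMSEQ_power_zero) auto
    then have "(\<lambda>n. \<rho>' n \<omega>) \<longlonglongrightarrow> \<rho> \<omega>"
      using ge le
      by (intro tendsto_sandwich[of "\<lambda>_. \<rho> \<omega>" "\<lambda>n. \<rho>' n \<omega>" _ "\<lambda>n. \<rho> \<omega> + (1 / 2) ^ n"])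
         (simp_all add: always_eventually)
    then have "filterlim (\<lambda>n. \<rho>' n \<omega>) (at_right (\<rho> \<omega>)) sequentially"
      using gt by (simp add: filterlim_at less_imp_neq[symmetric] always_eventually)
    then have "\<forall>\<^sub>F n in sequentially. N (\<rho>' n \<omega>) \<omega> = N (\<rho> \<omega>) \<omega>"
      using right[of \<omega>] pos[of \<omega>] unfolding counting_path_def filterlim_iff by blast
    then show ?thesis by (intro tendsto_eventually) (auto elim: eventually_mono)
  qed
  have "(\<lambda>\<omega>. real (N (\<rho> \<omega>) \<omega>)) \<in> borel_measurable M"
    using lim by (rule borel_measurable_LIMSEQ_real) (use meas in measurable)
  then have "(\<lambda>\<omega>. nat \<lfloor>real (N (\<rho> \<omega>) \<omega>)\<rfloor>) \<in> M \<rightarrow>\<^sub>M count_space UNIV"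
    by measurable
  then show ?thesis by simp
qed

lemma measurable_clock_path:
  fixes N :: "'p::finite \<Rightarrow> real \<Rightarrow> 'w \<Rightarrow> nat"
  assumes N_meas: "\<And>p t. 0 \<le> t \<Longrightarrow> N p t \<in> M \<rightarrow>\<^sub>M count_space UNIV"
    and N: "\<And>p \<omega>. counting_path (\<lambda>t. N p t \<omega>)" and r: "\<And>c p. 0 \<le> r c p \<and> r c p \<le> b"
  shows "(\<lambda>\<omega>. clock_path (\<lambda>p t. N p t \<omega>) r t) \<in> M \<rightarrow>\<^sub>M count_space UNIV"
proof -
  have readings_meas: "(\<lambda>\<omega>. readings (\<lambda>p t. N p t \<omega>) (\<rho> \<omega>)) \<in> M \<rightarrow>\<^sub>M count_space UNIV"
    if "\<And>p. (\<lambda>\<omega>. \<rho> \<omega> p) \<in> borel_measurable M" "\<And>p \<omega>. 0 \<le> \<rho> \<omega> p" for \<rho> :: "'w \<Rightarrow> 'p \<Rightarrow> real"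
  proof (subst measurable_count_space_eq2_countable)
    have [measurable]: "(\<lambda>\<omega>. N p (\<rho> \<omega> p) \<omega>) \<in> M \<rightarrow>\<^sub>M count_space UNIV" for p
      by (rule measurable_counting_path_compose[OF N_meas N that(1) that(2)])
    have "(\<lambda>\<omega>. readings (\<lambda>p t. N p t \<omega>) (\<rho> \<omega>)) -` {v} \<inter> space M
        = {\<omega>\<in>space M. \<forall>p. N p (\<rho> \<omega> p) \<omega> = v p}" for v
      by (auto simp: readings_def fun_eq_iff)
    moreover have "{\<omega>\<in>space M. \<forall>p. N p (\<rho> \<omega> p) \<omega> = v p} \<in> sets M" for v by measurable
    ultimately show "(\<lambda>\<omega>. readings (\<lambda>p t. N p t \<omega>) (\<rho> \<omega>)) \<in> space M \<rightarrow> UNIV \<and>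
      (\<forall>v\<in>UNIV. (\<lambda>\<omega>. readings (\<lambda>p t. N p t \<omega>) (\<rho> \<omega>)) -` {v} \<inter> space M \<in> sets M)"
      by auto
  qed
  let ?S = "\<lambda>k \<omega>. clock_state (\<lambda>p t. N p t \<omega>) r k"
  have pos: "\<forall>p. 0 \<le> snd (?S k \<omega>) p" for k \<omega>
    by (rule clocks_nonneg[OF N r])
  have adv_meas: "(\<lambda>\<omega>. advance (\<lambda>p t. N p t \<omega>) r (\<rho> \<omega>) (s \<omega>) p) \<in> borel_measurable M"
    if "\<And>p. (\<lambda>\<omega>. \<rho> \<omega> p) \<in> borel_measurable M" "\<And>p \<omega>. 0 \<le> \<rho> \<omega> p" "s \<in> borel_measurable M"
    for \<rho> :: "'w \<Rightarrow> 'p \<Rightarrow> real" and s p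
  proof -
    have "(\<lambda>\<omega>. r (readings (\<lambda>p t. N p t \<omega>) (\<rho> \<omega>)) p) \<in> borel_measurable M"
      using readings_meas[OF that(1,2)] by (rule measurable_compose) auto
    then show ?thesis unfolding advance_def using that by measurable
  qed
  have state_meas: "(\<lambda>\<omega>. fst (?S k \<omega>)) \<in> borel_measurable M \<and> (\<forall>p. (\<lambda>\<omega>. snd (?S k \<omega>) p) \<in> borel_measurable M)" for k
  proof (induction k)
    case (Suc k)
    let ?d = "\<lambda>\<omega>. next_event (\<lambda>p t. N p t \<omega>) r (snd (?S k \<omega>))"
    have nb: "0 < ?d \<omega>" "?d \<omega> \<le> 1" for \<omega>
      by (rule next_event_bounds[OF N r pos])+
    have nle: "?d \<omega> \<le> s \<longleftrightarrow> readings (\<lambda>p t. N p t \<omega>) (advance (\<lambda>p t. N p t \<omega>) r (snd (?S k \<omega>)) s)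
            \<noteq> readings (\<lambda>p t. N p t \<omega>) (snd (?S k \<omega>))" if "0 \<le> s" "s < 1" for \<omega> s
      by (rule next_event_le_iff[OF N r pos that])
    have "{\<omega>\<in>space M. ?d \<omega> \<le> s} \<in> sets M" for s
    proof -
      consider "s < 0" | "0 \<le> s" "s < 1" | "1 \<le> s" by linarith
      then show ?thesis
      proof cases
        case 1
        then have eq: "{\<omega>\<in>space M. ?d \<omega> \<le> s} = {}"
          using nb(1) by (auto simp: not_le intro: less_trans)
        show ?thesis unfolding eq by simp
      next
        case 2
        have "(\<lambda>\<omega>. readings (\<lambda>p t. N p t \<omega>) (advance (\<lambda>p t. N p t \<omega>) r (snd (?S k \<omega>)) s)) \<in> M \<rightarrow>\<^sub>M count_space UNIV"
          using Suc 2 r pos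
          by (intro readings_meas adv_meas) (auto simp: advance_def intro!: add_nonneg_nonneg mult_nonneg_nonneg)
        moreover have "(\<lambda>\<omega>. readings (\<lambda>p t. N p t \<omega>) (snd (?S k \<omega>))) \<in> M \<rightarrow>\<^sub>M count_space UNIV"
          using Suc pos by (intro readings_meas) auto
        ultimately have "{\<omega>\<in>space M. readings (\<lambda>p t. N p t \<omega>) (advance (\<lambda>p t. N p t \<omega>) r (snd (?S k \<omega>)) s)
            \<noteq> readings (\<lambda>p t. N p t \<omega>) (snd (?S k \<omega>))} \<in> sets M"
          by measurable
        then show ?thesis using nle[OF 2] by simp
      next
        case 3
        then have eq: "{\<omega>\<in>space M. ?d \<omega> \<le> s} = space M"
          using nb(2) by (auto intro: order_trans)
        show ?thesis unfolding eq by simp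
      qed
    qed
    then have d: "?d \<in> borel_measurable M" by (simp add: borel_measurable_iff_le)
    show ?case
      using Suc d pos by (auto simp: clock_state.simps(2) case_prod_beta Let_def intro!: adv_meas borel_measurable_add)
  qed simp
  have least: "(\<lambda>\<omega>. LEAST k. t < fst (?S (Suc k) \<omega>)) \<in> M \<rightarrow>\<^sub>M count_space UNIV"
  proof (rule measurable_Least)
    fix k
    have [measurable]: "(\<lambda>\<omega>. fst (?S (Suc k) \<omega>)) \<in> borel_measurable M" using state_meas by blast
    show "(\<lambda>\<omega>. t < fst (?S (Suc k) \<omega>)) \<in> M \<rightarrow>\<^sub>M count_space UNIV" by measurable
  qed
  have "(\<lambda>\<omega>. readings (\<lambda>p t. N p t \<omega>) (snd (?S k \<omega>))) \<in> M \<rightarrow>\<^sub>M count_space UNIV" for k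
    by (rule readings_meas) (use state_meas pos in blast)+
  then show ?thesis
    unfolding clock_path_def by (rule measurable_compose_countable[OF _ least])
qed

section \<open>Feasible policies admit controlled processes\<close>

text \<open>
  One clock of speed \<open>1\<close> per class counts arrivals; one clock per pair of a class and a station, of speed \<open>\<Psi>\<^sub>i\<^sub>j\<close>,
  counts departures. The state is a function of the readings, so \<open>clock_path\<close> solves the system. On a null
  set the primitive paths are replaced by \<open>0\<close>, which makes the construction measurable on the whole space.
\<close>

lemma feasible_policy_is_P_SCP:
  fixes M :: "'w measure" and f :: "('i::finite \<Rightarrow> nat) \<Rightarrow> 'i \<Rightarrow> 'j::finite \<Rightarrow> nat"
  assumes f: "\<And>x. feasible_allocation E N x (f x)"
    and A_meas: "\<And>i t. 0 \<le> t \<Longrightarrow> A i t \<in> M \<rightarrow>\<^sub>M count_space UNIV"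
    and S_meas: "\<And>i j t. 0 \<le> t \<Longrightarrow> S i j t \<in> M \<rightarrow>\<^sub>M count_space UNIV"
    and paths: "AE \<omega> in M. (\<forall>i. counting_path (\<lambda>t. A i t \<omega>)) \<and>
      (\<forall>i j. counting_path (\<lambda>t. S i j t \<omega>) \<and> unit_jumps (\<lambda>t. S i j t \<omega>) \<and> S i j 0 \<omega> = 0)"
  shows "P_SCP M E N X0 A S f"
proof -
  obtain B where B: "{\<omega>\<in>space M. \<not> ((\<forall>i. counting_path (\<lambda>t. A i t \<omega>)) \<and>
      (\<forall>i j. counting_path (\<lambda>t. S i j t \<omega>) \<and> unit_jumps (\<lambda>t. S i j t \<omega>) \<and> S i j 0 \<omega> = 0))} \<subseteq> B"
    "emeasure M B = 0" "B \<in> sets M"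
    using paths by (rule AE_E)
  define G where "G = space M - B"
  have G: "G \<in> sets M" using B by (simp add: G_def)
  have G_paths: "counting_path (\<lambda>t. A i t \<omega>)" "counting_path (\<lambda>t. S i j t \<omega>)"
    "unit_jumps (\<lambda>t. S i j t \<omega>)" "S i j 0 \<omega> = 0" if "\<omega> \<in> G" for \<omega> i j
    using B(1) that unfolding G_def by blast+
  define Q :: "'i + 'i \<times> 'j \<Rightarrow> real \<Rightarrow> 'w \<Rightarrow> nat" where
    "Q p t \<omega> = (if \<omega> \<in> G then (case p of Inl i \<Rightarrow> A i t \<omega> | Inr (i, j) \<Rightarrow> S i j t \<omega>) else 0)" for p t \<omega>
  have Q_meas: "Q p t \<in> M \<rightarrow>\<^sub>M count_space UNIV" if "0 \<le> t" for p t
  proof -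
    have "(\<lambda>\<omega>. case p of Inl i \<Rightarrow> A i t \<omega> | Inr (i, j) \<Rightarrow> S i j t \<omega>) \<in> M \<rightarrow>\<^sub>M count_space UNIV"
      using A_meas[OF that] S_meas[OF that] by (cases p) (simp_all add: case_prod_beta)
    then show ?thesis
      unfolding Q_def[abs_def] using G by (intro measurable_If) (auto simp: pred_def)
  qed
  have Q_path: "counting_path (\<lambda>t. Q p t \<omega>)" for p \<omega>
  proof (cases "\<omega> \<in> G")
    case True
    then show ?thesis using G_paths(1,2) by (cases p) (simp_all add: Q_def case_prod_beta)
  next
    case False
    then show ?thesis by (simp add: Q_def counting_path_def mono_on_def)
  qed
  define pop :: "('i + 'i \<times> 'j \<Rightarrow> nat) \<Rightarrow> 'i \<Rightarrow> nat" where
    "pop c i = nat (int (X0 i) + int (c (Inl i)) - (\<Sum>j\<in>UNIV. int (c (Inr (i, j)))))" for c i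
  define r :: "('i + 'i \<times> 'j \<Rightarrow> nat) \<Rightarrow> 'i + 'i \<times> 'j \<Rightarrow> real" where
    "r c p = (case p of Inl i \<Rightarrow> 1 | Inr (i, j) \<Rightarrow> real (f (pop c) i j))" for c p
  define b where "b = 1 + real (\<Sum>j\<in>UNIV. N j)"
  have f_le: "f x i j \<le> (\<Sum>j\<in>UNIV. N j)" for x i j
  proof -
    have "f x i j \<le> (\<Sum>i\<in>UNIV. f x i j)" by (rule member_le_sum) auto
    also have "\<dots> \<le> N j" using f[of x] by (simp add: feasible_allocation_def)
    also have "\<dots> \<le> (\<Sum>j\<in>UNIV. N j)" by (rule member_le_sum) auto
    finally show ?thesis .
  qed
  have r: "0 \<le> r c p \<and> r c p \<le> b" for c p
  proof (cases p)
    case (Inr q)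
    obtain i j where "q = (i, j)" by (cases q)
    then have "r c p = real (f (pop c) i j)" using Inr by (simp add: r_def)
    moreover have "real (f (pop c) i j) \<le> real (\<Sum>j\<in>UNIV. N j)" using f_le by (rule of_nat_mono)
    ultimately show ?thesis by (simp add: b_def)
  qed (simp add: r_def b_def sum_nonneg)
  define C where "C t \<omega> = clock_path (\<lambda>p t. Q p t \<omega>) r t" for t \<omega>
  have C_meas: "C t \<in> M \<rightarrow>\<^sub>M count_space UNIV" for t
    unfolding C_def[abs_def] by (rule measurable_clock_path[OF Q_meas Q_path r])
  have C_step: "step_path (\<lambda>t. C t \<omega>)" for \<omega>
    unfolding C_def by (rule step_path_clock_path[OF Q_path r])
  have C_eq: "C t \<omega> p = Q p (integral {0..t} (\<lambda>s. r (C s \<omega>) p)) \<omega>" if "0 \<le> t" for t \<omega> p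
    unfolding C_def by (rule clock_path_solves[OF Q_path r that])
  have C_inv: "(\<Sum>j\<in>UNIV. C t \<omega> (Inr (i, j))) \<le> X0 i + C t \<omega> (Inl i)" if "\<omega> \<in> G" "0 \<le> t" for t \<omega> i
  proof -
    define P :: "('i + 'i \<times> 'j \<Rightarrow> nat) \<Rightarrow> bool" where
      "P c \<longleftrightarrow> (\<Sum>j\<in>UNIV. c (Inr (i, j))) \<le> X0 i + c (Inl i)" for c
    have "P (clock_path (\<lambda>p t. Q p t \<omega>) r t)"
    proof (rule clock_path_invariant[OF Q_path r])
      show "P (\<lambda>p. Q p 0 \<omega>)" using G_paths(4)[OF that(1)] that by (simp add: P_def Q_def)
    next
      fix c c' :: "'i + 'i \<times> 'j \<Rightarrow> nat"
      assume c: "P c" and le: "\<And>p. c p \<le> c' p" and idle: "\<And>p. r c p = 0 \<Longrightarrow> c' p = c p"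
        and unit: "\<And>p. unit_jumps (\<lambda>t. Q p t \<omega>) \<Longrightarrow> c' p \<le> c p + 1"
      have "c' (Inr (i, j)) \<le> c (Inr (i, j)) + f (pop c) i j" for j
      proof (cases "f (pop c) i j = 0")
        case True
        then show ?thesis using idle[of "Inr (i, j)"] by (simp add: r_def)
      next
        case False
        have "unit_jumps (\<lambda>t. Q (Inr (i, j)) t \<omega>)" using G_paths(3)[OF that(1)] that by (simp add: Q_def)
        then show ?thesis using unit[of "Inr (i, j)"] False by simp
      qed
      then have "(\<Sum>j\<in>UNIV. c' (Inr (i, j))) \<le> (\<Sum>j\<in>UNIV. c (Inr (i, j)) + f (pop c) i j)"
        by (intro sum_mono)
      also have "\<dots> = (\<Sum>j\<in>UNIV. c (Inr (i, j))) + (\<Sum>j\<in>UNIV. f (pop c) i j)" by (rule sum.distrib)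
      also have "(\<Sum>j\<in>UNIV. f (pop c) i j) \<le> pop c i" using f[of "pop c"] by (simp add: feasible_allocation_def)
      also have "(\<Sum>j\<in>UNIV. c (Inr (i, j))) + pop c i = X0 i + c (Inl i)"
        using c by (simp add: P_def pop_def flip: of_nat_sum)
      also have "\<dots> \<le> X0 i + c' (Inl i)" using le by simp
      finally show "P c'" by (simp add: P_def)
    qed (fact that)
    then show ?thesis by (simp add: P_def C_def)
  qed
  define X where "X i t \<omega> = pop (C t \<omega>) i" for i t \<omega>
  define \<Psi> where "\<Psi> i j t \<omega> = f (pop (C t \<omega>)) i j" for i j t \<omega>
  define Y where "Y i t \<omega> = X i t \<omega> - (\<Sum>j\<in>UNIV. \<Psi> i j t \<omega>)" for i t \<omega>
  define Z where "Z j t \<omega> = N j - (\<Sum>i\<in>UNIV. \<Psi> i j t \<omega>)" for j t \<omega>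
  have meas: "(\<lambda>\<omega>. F (C t \<omega>)) \<in> M \<rightarrow>\<^sub>M count_space UNIV" for F :: "_ \<Rightarrow> nat" and t
    by (rule measurable_compose[OF C_meas]) simp
  have cad: "cadlag (\<lambda>t. F (C t \<omega>))" for F :: "_ \<Rightarrow> nat" and \<omega>
    unfolding cadlag_nat_iff_step_path by (rule step_path_comp[OF C_step])
  have "controlled_process M E N X0 A S f X Y Z \<Psi>"
    unfolding controlled_process_def
  proof (intro conjI allI impI)
    show "X i t \<in> M \<rightarrow>\<^sub>M count_space UNIV" for i t
      using meas[of "\<lambda>c. pop c i" t] by (simp add: X_def[abs_def])
    show "\<Psi> i j t \<in> M \<rightarrow>\<^sub>M count_space UNIV" for i j t
      using meas[of "\<lambda>c. f (pop c) i j" t] by (simp add: \<Psi>_def[abs_def])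
    show "Y i t \<in> M \<rightarrow>\<^sub>M count_space UNIV" for i t
      using meas[of "\<lambda>c. pop c i - (\<Sum>j\<in>UNIV. f (pop c) i j)" t]
      by (simp add: X_def \<Psi>_def Y_def[abs_def])
    show "Z j t \<in> M \<rightarrow>\<^sub>M count_space UNIV" for j t
      using meas[of "\<lambda>c. N j - (\<Sum>i\<in>UNIV. f (pop c) i j)" t]
      by (simp add: \<Psi>_def Z_def[abs_def])
    have "AE \<omega> in M. \<omega> \<notin> B" using B by (intro AE_not_in) auto
    then show "AE \<omega> in M.
        system_equations E N X0 (\<lambda>i t. A i t \<omega>) (\<lambda>i j t. S i j t \<omega>)
          (\<lambda>i t. X i t \<omega>) (\<lambda>i t. Y i t \<omega>) (\<lambda>j t. Z j t \<omega>) (\<lambda>i j t. \<Psi> i j t \<omega>) \<and>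
        (\<forall>t\<ge>0. \<forall>i j. \<Psi> i j t \<omega> = f (\<lambda>i'. X i' t \<omega>) i j)"
      using AE_space
    proof eventually_elim
      case (elim \<omega>)
      then have \<omega>: "\<omega> \<in> G" by (simp add: G_def)
      have pop_X: "pop (C t \<omega>) = (\<lambda>i'. X i' t \<omega>)" for t by (simp add: X_def fun_eq_iff)
      have feas: "feasible_allocation E N (pop (C t \<omega>)) (\<lambda>i j. \<Psi> i j t \<omega>)" for t
        unfolding \<Psi>_def by (rule f)
      show ?case
        unfolding system_equations_def
      proof (intro conjI allI impI)
        show "cadlag (\<lambda>t. X i t \<omega>)" for i
          using cad[of "\<lambda>c. pop c i"] by (simp add: X_def)
        show "cadlag (\<lambda>t. \<Psi> i j t \<omega>)" for i j
          using cad[of "\<lambda>c. f (pop c) i j"] by (simp add: \<Psi>_def)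
        show "cadlag (\<lambda>t. Y i t \<omega>)" for i
          using cad[of "\<lambda>c. pop c i - (\<Sum>j\<in>UNIV. f (pop c) i j)"] by (simp add: X_def \<Psi>_def Y_def)
        show "cadlag (\<lambda>t. Z j t \<omega>)" for j
          using cad[of "\<lambda>c. N j - (\<Sum>i\<in>UNIV. f (pop c) i j)"] by (simp add: \<Psi>_def Z_def)
        fix t :: real assume t: "0 \<le> t"
        show "\<Psi> i j t \<omega> = 0" if "(i, j) \<notin> E" for i j
          using feas[of t] that by (simp add: feasible_allocation_def)
        show "Y i t \<omega> + (\<Sum>j\<in>UNIV. \<Psi> i j t \<omega>) = X i t \<omega>" for i
          using feas[of t] by (simp add: feasible_allocation_def Y_def X_def)
        show "Z j t \<omega> + (\<Sum>i\<in>UNIV. \<Psi> i j t \<omega>) = N j" for j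
          using feas[of t] by (simp add: feasible_allocation_def Z_def)
        show "\<Psi> i j t \<omega> = f (\<lambda>i'. X i' t \<omega>) i j" for i j
          by (simp add: \<Psi>_def pop_X)
        have arr: "C t \<omega> (Inl i) = A i t \<omega>" for i
          using C_eq[OF t, of \<omega> "Inl i"] t \<omega> by (simp add: r_def Q_def)
        have dep: "C t \<omega> (Inr (i, j)) = S i j (integral {0..t} (\<lambda>s. real (\<Psi> i j s \<omega>))) \<omega>" for i j
          using C_eq[OF t, of \<omega> "Inr (i, j)"] \<omega> by (simp add: r_def Q_def \<Psi>_def)
        show "int (X i t \<omega>) = int (X0 i) + int (A i t \<omega>)
               - (\<Sum>j\<in>UNIV. int (S i j (integral {0..t} (\<lambda>s. real (\<Psi> i j s \<omega>))) \<omega>))" for i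
          using C_inv[OF \<omega> t, of i]
          by (simp add: X_def pop_def arr flip: of_nat_sum dep)
      qed
    qed
  qed
  then show ?thesis unfolding P_SCP_def by blast
qed

section \<open>Poisson processes and deviations on a grid\<close>

lemma poisson_pmf_second_moment:
  assumes "0 < m"
  shows "(\<integral>\<^sup>+k. ennreal ((real k - m)\<^sup>2) \<partial>measure_pmf (poisson_pmf m)) = ennreal m"
proof -
  have e: "(\<lambda>k. m ^ k / fact k) sums exp m"
    using exp_converges[of m] by (simp add: scaleR_conv_of_real divide_inverse mult.commute)
  have e1: "(\<lambda>k. real k * (m ^ k / fact k)) sums (m * exp m)"
  proof -
    have "(\<lambda>k. real (Suc k) * (m ^ Suc k / fact (Suc k))) = (\<lambda>k. m * (m ^ k / fact k))"
      by (simp add: fun_eq_iff divide_simps del: of_nat_Suc)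
    then have "(\<lambda>k. real (Suc k) * (m ^ Suc k / fact (Suc k))) sums (m * exp m)"
      using sums_mult[OF e, of m] by simp
    then show ?thesis by (subst (asm) sums_Suc_iff) simp
  qed
  have e2: "(\<lambda>k. real k * real k * (m ^ k / fact k)) sums (m * (m * exp m + exp m))"
  proof -
    have "(\<lambda>k. real (Suc k) * real (Suc k) * (m ^ Suc k / fact (Suc k)))
        = (\<lambda>k. m * (real k * (m ^ k / fact k) + m ^ k / fact k))"
      by (simp add: fun_eq_iff divide_simps) (simp add: algebra_simps)
    then have "(\<lambda>k. real (Suc k) * real (Suc k) * (m ^ Suc k / fact (Suc k))) sums (m * (m * exp m + exp m))"
      using sums_mult[OF sums_add[OF e1 e], of m] by simp
    then show ?thesis by (subst (asm) sums_Suc_iff) simp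
  qed
  have "(\<lambda>k. exp (- m) * (real k * real k * (m ^ k / fact k) - 2 * m * (real k * (m ^ k / fact k))
      + m\<^sup>2 * (m ^ k / fact k))) sums
      (exp (- m) * (m * (m * exp m + exp m) - 2 * m * (m * exp m) + m\<^sup>2 * exp m))"
    by (intro sums_mult sums_add sums_diff e e1 e2)
  also have "(exp (- m) * (m * (m * exp m + exp m) - 2 * m * (m * exp m) + m\<^sup>2 * exp m)) = m"
    by (simp add: exp_minus field_simps power2_eq_square)
  also have "(\<lambda>k. exp (- m) * (real k * real k * (m ^ k / fact k) - 2 * m * (real k * (m ^ k / fact k))
      + m\<^sup>2 * (m ^ k / fact k))) = (\<lambda>k. pmf (poisson_pmf m) k * (real k - m)\<^sup>2)"
    using assms by (simp add: fun_eq_iff power2_eq_square algebra_simps add_divide_distrib)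
  finally have "(\<lambda>k. pmf (poisson_pmf m) k * (real k - m)\<^sup>2) sums m" .
  then have "(\<Sum>k. ennreal (pmf (poisson_pmf m) k * (real k - m)\<^sup>2)) = ennreal m"
    by (intro suminf_ennreal_eq) auto
  then show ?thesis
    by (simp add: nn_integral_measure_pmf nn_integral_count_space_nat ennreal_mult)
qed

lemma poisson_pmf_tail:
  assumes "0 < m" "0 < \<beta>"
  shows "measure (measure_pmf (poisson_pmf m)) {k. \<beta> \<le> \<bar>real k - m\<bar>} \<le> m / \<beta>\<^sup>2"
proof -
  have "has_bochner_integral (measure_pmf (poisson_pmf m)) (\<lambda>k. (real k - m)\<^sup>2) m"
    using poisson_pmf_second_moment[OF assms(1)] assms
    by (intro has_bochner_integral_nn_integral) auto
  then show ?thesis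
    using prob_space.finite_measure[OF prob_space_measure_pmf]
      finite_measure.second_moment_method[of "measure_pmf (poisson_pmf m)" "\<lambda>k. real k - m" \<beta>] assms
    by (simp add: has_bochner_integral_iff)
qed

lemma poisson_process_tail:
  assumes "prob_space M" and S: "poisson_process M r S" and r: "0 \<le> r" and t: "0 \<le> t" and \<beta>: "0 < \<beta>"
  shows "measure M {\<omega>\<in>space M. \<beta> < \<bar>real (S t \<omega>) - r * t\<bar>} \<le> r * t / \<beta>\<^sup>2"
proof -
  interpret prob_space M by fact
  have [measurable]: "S u \<in> M \<rightarrow>\<^sub>M count_space UNIV" if "0 \<le> u" for u
    using S that by (simp add: poisson_process_def)
  have S0: "AE \<omega> in M. S 0 \<omega> = 0" using S by (auto simp: poisson_process_def)
  show ?thesis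
  proof (cases "r = 0 \<or> t = 0")
    case True
    have zero: "\<not> \<beta> < \<bar>real 0 - r * t\<bar>" using True \<beta> by auto
    have "AE \<omega> in M. S t \<omega> = 0" using True S S0 t by (auto simp: poisson_process_def)
    then have "AE \<omega> in M. \<not> \<beta> < \<bar>real (S t \<omega>) - r * t\<bar>"
      by eventually_elim (use zero in simp)
    then have "emeasure M {\<omega>\<in>space M. \<not> \<not> \<beta> < \<bar>real (S t \<omega>) - r * t\<bar>} = 0" by (rule AE_E2)
    then have "measure M {\<omega>\<in>space M. \<beta> < \<bar>real (S t \<omega>) - r * t\<bar>} = 0" by (simp add: measure_def)
    then show ?thesis using True by auto
  next
    case False
    then have rt: "0 < r" "0 < t" using r t by auto
    have d: "distr M (count_space UNIV) (\<lambda>\<omega>. S t \<omega> - S 0 \<omega>) = measure_pmf (poisson_pmf (r * t))"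
    proof -
      have "\<forall>s t. 0 \<le> s \<longrightarrow> s < t \<longrightarrow>
          distr M (count_space UNIV) (\<lambda>\<omega>. S t \<omega> - S s \<omega>) = measure_pmf (poisson_pmf (r * (t - s)))"
        using S rt(1) unfolding poisson_process_def by auto
      from this[rule_format, of 0 t] show ?thesis using rt(2) by simp
    qed
    have "measure M {\<omega>\<in>space M. \<beta> < \<bar>real (S t \<omega>) - r * t\<bar>}
        = measure M {\<omega>\<in>space M. \<beta> < \<bar>real (S t \<omega> - S 0 \<omega>) - r * t\<bar>}"
    proof (rule finite_measure_eq_AE)
      show "AE \<omega> in M. \<omega> \<in> {\<omega>\<in>space M. \<beta> < \<bar>real (S t \<omega>) - r * t\<bar>} \<longleftrightarrow>
          \<omega> \<in> {\<omega>\<in>space M. \<beta> < \<bar>real (S t \<omega> - S 0 \<omega>) - r * t\<bar>}"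
        using S0 by eventually_elim simp
    qed (use t in measurable)
    also have "\<dots> \<le> measure M {\<omega>\<in>space M. \<beta> \<le> \<bar>real (S t \<omega> - S 0 \<omega>) - r * t\<bar>}"
      using t by (intro finite_measure_mono) auto
    also have "\<dots> = measure (distr M (count_space UNIV) (\<lambda>\<omega>. S t \<omega> - S 0 \<omega>)) {k. \<beta> \<le> \<bar>real k - r * t\<bar>}"
      using t by (subst measure_distr) (auto intro!: arg_cong[where f = "measure M"])
    also have "\<dots> \<le> r * t / \<beta>\<^sup>2" unfolding d using rt \<beta> by (intro poisson_pmf_tail) auto
    finally show ?thesis .
  qed
qed

lemma poisson_pmf_two_or_more:
  assumes "0 < m"
  shows "measure (measure_pmf (poisson_pmf m)) {k. 2 \<le> k} \<le> m\<^sup>2"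
proof -
  have "measure (measure_pmf (poisson_pmf m)) {k. 2 \<le> k} = 1 - measure (measure_pmf (poisson_pmf m)) {0, 1}"
  proof -
    have "{k. 2 \<le> k} = UNIV - {0, 1::nat}" by auto
    then show ?thesis using measure_pmf.prob_compl[of "{0, 1}" "poisson_pmf m"] by simp
  qed
  also have "measure (measure_pmf (poisson_pmf m)) {0, 1} = exp (- m) + m * exp (- m)"
    using assms by (subst measure_measure_pmf_finite) auto
  also have "1 - (exp (- m) + m * exp (- m)) = 1 - exp (- m) * (1 + m)" by (simp add: algebra_simps)
  also have "\<dots> \<le> 1 - (1 - m) * (1 + m)"
    using exp_ge_add_one_self[of "- m"] assms by (intro diff_left_mono mult_right_mono) auto
  also have "\<dots> = m\<^sup>2" by (simp add: algebra_simps power2_eq_square)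
  finally show ?thesis .
qed

text \<open>
  A jump of size at least two shows up as an increment of at least two on a grid of every mesh.
  A Poisson process has such an increment on a given interval with probability at most the square of the
  mean, so that the probability of a jump of this size in a bounded time interval vanishes in the limit of fine meshes.
\<close>

lemma not_unit_jumps_witness:
  assumes mono: "mono_on {0..} g" and "\<not> unit_jumps g"
  shows "\<exists>K::nat. \<forall>n>0. \<exists>k<n * K. g (real k / real n) + 2 \<le> g (real (Suc k) / real n)"
proof -
  obtain t where t: "t > 0" "\<not> (\<forall>\<^sub>F s in at_left t. g t \<le> g s + 1)"
    using assms(2) by (auto simp: unit_jumps_def)
  have jump: "g s + 2 \<le> g t" if s: "0 \<le> s" "s < t" for s
  proof (rule ccontr)
    assume "\<not> g s + 2 \<le> g t"
    then have "g t \<le> g s' + 1" if "s < s'" for s'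
      using mono_onD[OF mono, of s s'] s that by auto
    then have "\<forall>\<^sub>F s in at_left t. g t \<le> g s + 1"
      using s(2) unfolding eventually_at_left_field by blast
    then show False using t by simp
  qed
  obtain K :: nat where K: "t < real K" using reals_Archimedean2 by blast
  show ?thesis
  proof (rule exI[of _ K], intro allI impI)
    fix n :: nat assume n: "n > 0"
    define k where "k = nat \<lceil>t * real n\<rceil> - 1"
    have pos: "t * real n > 0" using t n by simp
    then have c: "1 \<le> nat \<lceil>t * real n\<rceil>" by linarith
    have k: "real k < t * real n" "t * real n \<le> real (Suc k)" using pos c unfolding k_def by linarith+
    have "t * real n < real K * real n" using K n by (intro mult_strict_right_mono) auto
    then have "real k < real n * real K" using k(1) by (simp add: mult.commute)
    then have "k < n * K" by (metis of_nat_less_iff of_nat_mult)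
    moreover have lt: "real k / real n < t" "t \<le> real (Suc k) / real n"
      using k n by (simp_all add: divide_simps del: of_nat_Suc)
    have "g (real k / real n) + 2 \<le> g t" by (rule jump[OF _ lt(1)]) simp
    moreover have "g t \<le> g (real (Suc k) / real n)" using lt(2) t(1) by (intro mono_onD[OF mono]) auto
    ultimately show "\<exists>k<n * K. g (real k / real n) + 2 \<le> g (real (Suc k) / real n)"
      by (meson order_trans)
  qed
qed

lemma poisson_process_AE_paths:
  assumes "prob_space M" and S: "poisson_process M r S" and r: "0 \<le> r"
  shows "AE \<omega> in M. counting_path (\<lambda>t. S t \<omega>) \<and> unit_jumps (\<lambda>t. S t \<omega>) \<and> S 0 \<omega> = 0"
proof -
  interpret prob_space M by fact
  have S_meas: "S u \<in> M \<rightarrow>\<^sub>M count_space UNIV" if "0 \<le> u" for u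
    using S that by (simp add: poisson_process_def)
  have basic: "AE \<omega> in M. S 0 \<omega> = 0 \<and> mono_on {0..} (\<lambda>t. S t \<omega>) \<and> cadlag (\<lambda>t. S t \<omega>)"
    using S by (simp add: poisson_process_def)
  have "AE \<omega> in M. mono_on {0..} (\<lambda>t. S t \<omega>) \<longrightarrow> unit_jumps (\<lambda>t. S t \<omega>)"
  proof (cases "r = 0")
    case True
    then have "AE \<omega> in M. \<forall>t\<ge>0. S t \<omega> = 0" using S by (simp add: poisson_process_def)
    then show ?thesis by eventually_elim (auto simp: unit_jumps_def)
  next
    case False
    then have "r > 0" using r by simp
    define B where "B K n = (\<Union>k<n * K. {\<omega>\<in>space M. 2 \<le> S (real (Suc k) / real n) \<omega> - S (real k / real n) \<omega>})"
      for K n :: nat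
    have B_meas: "B K n \<in> sets M" for K n
    proof -
      have [measurable]: "S (real k / real n) \<in> M \<rightarrow>\<^sub>M count_space UNIV" for k by (rule S_meas) simp
      show ?thesis unfolding B_def by measurable
    qed
    have B_le: "measure M (B K n) \<le> real K * r\<^sup>2 / real n" if "n > 0" for K n
    proof -
      have one: "measure M {\<omega>\<in>space M. 2 \<le> S (real (Suc k) / real n) \<omega> - S (real k / real n) \<omega>} \<le> (r * (1 / real n))\<^sup>2" for k
      proof -
        have lt: "0 \<le> real k / real n" "real k / real n < real (Suc k) / real n"
          using that by (simp_all add: divide_strict_right_mono)
        have step: "real (Suc k) / real n - real k / real n = 1 / real n"
          by (simp add: diff_divide_distrib[symmetric])
        have [measurable]: "S (real k / real n) \<in> M \<rightarrow>\<^sub>M count_space UNIV" for k by (rule S_meas) simp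
        have d: "distr M (count_space UNIV) (\<lambda>\<omega>. S (real (Suc k) / real n) \<omega> - S (real k / real n) \<omega>)
            = measure_pmf (poisson_pmf (r * (1 / real n)))"
          using S False lt unfolding poisson_process_def step[symmetric] by auto
        have "measure M {\<omega>\<in>space M. 2 \<le> S (real (Suc k) / real n) \<omega> - S (real k / real n) \<omega>}
          = measure (distr M (count_space UNIV) (\<lambda>\<omega>. S (real (Suc k) / real n) \<omega> - S (real k / real n) \<omega>)) {k. 2 \<le> k}"
          by (subst measure_distr) (auto simp del: of_nat_Suc intro!: arg_cong[where f = "measure M"])
        also have "\<dots> \<le> (r * (1 / real n))\<^sup>2"
          unfolding d using \<open>r > 0\<close> that by (intro poisson_pmf_two_or_more) auto
        finally show ?thesis .
      qed
      have [measurable]: "S (real k / real n) \<in> M \<rightarrow>\<^sub>M count_space UNIV" for k by (rule S_meas) simp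
      have "measure M (B K n) \<le> (\<Sum>k<n * K. measure M {\<omega>\<in>space M. 2 \<le> S (real (Suc k) / real n) \<omega> - S (real k / real n) \<omega>})"
      proof -
        have "{\<omega>\<in>space M. 2 \<le> S (real (Suc k) / real n) \<omega> - S (real k / real n) \<omega>} \<in> sets M" for k
          by measurable
        then show ?thesis
          unfolding B_def by (intro finite_measure_subadditive_finite image_subsetI) auto
      qed
      also have "\<dots> \<le> (\<Sum>k<n * K. (r * (1 / real n))\<^sup>2)" by (intro sum_mono one)
      also have "\<dots> = real K * r\<^sup>2 / real n" using that by (simp add: power2_eq_square)
      finally show ?thesis .
    qed
    define B' where "B' K = (\<Inter>n\<in>{1..}. B K n)" for K
    have B'_meas: "B' K \<in> sets M" for K unfolding B'_def using B_meas by (intro sets.countable_INT') auto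
    have "measure M (B' K) = 0" for K
    proof -
      have "measure M (B' K) \<le> real K * r\<^sup>2 / real n" if "n > 0" for n
        using that B_meas by (intro order_trans[OF finite_measure_mono B_le]) (auto simp: B'_def)
      moreover have "(\<lambda>n. real K * r\<^sup>2 / real n) \<longlonglongrightarrow> 0" by (rule lim_const_over_n)
      ultimately have "measure M (B' K) \<le> 0"
        by (intro LIMSEQ_le_const[of "\<lambda>n. real K * r\<^sup>2 / real n"]) (auto intro!: exI[of _ 1])
      then show ?thesis using measure_nonneg[of M "B' K"] by linarith
    qed
    then have "B' K \<in> null_sets M" for K using B'_meas by (simp add: null_sets_def emeasure_eq_measure)
    then have "AE \<omega> in M. \<forall>K. \<omega> \<notin> B' K" by (simp add: AE_all_countable AE_not_in)
    then show ?thesis using AE_space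
    proof eventually_elim
      case (elim \<omega>)
      show ?case
      proof (intro impI, rule ccontr)
        assume "mono_on {0..} (\<lambda>t. S t \<omega>)" "\<not> unit_jumps (\<lambda>t. S t \<omega>)"
        from not_unit_jumps_witness[OF this] obtain K where
          K: "\<And>n. n > 0 \<Longrightarrow> \<exists>k<n * K. S (real k / real n) \<omega> + 2 \<le> S (real (Suc k) / real n) \<omega>" by blast
        have "\<omega> \<in> B' K"
          unfolding B'_def B_def
        proof
          fix n :: nat assume "n \<in> {1..}"
          then obtain k where "k < n * K" "S (real k / real n) \<omega> + 2 \<le> S (real (Suc k) / real n) \<omega>"
            using K[of n] by auto
          then show "\<omega> \<in> (\<Union>k<n * K. {\<omega>\<in>space M. 2 \<le> S (real (Suc k) / real n) \<omega> - S (real k / real n) \<omega>})"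
            using elim by (intro UN_I[of k]) auto
        qed
        then show False using elim by blast
      qed
    qed
  qed
  with basic show ?thesis
  proof eventually_elim
    case (elim \<omega>)
    then show ?case by (auto simp: counting_path_def cadlag_nat_iff_step_path step_path_def)
  qed
qed

text \<open>
  Between two grid points a monotone path stays between its values there, and the mean moves by at most
  \<open>\<beta> / 2\<close>. So a bound at \<open>G + 1\<close> points is enough, at the price of a factor \<open>G + 1\<close> in probability.
\<close>

lemma grid_deviation:
  fixes W :: "real \<Rightarrow> 'w \<Rightarrow> nat"
  assumes "prob_space M" and W_meas: "\<And>t. 0 \<le> t \<Longrightarrow> W t \<in> M \<rightarrow>\<^sub>M count_space UNIV"
    and mono: "AE \<omega> in M. mono_on {0..} (\<lambda>t. W t \<omega>)"
    and r: "0 \<le> r" and L: "0 < L" and G: "0 < G"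
    and pt: "\<And>t. 0 \<le> t \<Longrightarrow> t \<le> L \<Longrightarrow> measure M {\<omega>\<in>space M. \<beta> / 2 < \<bar>real (W t \<omega>) - r * t\<bar>} \<le> q"
    and fine: "r * L \<le> real G * (\<beta> / 2)"
  shows "\<exists>B\<in>sets M. measure M B \<le> (real G + 1) * q \<and>
    (\<forall>\<omega>\<in>space M - B. \<forall>t. 0 \<le> t \<longrightarrow> t \<le> L \<longrightarrow> \<bar>real (W t \<omega>) - r * t\<bar> \<le> \<beta>)"
proof -
  interpret prob_space M by fact
  define \<tau> where "\<tau> g = real g * L / real G" for g
  have \<tau>0: "0 \<le> \<tau> g" for g using L by (simp add: \<tau>_def)
  have \<tau>L: "\<tau> g \<le> L" if "g \<le> G" for g using L G that by (simp add: \<tau>_def divide_simps)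
  define D where "D g = {\<omega>\<in>space M. \<beta> / 2 < \<bar>real (W (\<tau> g) \<omega>) - r * \<tau> g\<bar>}" for g
  have D_meas: "D g \<in> sets M" for g
  proof -
    have [measurable]: "W (\<tau> g) \<in> M \<rightarrow>\<^sub>M count_space UNIV" by (intro W_meas \<tau>0)
    show ?thesis unfolding D_def by measurable
  qed
  obtain N where N: "{\<omega>\<in>space M. \<not> mono_on {0..} (\<lambda>t. W t \<omega>)} \<subseteq> N" "emeasure M N = 0" "N \<in> sets M"
    using mono by (rule AE_E)
  define B where "B = N \<union> (\<Union>g\<le>G. D g)"
  have "measure M (\<Union>g\<le>G. D g) \<le> (\<Sum>g\<le>G. measure M (D g))"
    using D_meas by (intro finite_measure_subadditive_finite) auto
  also have "\<dots> \<le> (\<Sum>g\<le>G. q)" unfolding D_def by (intro sum_mono pt \<tau>0 \<tau>L) auto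
  finally have "measure M (\<Union>g\<le>G. D g) \<le> (real G + 1) * q" by (simp add: algebra_simps)
  moreover have "measure M B \<le> measure M N + measure M (\<Union>g\<le>G. D g)"
    unfolding B_def using N D_meas by (intro measure_Un_le) auto
  moreover have "measure M N = 0" using N by (simp add: measure_def)
  ultimately have B_le: "measure M B \<le> (real G + 1) * q" by simp
  have fine': "r * (L / real G) \<le> \<beta> / 2" using fine G by (simp add: divide_simps mult_ac)
  have "\<bar>real (W t \<omega>) - r * t\<bar> \<le> \<beta>" if \<omega>: "\<omega> \<in> space M - B" and t: "0 \<le> t" "t \<le> L" for \<omega> t
  proof -
    have mon: "mono_on {0..} (\<lambda>t. W t \<omega>)" using N(1) \<omega> by (auto simp: B_def)
    have grid: "\<bar>real (W (\<tau> g) \<omega>) - r * \<tau> g\<bar> \<le> \<beta> / 2" if "g \<le> G" for g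
      using \<omega> that by (force simp: B_def D_def not_less)
    define g where "g = nat \<lfloor>t * real G / L\<rfloor>"
    have x0: "0 \<le> t * real G / L" using t L by simp
    then have g: "real g \<le> t * real G / L" "t * real G / L < real g + 1"
      unfolding g_def by linarith+
    have gL: "real g * L \<le> t * real G" "t * real G < (real g + 1) * L"
      using g L by (simp_all add: pos_le_divide_eq pos_divide_less_eq)
    have g1: "\<tau> g \<le> t" "t \<le> \<tau> g + L / real G"
      using gL G by (simp_all add: \<tau>_def divide_simps algebra_simps)
    have "t * real G \<le> L * real G" using t(2) by (intro mult_right_mono) auto
    then have "real g * L \<le> real G * L" using gL(1) by (simp only: mult.commute[of L])
    then have gG: "g \<le> G" using L by simp
    define g' where "g' = min (Suc g) G"
    have g': "g' \<le> G" "t \<le> \<tau> g'" "\<tau> g' \<le> t + L / real G"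
    proof -
      show "g' \<le> G" by (simp add: g'_def)
      have S: "\<tau> (Suc g) = \<tau> g + L / real G" by (simp add: \<tau>_def add_divide_distrib distrib_right)
      have GL: "\<tau> G = L" using G by (simp add: \<tau>_def)
      show "t \<le> \<tau> g'" using g1 t S GL by (auto simp: g'_def min_def)
      have "\<tau> g' \<le> \<tau> (Suc g)" unfolding \<tau>_def g'_def using L by (intro divide_right_mono mult_right_mono) auto
      then show "\<tau> g' \<le> t + L / real G" using S g1 by linarith
    qed
    have lower: "real (W (\<tau> g) \<omega>) \<le> real (W t \<omega>)"
      using mono_onD[OF mon, of "\<tau> g" t] \<tau>0 g1 t by simp
    have upper: "real (W t \<omega>) \<le> real (W (\<tau> g') \<omega>)"
      using mono_onD[OF mon, of t "\<tau> g'"] \<tau>0 g' t by simp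
    have "r * t \<le> r * (\<tau> g + L / real G)" using g1 r by (intro mult_left_mono)
    then have a: "r * t \<le> r * \<tau> g + r * (L / real G)" by (simp only: distrib_left)
    have "r * \<tau> g' \<le> r * (t + L / real G)" using g' r by (intro mult_left_mono)
    then have b: "r * \<tau> g' \<le> r * t + r * (L / real G)" by (simp only: distrib_left)
    show ?thesis using grid[OF gG] grid[OF g'(1)] lower upper a b fine' by linarith
  qed
  moreover have "B \<in> sets M" unfolding B_def using N D_meas by auto
  ultimately show ?thesis using B_le by blast
qed

section \<open>Renewal arrivals\<close>

text \<open>
  By independence the mixed term vanishes when one summand is added.
\<close>

lemma interarrival_second_moment:
  fixes l :: nat
  assumes "prob_space M" and U: "interarrival_times M U"
  shows "integrable M (\<lambda>\<omega>. (\<Sum>k=1..l. U i k \<omega> - 1)\<^sup>2) \<and>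
    integral\<^sup>L M (\<lambda>\<omega>. (\<Sum>k=1..l. U i k \<omega> - 1)\<^sup>2) = real l * integral\<^sup>L M (\<lambda>\<omega>. (U i 1 \<omega> - 1)\<^sup>2)"
proof -
  interpret prob_space M by fact
  have indepU: "indep_vars (\<lambda>_. borel) (\<lambda>(i, k). U i k) (UNIV \<times> {1..})"
    and dist: "\<And>k. k \<ge> 1 \<Longrightarrow> distr M borel (U i k) = distr M borel (U i 1)"
    and int1: "\<And>k. k \<ge> 1 \<Longrightarrow> integrable M (U i k)"
    and exp1: "\<And>k. k \<ge> 1 \<Longrightarrow> expectation (U i k) = 1"
    and int2: "\<And>k. k \<ge> 1 \<Longrightarrow> integrable M (\<lambda>\<omega>. (U i k \<omega>)\<^sup>2)"
    using U unfolding interarrival_times_def by blast+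
  have rv: "U i k \<in> borel_measurable M" if "k \<ge> 1" for k using int1[OF that] by simp
  define X where "X k \<omega> = U i k \<omega> - 1" for k \<omega>
  have X_rv[measurable]: "X k \<in> borel_measurable M" if "k \<ge> 1" for k
    using rv[OF that] unfolding X_def[abs_def] by measurable
  have X_int: "integrable M (X k)" "expectation (X k) = 0" if "k \<ge> 1" for k
    using int1[OF that] exp1[OF that] by (simp_all add: X_def[abs_def] prob_space)
  have X_int2: "integrable M (\<lambda>\<omega>. (X k \<omega>)\<^sup>2)" if "k \<ge> 1" for k
    using int1[OF that] int2[OF that] by (simp add: X_def[abs_def] power2_diff)
  have X_var: "expectation (\<lambda>\<omega>. (X k \<omega>)\<^sup>2) = expectation (\<lambda>\<omega>. (X 1 \<omega>)\<^sup>2)" if "k \<ge> 1" for k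
  proof -
    have m: "(\<lambda>x::real. (x - 1)\<^sup>2) \<in> borel_measurable borel" by measurable
    have "expectation (\<lambda>\<omega>. (U i k \<omega> - 1)\<^sup>2) = integral\<^sup>L (distr M borel (U i k)) (\<lambda>x. (x - 1)\<^sup>2)"
      by (rule integral_distr[symmetric, OF rv[OF that] m])
    also have "\<dots> = expectation (\<lambda>\<omega>. (U i 1 \<omega> - 1)\<^sup>2)"
      unfolding dist[OF that] by (rule integral_distr[OF rv m]) simp
    finally show ?thesis by (simp add: X_def)
  qed
  define X' where "X' q \<omega> = U (fst q) (snd q) \<omega> - 1" for q \<omega>
  have "indep_vars (\<lambda>_. borel) (\<lambda>q \<omega>. (\<lambda>x. x - 1) ((\<lambda>(i, k). U i k) q \<omega>)) (UNIV \<times> {1..})"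
    using indepU by (rule indep_vars_compose2) simp
  then have indepX: "indep_vars (\<lambda>_. borel) X' (UNIV \<times> {1..})"
    by (simp add: X'_def[abs_def] case_prod_beta)
  have "integrable M (\<lambda>\<omega>. (\<Sum>k=1..l. X k \<omega>)\<^sup>2) \<and> integrable M (\<lambda>\<omega>. \<Sum>k=1..l. X k \<omega>) \<and>
      expectation (\<lambda>\<omega>. (\<Sum>k=1..l. X k \<omega>)\<^sup>2) = real l * expectation (\<lambda>\<omega>. (X 1 \<omega>)\<^sup>2)"
  proof (induction l)
    case (Suc l)
    let ?W = "\<lambda>\<omega>. \<Sum>k=1..l. X k \<omega>"
    have ind: "indep_var borel (X (Suc l)) borel ?W"
    proof -
      have "indep_var borel (X' (i, Suc l)) borel (\<lambda>\<omega>. \<Sum>q\<in>Pair i ` {1..l}. X' q \<omega>)"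
      proof (rule indep_vars_sum)
        show "indep_vars (\<lambda>_. borel) X' (insert (i, Suc l) (Pair i ` {1..l}))"
          using indepX by (rule indep_vars_subset) auto
      qed auto
      then show ?thesis
        by (simp add: sum.reindex inj_on_def X'_def[abs_def] X_def[abs_def])
    qed
    have intW: "integrable M ?W" using Suc by blast
    have prod: "expectation (\<lambda>\<omega>. X (Suc l) \<omega> * ?W \<omega>) = 0"
      using indep_var_lebesgue_integral[OF ind X_int(1) intW] X_int(2)[of "Suc l"] by simp
    have prod_int: "integrable M (\<lambda>\<omega>. X (Suc l) \<omega> * ?W \<omega>)"
      by (rule indep_var_integrable[OF ind X_int(1) intW]) simp
    have eq: "(\<Sum>k=1..Suc l. X k \<omega>)\<^sup>2 = (?W \<omega>)\<^sup>2 + 2 * (X (Suc l) \<omega> * ?W \<omega>) + (X (Suc l) \<omega>)\<^sup>2" for \<omega>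
      by (simp add: power2_eq_square algebra_simps)
    have "expectation (\<lambda>\<omega>. (?W \<omega>)\<^sup>2 + 2 * (X (Suc l) \<omega> * ?W \<omega>) + (X (Suc l) \<omega>)\<^sup>2)
        = expectation (\<lambda>\<omega>. (?W \<omega>)\<^sup>2) + 2 * 0 + expectation (\<lambda>\<omega>. (X (Suc l) \<omega>)\<^sup>2)"
      using Suc X_int2[of "Suc l"] prod_int prod by simp
    also have "\<dots> = real (Suc l) * expectation (\<lambda>\<omega>. (X 1 \<omega>)\<^sup>2)"
      using Suc X_var[of "Suc l"] by (simp add: algebra_simps)
    finally show ?case
      unfolding eq using Suc X_int2[of "Suc l"] prod_int X_int(1)[of "Suc l"] by simp
  qed (simp add: prob_space)
  then show ?thesis by (simp add: X_def)
qed

lemma interarrival_tail: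
  fixes l :: nat
  assumes "prob_space M" and U: "interarrival_times M U" and \<beta>: "0 < \<beta>"
  shows "measure M {\<omega>\<in>space M. \<beta> \<le> \<bar>(\<Sum>k=1..l. U i k \<omega>) - real l\<bar>}
    \<le> real l * integral\<^sup>L M (\<lambda>\<omega>. (U i 1 \<omega> - 1)\<^sup>2) / \<beta>\<^sup>2"
proof -
  interpret prob_space M by fact
  have rv[measurable]: "U i k \<in> borel_measurable M" if "k \<in> {1..l}" for k
    using U that unfolding interarrival_times_def by (meson atLeastAtMost_iff borel_measurable_integrable)
  have eq: "(\<Sum>k=1..l. U i k \<omega>) - real l = (\<Sum>k=1..l. U i k \<omega> - 1)" for \<omega>
    by (simp add: sum_subtractf)
  have "measure M {\<omega>\<in>space M. \<beta> \<le> \<bar>\<Sum>k=1..l. U i k \<omega> - 1\<bar>}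
     \<le> integral\<^sup>L M (\<lambda>\<omega>. (\<Sum>k=1..l. U i k \<omega> - 1)\<^sup>2) / \<beta>\<^sup>2"
    using interarrival_second_moment[OF assms(1) U] \<beta>
    by (intro second_moment_method borel_measurable_sum borel_measurable_diff rv) auto
  then show ?thesis
    using interarrival_second_moment[OF assms(1) U, where l = l and i = i] unfolding eq by simp
qed

text \<open>
  On such outcomes the set whose supremum defines \<open>arrivals\<close> is finite, and \<open>arrivals\<close> is its maximum.
\<close>

definition regular_interarrivals :: "(nat \<Rightarrow> 'w \<Rightarrow> real) \<Rightarrow> 'w \<Rightarrow> bool" where
  "regular_interarrivals u \<omega> \<longleftrightarrow> (\<forall>k\<ge>1. 0 < u k \<omega>) \<and> (\<forall>B. \<exists>l. B < (\<Sum>k=1..l. u k \<omega>))"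

lemma interarrival_AE_regular:
  assumes "prob_space M" and U: "interarrival_times M U"
  shows "AE \<omega> in M. regular_interarrivals (U i) \<omega>"
proof -
  interpret prob_space M by fact
  have rv: "U i k \<in> borel_measurable M" if "k \<ge> 1" for k
    using U that unfolding interarrival_times_def by (meson atLeastAtMost_iff borel_measurable_integrable)
  have "AE \<omega> in M. 0 < U i k \<omega>" if "k \<ge> 1" for k
    using U that unfolding interarrival_times_def by blast
  then have "\<And>k. AE \<omega> in M. k \<ge> 1 \<longrightarrow> 0 < U i k \<omega>" by (rule AE_impI) 
  then have pos: "AE \<omega> in M. \<forall>k\<ge>1. 0 < U i k \<omega>" by (simp add: AE_all_countable)
  let ?v = "integral\<^sup>L M (\<lambda>\<omega>. (U i 1 \<omega> - 1)\<^sup>2)"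
  define D where "D B l = {\<omega>\<in>space M. (\<Sum>k=1..l. U i k \<omega>) \<le> real B}" for B l :: nat
  have D_meas: "D B l \<in> sets M" for B l
  proof -
    have [measurable]: "(\<lambda>\<omega>. \<Sum>k=1..l. U i k \<omega>) \<in> borel_measurable M"
      by (intro borel_measurable_sum rv) auto
    show ?thesis unfolding D_def by measurable
  qed
  have D_le: "measure M (D B l) \<le> 4 * ?v / real l" if "2 * B < l" for B l
  proof -
    have "measure M (D B l) \<le> measure M {\<omega>\<in>space M. real l / 2 \<le> \<bar>(\<Sum>k=1..l. U i k \<omega>) - real l\<bar>}"
    proof (rule finite_measure_mono)
      have "(\<lambda>\<omega>. \<Sum>k=1..l. U i k \<omega>) \<in> borel_measurable M"
        by (intro borel_measurable_sum rv) auto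
      then show "{\<omega>\<in>space M. real l / 2 \<le> \<bar>(\<Sum>k=1..l. U i k \<omega>) - real l\<bar>} \<in> sets M" by measurable
      have "2 * real B < real l" using that by (metis of_nat_less_iff of_nat_mult of_nat_numeral)
      then show "D B l \<subseteq> {\<omega>\<in>space M. real l / 2 \<le> \<bar>(\<Sum>k=1..l. U i k \<omega>) - real l\<bar>}"
        by (auto simp: D_def)
    qed
    also have "\<dots> \<le> real l * ?v / (real l / 2)\<^sup>2"
      using that by (intro interarrival_tail assms) auto
    also have "\<dots> = 4 * ?v / real l" using that by (simp add: power2_eq_square)
    finally show ?thesis .
  qed
  have "AE \<omega> in M. \<forall>B. \<omega> \<notin> (\<Inter>l. D B l)"
    unfolding AE_all_countable
  proof
    fix B
    have meas: "(\<Inter>l. D B l) \<in> sets M" using D_meas by auto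
    have "measure M (\<Inter>l. D B l) \<le> 4 * ?v / real l" if "2 * B < l" for l
      using that D_meas by (intro order_trans[OF finite_measure_mono D_le]) auto
    moreover have "(\<lambda>l. 4 * ?v / real l) \<longlonglongrightarrow> 0" by (rule lim_const_over_n)
    ultimately have "measure M (\<Inter>l. D B l) \<le> 0"
      by (intro LIMSEQ_le_const[of "\<lambda>l. 4 * ?v / real l"]) (auto intro!: exI[of _ "Suc (2 * B)"])
    then have "measure M (\<Inter>l. D B l) = 0" using measure_nonneg[of M "\<Inter>l. D B l"] by linarith
    then have "(\<Inter>l. D B l) \<in> null_sets M"
      using meas by (simp add: null_sets_def emeasure_eq_measure)
    then show "AE \<omega> in M. \<omega> \<notin> (\<Inter>l. D B l)" by (rule AE_not_in)
  qed
  with pos AE_space show ?thesis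
  proof eventually_elim
    case (elim \<omega>)
    have "\<exists>l. C < (\<Sum>k=1..l. U i k \<omega>)" for C :: real
    proof -
      obtain B :: nat where "C \<le> real B" using real_arch_simple by blast
      moreover obtain l where "\<omega> \<notin> D B l" using elim by blast
      then have "real B < (\<Sum>k=1..l. U i k \<omega>)" using elim by (simp add: D_def)
      ultimately show ?thesis by (meson le_less_trans)
    qed
    then show ?case using elim by (simp add: regular_interarrivals_def)
  qed
qed

lemma arrivals_ge_iff:
  assumes u: "regular_interarrivals u \<omega>" and r: "0 < r" and t: "0 \<le> t"
  shows "l \<le> arrivals u r t \<omega> \<longleftrightarrow> (\<Sum>k=1..l. u k \<omega>) \<le> r * t"
proof -
  let ?V = "\<lambda>l. \<Sum>k=1..l. u k \<omega>"
  define L where "L = {l. ?V l \<le> r * t}"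
  have arr: "arrivals u r t \<omega> = Sup L"
    using r by (simp add: arrivals_def L_def sum_divide_distrib[symmetric] pos_divide_le_eq mult.commute)
  have mono: "?V l \<le> ?V l'" if "l \<le> l'" for l l'
    using u that by (intro sum_mono2) (auto simp: regular_interarrivals_def less_imp_le)
  obtain l0 where l0: "r * t < ?V l0" using u by (auto simp: regular_interarrivals_def)
  have "L \<subseteq> {..l0}"
  proof
    fix l assume "l \<in> L"
    then have "?V l < ?V l0" using l0 by (simp add: L_def)
    then show "l \<in> {..l0}" using mono[of l0 l] by force
  qed
  then have fin: "finite L" by (rule finite_subset) simp
  have "0 \<in> L" using r t by (simp add: L_def)
  then have arr: "arrivals u r t \<omega> = Max L" using arr by (auto simp: Sup_nat_def)
  show ?thesis
  proof
    assume "l \<le> arrivals u r t \<omega>"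
    moreover have "Max L \<in> L" using fin \<open>0 \<in> L\<close> by (intro Max_in) auto
    ultimately show "?V l \<le> r * t" using mono[of l "Max L"] arr by (auto simp: L_def)
  next
    assume "?V l \<le> r * t"
    then show "l \<le> arrivals u r t \<omega>" unfolding arr using fin by (intro Max_ge) (auto simp: L_def)
  qed
qed

lemma counting_path_arrivals:
  assumes u: "regular_interarrivals u \<omega>" and r: "0 < r"
  shows "counting_path (\<lambda>t. arrivals u r t \<omega>)"
proof -
  have mono: "arrivals u r s \<omega> \<le> arrivals u r t \<omega>" if "0 \<le> s" "s \<le> t" for s t
  proof -
    have "(\<Sum>k=1..arrivals u r s \<omega>. u k \<omega>) \<le> r * s"
      using arrivals_ge_iff[OF u r that(1)] by blast
    also have "\<dots> \<le> r * t" using r that by simp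
    finally show ?thesis using arrivals_ge_iff[OF u r, of t] that by simp
  qed
  moreover have "\<forall>\<^sub>F s in at_right t. arrivals u r s \<omega> = arrivals u r t \<omega>" if t: "0 \<le> t" for t
  proof -
    let ?n = "Suc (arrivals u r t \<omega>)"
    have "r * t < (\<Sum>k=1..?n. u k \<omega>)"
      using arrivals_ge_iff[OF u r t, of ?n] by (simp add: not_le)
    then have lt: "t < (\<Sum>k=1..?n. u k \<omega>) / r" using r by (simp add: pos_less_divide_eq mult.commute)
    have "arrivals u r s \<omega> = arrivals u r t \<omega>" if "t < s" "s < (\<Sum>k=1..?n. u k \<omega>) / r" for s
    proof -
      have "r * s < (\<Sum>k=1..?n. u k \<omega>)" using that r by (simp add: pos_less_divide_eq mult.commute)
      then have "\<not> ?n \<le> arrivals u r s \<omega>" using arrivals_ge_iff[OF u r, of s ?n] t that by simp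
      then show ?thesis using mono[of t s] t that by simp
    qed
    then show ?thesis using lt unfolding eventually_at_right_field by blast
  qed
  ultimately show ?thesis by (simp add: counting_path_def mono_on_def)
qed

text \<open>
  Measurability holds on the whole space: the supremum of the empty set is \<open>0\<close>, and on an infinite set \<open>Max\<close> is a fixed value.
\<close>

lemma measurable_arrivals:
  assumes u: "\<And>k. k \<ge> 1 \<Longrightarrow> u k \<in> borel_measurable M"
  shows "arrivals u r t \<in> M \<rightarrow>\<^sub>M count_space UNIV"
proof -
  have [measurable]: "(\<lambda>\<omega>. \<Sum>k=1..l. u k \<omega> / r) \<in> borel_measurable M" for l
    by (intro borel_measurable_sum borel_measurable_divide u) auto
  have "arrivals u r t = (\<lambda>\<omega>. if \<exists>l. (\<Sum>k=1..l. u k \<omega> / r) \<le> t then Max {l. (\<Sum>k=1..l. u k \<omega> / r) \<le> t} else 0)"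
    by (auto simp: fun_eq_iff arrivals_def Sup_nat_def)
  also have "\<dots> \<in> M \<rightarrow>\<^sub>M count_space UNIV" by measurable
  finally show ?thesis .
qed

text \<open>
  Too many arrivals by time \<open>t\<close> mean that the partial sum with index \<open>l\<^sub>1 = \<lceil>r t + \<beta>\<rceil>\<close> is too small, and too few mean
  that the one with index \<open>l\<^sub>2 = \<lceil>r t - \<beta>\<rceil>\<close> is too large. In the second case rounding costs up to \<open>1 \<le> \<beta> / 2\<close>.
\<close>

lemma arrivals_tail:
  assumes "prob_space M" and U: "interarrival_times M U" and r: "0 < r" and t: "0 \<le> t" and \<beta>: "2 \<le> \<beta>"
  shows "measure M {\<omega>\<in>space M. \<beta> < \<bar>real (arrivals (U i) r t \<omega>) - r * t\<bar>}
    \<le> 5 * (r * t + \<beta> + 1) * integral\<^sup>L M (\<lambda>\<omega>. (U i 1 \<omega> - 1)\<^sup>2) / \<beta>\<^sup>2"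
proof -
  interpret prob_space M by fact
  let ?v = "integral\<^sup>L M (\<lambda>\<omega>. (U i 1 \<omega> - 1)\<^sup>2)"
  define y where "y = r * t"
  have y: "0 \<le> y" using r t by (simp add: y_def)
  define l1 where "l1 = nat \<lceil>y + \<beta>\<rceil>"
  define l2 where "l2 = nat \<lceil>y - \<beta>\<rceil>"
  let ?V = "\<lambda>l \<omega>. \<Sum>k=1..l. U i k \<omega>"
  have rv: "U i k \<in> borel_measurable M" if "k \<ge> 1" for k
    using U that unfolding interarrival_times_def by (meson atLeastAtMost_iff borel_measurable_integrable)
  have V[measurable]: "?V l \<in> borel_measurable M" for l
    by (intro borel_measurable_sum rv) auto
  define D1 where "D1 = {\<omega>\<in>space M. \<beta> \<le> \<bar>?V l1 \<omega> - real l1\<bar>}"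
  define D2 where "D2 = {\<omega>\<in>space M. \<beta> / 2 \<le> \<bar>?V l2 \<omega> - real l2\<bar>}"
  have D: "D1 \<in> sets M" "D2 \<in> sets M" unfolding D1_def D2_def by measurable
  have v: "0 \<le> ?v" by simp
  have l1: "y + \<beta> \<le> real l1" "real l1 \<le> y + \<beta> + 1" using y \<beta> unfolding l1_def by linarith+
  have l2: "y - \<beta> \<le> real l2" "real l2 \<le> y + 1" "l2 = 0 \<or> real l2 < y - \<beta> + 1" using y \<beta> unfolding l2_def by linarith+
  have AE_sub: "AE \<omega> in M. \<omega> \<in> {\<omega>\<in>space M. \<beta> < \<bar>real (arrivals (U i) r t \<omega>) - r * t\<bar>} \<longrightarrow> \<omega> \<in> D1 \<union> D2"
    using interarrival_AE_regular[OF assms(1) U, of i]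
  proof eventually_elim
    case (elim \<omega>)
    note iff = arrivals_ge_iff[OF elim r t, folded y_def]
    let ?A = "arrivals (U i) r t \<omega>"
    show ?case
    proof (intro impI)
      assume "\<omega> \<in> {\<omega>\<in>space M. \<beta> < \<bar>real (arrivals (U i) r t \<omega>) - r * t\<bar>}"
      then have \<omega>: "\<omega> \<in> space M" and dev: "\<beta> < \<bar>real ?A - y\<bar>" by (auto simp: y_def)
      show "\<omega> \<in> D1 \<union> D2"
      proof (cases "real ?A > y + \<beta>")
        case True
        then have "l1 \<le> ?A" unfolding l1_def by linarith
        then have "?V l1 \<omega> \<le> y" using iff by blast
        then show ?thesis using \<omega> l1 by (auto simp: D1_def)
      next
        case False
        then have lt: "real ?A < y - \<beta>" using dev by linarith
        then have "\<not> l2 \<le> ?A" using l2(1) by linarith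
        then have "y < ?V l2 \<omega>" "l2 \<noteq> 0" using iff[of l2] by auto
        then have "\<beta> / 2 \<le> \<bar>?V l2 \<omega> - real l2\<bar>" using l2 \<beta> by linarith
        then show ?thesis using \<omega> unfolding D2_def by blast
      qed
    qed
  qed
  have "measure M {\<omega>\<in>space M. \<beta> < \<bar>real (arrivals (U i) r t \<omega>) - r * t\<bar>} \<le> measure M (D1 \<union> D2)"
    using D AE_sub by (intro finite_measure_mono_AE) auto
  also have "\<dots> \<le> measure M D1 + measure M D2" using D by (intro measure_Un_le)
  also have "measure M D1 \<le> real l1 * ?v / \<beta>\<^sup>2"
    unfolding D1_def using \<beta> by (intro interarrival_tail assms) auto
  also have "measure M D2 \<le> real l2 * ?v / (\<beta> / 2)\<^sup>2"
    unfolding D2_def using \<beta> by (intro interarrival_tail assms) auto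
  also have "real l1 * ?v / \<beta>\<^sup>2 + real l2 * ?v / (\<beta> / 2)\<^sup>2 = (real l1 + 4 * real l2) * ?v / \<beta>\<^sup>2"
    by (simp add: power_divide add_divide_distrib distrib_right)
  also have "\<dots> \<le> (5 * (y + \<beta> + 1)) * ?v / \<beta>\<^sup>2"
    using l1 l2 \<beta> v by (intro divide_right_mono mult_right_mono) auto
  finally show ?thesis by (simp add: y_def)
qed

section \<open>Scales and negligible noise\<close>

lemma powr_eventually_le:
  assumes "\<alpha> < \<beta>"
  shows "\<forall>\<^sub>F n in sequentially. K * real n powr \<alpha> \<le> real n powr \<beta>"
proof -
  have "(\<lambda>n. real n powr (\<alpha> - \<beta>)) \<longlonglongrightarrow> 0"
    using assms by (intro tendsto_neg_powr filterlim_real_sequentially) auto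
  then have "(\<lambda>n. K * real n powr (\<alpha> - \<beta>)) \<longlonglongrightarrow> K * 0" by (intro tendsto_intros)
  then have "\<forall>\<^sub>F n in sequentially. K * real n powr (\<alpha> - \<beta>) < 1"
    by (intro order_tendstoD) auto
  then show ?thesis
    using eventually_gt_at_top[of 0]
  proof eventually_elim
    case (elim n)
    have "K * real n powr \<alpha> = K * real n powr (\<alpha> - \<beta>) * real n powr \<beta>"
      by (simp flip: powr_add)
    also have "\<dots> \<le> 1 * real n powr \<beta>" using elim by (intro mult_right_mono) auto
    finally show ?case by simp
  qed
qed

lemma sqrt_scale_eventually_le:
  assumes "(\<lambda>n. (x n - real n * y) / sqrt (real n)) \<longlonglongrightarrow> z"
  shows "\<forall>\<^sub>F n in sequentially. \<bar>x n - real n * y\<bar> \<le> real n powr (3 / 4)"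
proof -
  have "\<forall>\<^sub>F n in sequentially. \<bar>(x n - real n * y) / sqrt (real n)\<bar> < \<bar>z\<bar> + 1"
    using tendsto_rabs[OF assms] by (intro order_tendstoD) auto
  moreover have "\<forall>\<^sub>F n in sequentially. (\<bar>z\<bar> + 1) * real n powr (1 / 2) \<le> real n powr (3 / 4)"
    by (rule powr_eventually_le) simp
  ultimately show ?thesis
    using eventually_gt_at_top[of 0]
  proof eventually_elim
    case (elim n)
    then have "\<bar>x n - real n * y\<bar> \<le> (\<bar>z\<bar> + 1) * sqrt (real n)"
      by (simp add: abs_divide pos_divide_less_eq)
    then show ?case using elim by (simp add: powr_half_sqrt)
  qed
qed

lemma fraction_scale_eventually_le:
  assumes "(\<lambda>n. sqrt (real n) * (x n / real n - y)) \<longlonglongrightarrow> z"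
  shows "\<forall>\<^sub>F n in sequentially. \<bar>x n - real n * y\<bar> \<le> real n powr (3 / 4)"
proof (rule sqrt_scale_eventually_le)
  have scale: "s * (u / (s * s) - y) = (u - s * s * y) / s" if "s > 0" for s u :: real
    using that by (simp add: field_simps)
  have eq: "sqrt (real n) * (x n / real n - y) = (x n - real n * y) / sqrt (real n)" if "n > 0" for n
    using scale[of "sqrt (real n)" "x n"] that by simp
  show "(\<lambda>n. (x n - real n * y) / sqrt (real n)) \<longlonglongrightarrow> z"
    using assms by (rule Lim_transform_eventually)
      (use eventually_gt_at_top[of 0] in \<open>eventually_elim, use eq in simp\<close>)
qed

lemma rate_scale_eventually_le:
  assumes "(\<lambda>n. sqrt (real n) * (x n - y)) \<longlonglongrightarrow> z"
  shows "\<forall>\<^sub>F n in sequentially. \<bar>x n - y\<bar> * real n \<le> real n powr (3 / 4)"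
proof -
  have "(\<lambda>n. sqrt (real n) * (real n * x n / real n - y)) \<longlonglongrightarrow> z"
    using assms by (rule Lim_transform_eventually)
      (use eventually_gt_at_top[of 0] in \<open>eventually_elim, simp\<close>)
  from fraction_scale_eventually_le[OF this] show ?thesis
  proof eventually_elim
    case (elim n)
    have "\<bar>x n - y\<bar> * real n = \<bar>real n * (x n - y)\<bar>" by (simp add: abs_mult)
    also have "\<dots> = \<bar>real n * x n - real n * y\<bar>" by (simp only: right_diff_distrib)
    finally show ?case using elim by simp
  qed
qed

definition negligible_deviation ::
  "'w measure \<Rightarrow> (nat \<Rightarrow> real \<Rightarrow> 'w \<Rightarrow> nat) \<Rightarrow> (nat \<Rightarrow> real) \<Rightarrow> (nat \<Rightarrow> real) \<Rightarrow> (nat \<Rightarrow> 'w set) \<Rightarrow> bool" where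
  "negligible_deviation M W r L B \<longleftrightarrow> (\<forall>n. B n \<in> sets M) \<and> (\<lambda>n. measure M (B n)) \<longlonglongrightarrow> 0 \<and>
    (\<forall>\<^sub>F n in sequentially. \<forall>\<omega>\<in>space M - B n. \<forall>t. 0 \<le> t \<longrightarrow> t \<le> L n \<longrightarrow>
       \<bar>real (W n t \<omega>) - r n * t\<bar> \<le> real n powr (3 / 4))"

text \<open>
  With about \<open>n\<^bsup>1/4\<^esup>\<close> grid points the mean moves by \<open>O(n\<^bsup>3/4\<^esup>)\<close> between neighbours, while each point fails with
  probability \<open>O(n\<^bsup>-1/2\<^esup>)\<close>; the union bound gives \<open>O(n\<^bsup>-1/4\<^esup>)\<close>. The exponent \<open>3 / 4\<close> leaves enough room for this.
\<close>

lemma noise_negligible: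
  fixes W :: "nat \<Rightarrow> real \<Rightarrow> 'w \<Rightarrow> nat"
  assumes "prob_space M" and meas: "\<And>n t. 0 \<le> t \<Longrightarrow> W n t \<in> M \<rightarrow>\<^sub>M count_space UNIV"
    and mono: "\<And>n. AE \<omega> in M. mono_on {0..} (\<lambda>t. W n t \<omega>)"
    and r: "\<And>n. 0 \<le> r n" and K: "0 \<le> K"
    and L: "\<forall>\<^sub>F n in sequentially. 0 < L n \<and> r n * L n \<le> K * real n"
    and tail: "\<forall>\<^sub>F n in sequentially. \<forall>t. 0 \<le> t \<longrightarrow> t \<le> L n \<longrightarrow>
      measure M {\<omega>\<in>space M. real n powr (3 / 4) / 2 < \<bar>real (W n t \<omega>) - r n * t\<bar>} \<le> K * real n powr (- 1 / 2)"
  shows "\<exists>B. negligible_deviation M W r L B"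
proof -
  interpret prob_space M by fact
  \<comment> \<open>the number of grid points for which the mean moves by at most half the allowed deviation\<close>
  define G where "G n = Suc (nat \<lceil>2 * K * real n powr (1 / 4)\<rceil>)" for n :: nat
  define q where "q n = (real (G n) + 1) * (K * real n powr (- 1 / 2))" for n :: nat
  define good where "good B n \<longleftrightarrow> B \<in> sets M \<and> measure M B \<le> q n \<and>
    (\<forall>\<omega>\<in>space M - B. \<forall>t. 0 \<le> t \<longrightarrow> t \<le> L n \<longrightarrow> \<bar>real (W n t \<omega>) - r n * t\<bar> \<le> real n powr (3 / 4))" for B n
  have G_bounds: "2 * K * real n powr (1 / 4) \<le> real (G n)" "real (G n) \<le> 2 * K * real n powr (1 / 4) + 2" for n
  proof -
    have "0 \<le> 2 * K * real n powr (1 / 4)" using K by simp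
    then show "2 * K * real n powr (1 / 4) \<le> real (G n)" "real (G n) \<le> 2 * K * real n powr (1 / 4) + 2"
      unfolding G_def by linarith+
  qed
  have ex: "\<forall>\<^sub>F n in sequentially. \<exists>B. good B n"
    using L tail eventually_gt_at_top[of 0]
  proof eventually_elim
    case (elim n)
    have "r n * L n \<le> K * (real n powr (1 / 4) * real n powr (3 / 4))"
      using elim by (simp flip: powr_add)
    also have "\<dots> = (2 * K * real n powr (1 / 4)) * (real n powr (3 / 4) / 2)" by simp
    also have "\<dots> \<le> real (G n) * (real n powr (3 / 4) / 2)"
      using G_bounds by (intro mult_right_mono) auto
    finally have fine: "r n * L n \<le> real (G n) * (real n powr (3 / 4) / 2)" .
    have "\<exists>B\<in>sets M. measure M B \<le> (real (G n) + 1) * (K * real n powr (- 1 / 2)) \<and>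
      (\<forall>\<omega>\<in>space M - B. \<forall>t. 0 \<le> t \<longrightarrow> t \<le> L n \<longrightarrow> \<bar>real (W n t \<omega>) - r n * t\<bar> \<le> real n powr (3 / 4))"
      by (rule grid_deviation[OF assms(1) meas mono r _ _ _ fine]) (use elim in \<open>auto simp: G_def\<close>)
    then show ?case unfolding good_def q_def by blast
  qed
  define B where "B n = (if \<exists>B. good B n then SOME B. good B n else {})" for n
  have B: "good (B n) n" if "\<exists>B. good B n" for n
    using someI_ex[OF that] that by (simp add: B_def)
  have "\<forall>n. B n \<in> sets M"
    using B by (metis B_def good_def sets.empty_sets)
  moreover have "(\<lambda>n. measure M (B n)) \<longlonglongrightarrow> 0"
  proof (rule tendsto_sandwich[of "\<lambda>_. 0" _ _ "\<lambda>n. 2 * K\<^sup>2 * real n powr (- 1 / 4) + 3 * K * real n powr (- 1 / 2)"])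
    show "(\<lambda>n. 2 * K\<^sup>2 * real n powr (- 1 / 4) + 3 * K * real n powr (- 1 / 2)) \<longlonglongrightarrow> 0"
    proof -
      have "(\<lambda>n. 2 * K\<^sup>2 * real n powr (- 1 / 4) + 3 * K * real n powr (- 1 / 2)) \<longlonglongrightarrow> 2 * K\<^sup>2 * 0 + 3 * K * 0"
        by (intro tendsto_intros tendsto_neg_powr filterlim_real_sequentially) auto
      then show ?thesis by simp
    qed
    show "\<forall>\<^sub>F n in sequentially. measure M (B n) \<le> 2 * K\<^sup>2 * real n powr (- 1 / 4) + 3 * K * real n powr (- 1 / 2)"
      using ex
    proof eventually_elim
      case (elim n)
      have "measure M (B n) \<le> (real (G n) + 1) * (K * real n powr (- 1 / 2))"
        using B[OF elim] by (simp add: good_def q_def)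
      also have "\<dots> \<le> (2 * K * real n powr (1 / 4) + 3) * (K * real n powr (- 1 / 2))"
        using G_bounds[of n] K by (intro mult_right_mono) auto
      also have "\<dots> = 2 * K\<^sup>2 * (real n powr (1 / 4) * real n powr (- 1 / 2)) + 3 * K * real n powr (- 1 / 2)"
        by (simp add: algebra_simps power2_eq_square)
      also have "real n powr (1 / 4) * real n powr (- 1 / 2) = real n powr (- 1 / 4)"
        by (simp flip: powr_add)
      finally show ?case .
    qed
  qed auto
  moreover have "\<forall>\<^sub>F n in sequentially. \<forall>\<omega>\<in>space M - B n. \<forall>t. 0 \<le> t \<longrightarrow> t \<le> L n \<longrightarrow>
       \<bar>real (W n t \<omega>) - r n * t\<bar> \<le> real n powr (3 / 4)"
    using ex by eventually_elim (use B in \<open>auto simp: good_def\<close>)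
  ultimately show ?thesis unfolding negligible_deviation_def by blast
qed

lemma service_noise_negligible:
  fixes S :: "nat \<Rightarrow> real \<Rightarrow> 'w \<Rightarrow> nat"
  assumes "prob_space M" and S: "\<And>n. poisson_process M (r n) (S n)" and r: "\<And>n. 0 \<le> r n"
    and lim: "r \<longlonglongrightarrow> r'" and L: "0 < L"
  shows "\<exists>B. negligible_deviation M S r (\<lambda>n. L * real n) B"
proof (rule noise_negligible[where K = "4 * (r' + 1) * L"])
  have r': "0 \<le> r'" using lim r by (intro LIMSEQ_le_const[of r]) auto
  show "0 \<le> 4 * (r' + 1) * L" using r' L by simp
  have le: "\<forall>\<^sub>F n in sequentially. r n < r' + 1" using lim by (intro order_tendstoD) auto
  have rL: "r n * t \<le> (r' + 1) * L * real n" if "r n < r' + 1" "0 \<le> t" "t \<le> L * real n" for n t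
  proof -
    have "r n * t \<le> (r' + 1) * (L * real n)" using that r[of n] r' by (intro mult_mono) auto
    then show ?thesis by simp
  qed
  show "\<forall>\<^sub>F n in sequentially. 0 < L * real n \<and> r n * (L * real n) \<le> 4 * (r' + 1) * L * real n"
    using le eventually_gt_at_top[of 0]
  proof eventually_elim
    case (elim n)
    have "r n * (L * real n) \<le> (r' + 1) * L * real n" using elim L by (intro rL) auto
    moreover have "0 \<le> (r' + 1) * L * real n" using r' L by simp
    moreover have "4 * (r' + 1) * L * real n = 4 * ((r' + 1) * L * real n)" by simp
    moreover have "0 < L * real n" using elim L by simp
    ultimately show ?case by linarith
  qed
  show "\<forall>\<^sub>F n in sequentially. \<forall>t. 0 \<le> t \<longrightarrow> t \<le> L * real n \<longrightarrow>
      measure M {\<omega>\<in>space M. real n powr (3 / 4) / 2 < \<bar>real (S n t \<omega>) - r n * t\<bar>}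
        \<le> 4 * (r' + 1) * L * real n powr (- 1 / 2)"
    using le eventually_gt_at_top[of 0]
  proof eventually_elim
    case (elim n)
    show ?case
    proof (intro allI impI)
      fix t assume t: "0 \<le> t" "t \<le> L * real n"
      have "measure M {\<omega>\<in>space M. real n powr (3 / 4) / 2 < \<bar>real (S n t \<omega>) - r n * t\<bar>}
          \<le> r n * t / (real n powr (3 / 4) / 2)\<^sup>2"
        using elim t r by (intro poisson_process_tail assms) auto
      also have "\<dots> \<le> (r' + 1) * L * real n / (real n powr (3 / 4) / 2)\<^sup>2"
        using rL[of n t] elim t by (intro divide_right_mono) auto
      also have "\<dots> = 4 * (r' + 1) * L * (real n powr 1 / real n powr (3 / 2))"
        by (simp add: power_divide power2_eq_square flip: powr_add)
      also have "real n powr 1 / real n powr (3 / 2) = real n powr (- 1 / 2)"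
        by (simp only: flip: powr_diff) simp
      finally show "measure M {\<omega>\<in>space M. real n powr (3 / 4) / 2 < \<bar>real (S n t \<omega>) - r n * t\<bar>}
        \<le> 4 * (r' + 1) * L * real n powr (- 1 / 2)" .
    qed
  qed
  show "S n t \<in> M \<rightarrow>\<^sub>M count_space UNIV" if "0 \<le> t" for n t
    using S[of n] that by (simp add: poisson_process_def)
  show "AE \<omega> in M. mono_on {0..} (\<lambda>t. S n t \<omega>)" for n
    using S[of n] by (auto simp: poisson_process_def)
qed (use assms in auto)

lemma arrival_noise_negligible:
  assumes "prob_space M" and U: "interarrival_times M U" and r: "\<And>n. 0 < r n"
    and lim: "(\<lambda>n. r n / real n) \<longlonglongrightarrow> r'" and T: "0 < T"
  shows "\<exists>B. negligible_deviation M (\<lambda>n. arrivals (U i) (r n)) r (\<lambda>_. T) B"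
proof -
  let ?v = "integral\<^sup>L M (\<lambda>\<omega>. (U i 1 \<omega> - 1)\<^sup>2)"
  define C where "C = (r' + 1) * T"
  define K where "K = C + 20 * (C + 2) * ?v"
  have v: "0 \<le> ?v" by simp
  have r': "0 \<le> r'" using lim r by (intro LIMSEQ_le_const[OF lim] exI[of _ 0]) (simp add: less_imp_le)
  have C: "0 \<le> C" using r' T by (simp add: C_def)
  have "\<forall>\<^sub>F n in sequentially. r n / real n < r' + 1" using lim by (intro order_tendstoD) auto
  then have le: "\<forall>\<^sub>F n in sequentially. r n \<le> (r' + 1) * real n"
    using eventually_gt_at_top[of 0] by eventually_elim (simp add: pos_divide_less_eq)
  have rT: "r n * t \<le> C * real n" if "r n \<le> (r' + 1) * real n" "0 \<le> t" "t \<le> T" for n t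
  proof -
    have "r n * t \<le> (r' + 1) * real n * T" using that r[of n] r' by (intro mult_mono) auto
    then show ?thesis by (simp add: C_def mult_ac)
  qed
  have rv: "U i k \<in> borel_measurable M" if "k \<ge> 1" for k
    using U that unfolding interarrival_times_def by (meson borel_measurable_integrable)
  show ?thesis
  proof (rule noise_negligible[where K = K])
    show "0 \<le> K" using C v by (simp add: K_def)
    show "\<forall>\<^sub>F n in sequentially. 0 < T \<and> r n * T \<le> K * real n"
      using le
    proof eventually_elim
      case (elim n)
      have "r n * T \<le> C * real n" using elim T by (intro rT) auto
      also have "\<dots> \<le> K * real n" using C v by (intro mult_right_mono) (auto simp: K_def)
      finally show ?case using T by simp
    qed
    have "\<forall>\<^sub>F n in sequentially. 4 * real n powr 0 \<le> real n powr (3 / 4)"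
      by (rule powr_eventually_le) simp
    then show "\<forall>\<^sub>F n in sequentially. \<forall>t. 0 \<le> t \<longrightarrow> t \<le> T \<longrightarrow>
      measure M {\<omega>\<in>space M. real n powr (3 / 4) / 2 < \<bar>real (arrivals (U i) (r n) t \<omega>) - r n * t\<bar>}
        \<le> K * real n powr (- 1 / 2)"
      using le eventually_gt_at_top[of 0]
    proof eventually_elim
      case (elim n)
      show ?case
      proof (intro allI impI)
        fix t assume t: "0 \<le> t" "t \<le> T"
        let ?\<beta> = "real n powr (3 / 4) / 2"
        have \<beta>: "2 \<le> ?\<beta>" using elim by simp
        have "real n powr (3 / 4) \<le> real n powr 1" using elim by (intro powr_mono) auto
        then have small: "?\<beta> + 1 \<le> 2 * real n" using elim by simp
        have "measure M {\<omega>\<in>space M. ?\<beta> < \<bar>real (arrivals (U i) (r n) t \<omega>) - r n * t\<bar>}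
            \<le> 5 * (r n * t + ?\<beta> + 1) * ?v / ?\<beta>\<^sup>2"
          by (rule arrivals_tail[OF assms(1) U r t(1) \<beta>])
        also have "\<dots> \<le> 5 * ((C + 2) * real n) * ?v / ?\<beta>\<^sup>2"
        proof -
          have "r n * t + ?\<beta> + 1 \<le> (C + 2) * real n"
            using rT[of n t] elim t small by (simp add: distrib_right)
          then show ?thesis using v by (intro divide_right_mono mult_right_mono mult_left_mono) auto
        qed
        also have "\<dots> = 20 * (C + 2) * ?v * (real n powr 1 / real n powr (3 / 2))"
          by (simp add: power_divide power2_eq_square flip: powr_add)
        also have "real n powr 1 / real n powr (3 / 2) = real n powr (- 1 / 2)"
          by (simp only: flip: powr_diff) simp
        also have "20 * (C + 2) * ?v * real n powr (- 1 / 2) \<le> K * real n powr (- 1 / 2)"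
          using C by (intro mult_right_mono) (auto simp: K_def)
        finally show "measure M {\<omega>\<in>space M. ?\<beta> < \<bar>real (arrivals (U i) (r n) t \<omega>) - r n * t\<bar>}
            \<le> K * real n powr (- 1 / 2)" .
      qed
    qed
    show "arrivals (U i) (r n) t \<in> M \<rightarrow>\<^sub>M count_space UNIV" for n t
      by (rule measurable_arrivals) (rule rv)
    show "AE \<omega> in M. mono_on {0..} (\<lambda>t. arrivals (U i) (r n) t \<omega>)" for n
      using interarrival_AE_regular[OF assms(1) U, of i]
    proof eventually_elim
      case (elim \<omega>)
      from counting_path_arrivals[OF elim r[of n]] show ?case by (simp add: counting_path_def)
    qed
    show "0 \<le> r n" for n using r[of n] by simp
  qed fact
qed

section \<open>Increments of a steered system\<close>

lemma system_equations_real: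
  assumes "system_equations E N X0 A S X Y Z \<Psi>" "0 \<le> t"
  shows "real (X i t) = real (X0 i) + real (A i t)
    - (\<Sum>j\<in>UNIV. real (S i j (integral {0..t} (\<lambda>s. real (\<Psi> i j s)))))"
proof -
  have "int (X i t) = int (X0 i) + int (A i t)
    - (\<Sum>j\<in>UNIV. int (S i j (integral {0..t} (\<lambda>s. real (\<Psi> i j s)))))"
    using assms unfolding system_equations_def by blast
  then have "real_of_int (int (X i t)) = real_of_int (int (X0 i) + int (A i t)
    - (\<Sum>j\<in>UNIV. int (S i j (integral {0..t} (\<lambda>s. real (\<Psi> i j s))))))" by (rule arg_cong)
  then show ?thesis by simp
qed

lemma system_busy_time:
  fixes s t :: real
  assumes sys: "system_equations E N X0 A S X Y Z \<Psi>" and "0 \<le> t"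
  shows "0 \<le> integral {0..t} (\<lambda>s. real (\<Psi> i j s))"
    and "integral {0..t} (\<lambda>s. real (\<Psi> i j s)) \<le> real (N j) * t"
    and "0 \<le> s \<Longrightarrow> (\<lambda>s. real (\<Psi> i j s)) integrable_on {s..t}"
proof -
  have "cadlag (\<lambda>t. \<Psi> i j t)" using sys by (simp add: system_equations_def)
  then have "step_path (\<Psi> i j)" by (simp add: cadlag_nat_iff_step_path)
  then have "step_path (\<lambda>t. real (\<Psi> i j t))" by (rule step_path_comp)
  then have int: "(\<lambda>s. real (\<Psi> i j s)) integrable_on {s..t}" if "0 \<le> s" for s
    using that by (intro step_path_integrable)
  then show "0 \<le> s \<Longrightarrow> (\<lambda>s. real (\<Psi> i j s)) integrable_on {s..t}" .
  show "0 \<le> integral {0..t} (\<lambda>s. real (\<Psi> i j s))"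
    using int[of 0] by (intro integral_nonneg) auto
  have "\<Psi> i j s \<le> N j" if "0 \<le> s" for s
  proof -
    have "\<Psi> i j s \<le> (\<Sum>i\<in>UNIV. \<Psi> i j s)" by (rule member_le_sum) auto
    also have "\<dots> \<le> Z j s + (\<Sum>i\<in>UNIV. \<Psi> i j s)" by simp
    also have "\<dots> = N j" using sys that unfolding system_equations_def by blast
    finally show ?thesis .
  qed
  then have "integral {0..t} (\<lambda>s. real (\<Psi> i j s)) \<le> integral {0..t} (\<lambda>_. real (N j))"
    using int[of 0] by (intro integral_le) auto
  then show "integral {0..t} (\<lambda>s. real (\<Psi> i j s)) \<le> real (N j) * t"
    using \<open>0 \<le> t\<close> by (simp add: mult.commute)
qed

lemma abs_sum_le_card:
  fixes g :: "'j::finite \<Rightarrow> real"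
  assumes "\<And>j. \<bar>g j\<bar> \<le> B"
  shows "\<bar>\<Sum>j\<in>UNIV. g j\<bar> \<le> real CARD('j) * B"
  using sum_mono[of UNIV "\<lambda>j. \<bar>g j\<bar>" "\<lambda>_. B"] assms
  by (intro order_trans[OF sum_abs]) simp

text \<open>
  The error bound is assumed before \<open>t\<close> only, since the first time at which the deviation is too large
  has to be covered as well.
\<close>

lemma integral_allocation_error:
  fixes \<Psi> u h :: "real \<Rightarrow> real"
  assumes st: "0 \<le> s" "s \<le> t" and C: "0 \<le> C"
    and int: "\<Psi> integrable_on {s..t}" "u integrable_on {s..t}" "h integrable_on {s..t}"
    and h: "\<And>r. 0 \<le> h r"
    and err: "\<And>r. s \<le> r \<Longrightarrow> r < t \<Longrightarrow> \<bar>\<Psi> r - q + v * u r\<bar> \<le> C * h r"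
  shows "\<bar>integral {s..t} \<Psi> - q * (t - s) + v * integral {s..t} u\<bar> \<le> C * integral {s..t} h"
proof -
  define e where "e r = (if r = t then 0 else \<Psi> r - q + v * u r)" for r
  have full: "((\<lambda>r. \<Psi> r - q + v * u r) has_integral
      integral {s..t} \<Psi> - (t - s) * q + v * integral {s..t} u) {s..t}"
    using st int has_integral_const_real[of q s t]
    by (intro has_integral_add has_integral_diff has_integral_mult_right integrable_integral) auto
  have e: "(e has_integral integral {s..t} \<Psi> - (t - s) * q + v * integral {s..t} u) {s..t}"
    by (rule has_integral_spike_finite[of "{t}", OF _ _ full]) (auto simp: e_def)
  have Ch: "((\<lambda>r. C * h r) has_integral C * integral {s..t} h) {s..t}"
    using int(3) by (intro has_integral_mult_right integrable_integral)
  have "norm (e r) \<le> C * h r" if "r \<in> {s..t}" for r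
    using that err[of r] C h[of r] by (auto simp: e_def)
  then have "norm (integral {s..t} e) \<le> integral {s..t} (\<lambda>r. C * h r)"
    using e Ch by (intro integral_norm_bound_integral has_integral_integrable[OF e] has_integral_integrable[OF Ch]) auto
  then show ?thesis using integral_unique[OF e] integral_unique[OF Ch] by (simp add: mult.commute)
qed

text \<open>
  Replacing all primitive processes by their means costs a multiple of \<open>b\<close>, and so does replacing the rates
  by \<open>n \<lambda>\<close> and \<open>\<mu>\<close>. By the fluid balance the arrivals cancel against the fluid part of the
  departures; what is left is the cycle shift, weighted with \<open>\<mu>\<close>, and the allocation error.
\<close>

lemma system_increment:
  fixes X :: "'i::finite \<Rightarrow> real \<Rightarrow> nat" and \<Psi> :: "'i \<Rightarrow> 'j::finite \<Rightarrow> real \<Rightarrow> nat"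
    and p sg mu :: "'i \<Rightarrow> 'j \<Rightarrow> real" and n b T L a :: real
  defines "d \<equiv> \<lambda>r. deviation p n (\<lambda>i. X i r)"
  assumes sys: "system_equations E N X0 A S X Y Z \<Psi>"
    and A: "\<And>i t. 0 \<le> t \<Longrightarrow> t \<le> T \<Longrightarrow> \<bar>real (A i t) - la i * t\<bar> \<le> b"
    and S: "\<And>i j u. 0 \<le> u \<Longrightarrow> u \<le> L * n \<Longrightarrow> \<bar>real (S i j u) - me i j * u\<bar> \<le> b"
    and la: "\<And>i. \<bar>la i - n * lam i\<bar> \<le> b" and me: "\<And>i j. \<bar>me i j - mu i j\<bar> * n \<le> b"
    and N: "\<And>j. real (N j) * T \<le> L * n"
    and balance: "\<And>i. lam i = (\<Sum>j\<in>UNIV. mu i j * p i j)"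
    and mu: "\<And>i j. 0 \<le> mu i j" and nonneg: "0 \<le> b" "0 \<le> n" "0 \<le> L" "0 \<le> Ca" "0 \<le> \<theta>"
    and steer: "\<And>r. 0 \<le> r \<Longrightarrow> r \<le> T \<Longrightarrow> (\<Sum>k\<in>UNIV. \<bar>d r k\<bar>) \<le> a \<Longrightarrow>
      steering_allocation p sg Ca n \<theta> a (\<lambda>i. X i r) (\<lambda>i j. \<Psi> i j r)"
  shows "steered_increments (\<lambda>i. \<Sum>j\<in>UNIV. mu i j * sg i j)
    (2 + T + CARD('j) * (2 + L) + Ca * (\<Sum>i\<in>UNIV. \<Sum>j\<in>UNIV. mu i j)) T b \<theta> a d"
  unfolding steered_increments_def
proof (intro allI impI)
  fix s t i
  assume st: "0 \<le> s" "s \<le> t" "t \<le> T" and near: "\<forall>r\<in>{0..<t}. (\<Sum>k\<in>UNIV. \<bar>d r k\<bar>) \<le> a"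
  let ?J = "real CARD('j)" and ?mm = "\<Sum>i\<in>UNIV. \<Sum>j\<in>UNIV. mu i j"
  define u :: "real \<Rightarrow> real" where "u r = (if (\<Sum>k\<in>UNIV. d r k) > - \<theta> then 1 else 0)" for r
  define h where "h r = (\<Sum>k\<in>UNIV. \<bar>d r k\<bar>) + \<theta>" for r
  define \<tau> where "\<tau> j r = integral {0..r} (\<lambda>r. real (\<Psi> i j r))" for j r
  define U where "U = integral {s..t} u"
  define H where "H = integral {s..t} h"
  have t0: "0 \<le> t" using st by simp
  have Xstep: "step_path (\<lambda>r i. X i r)"
    by (rule step_path_family) (use sys in \<open>simp add: system_equations_def cadlag_nat_iff_step_path\<close>)
  have u_int: "u integrable_on {s..t}" and h_int: "h integrable_on {s..t}"
    using step_path_comp[OF Xstep, of "\<lambda>x. if (\<Sum>k\<in>UNIV. deviation p n x k) > - \<theta> then 1 else (0::real)"]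
      step_path_comp[OF Xstep, of "\<lambda>x. (\<Sum>k\<in>UNIV. \<bar>deviation p n x k\<bar>) + \<theta>"] st
    by (auto simp: u_def[abs_def] h_def[abs_def] d_def intro!: step_path_integrable)
  have h0: "0 \<le> h r" for r using nonneg by (simp add: h_def sum_nonneg)
  have H0: "0 \<le> H" unfolding H_def using h_int h0 by (intro integral_nonneg) auto
  have \<tau>_range: "0 \<le> \<tau> j r" "\<tau> j r \<le> L * n" if "0 \<le> r" "r \<le> T" for j r
  proof -
    show "0 \<le> \<tau> j r" unfolding \<tau>_def by (rule system_busy_time(1)[OF sys that(1)])
    have "\<tau> j r \<le> real (N j) * r" unfolding \<tau>_def by (rule system_busy_time(2)[OF sys that(1)])
    also have "\<dots> \<le> real (N j) * T" using that by (intro mult_left_mono) auto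
    finally show "\<tau> j r \<le> L * n" using N[of j] by simp
  qed
  have \<tau>_incr: "\<tau> j t - \<tau> j s = integral {s..t} (\<lambda>r. real (\<Psi> i j r))" for j
    using Henstock_Kurzweil_Integration.integral_combine[of 0 s t "\<lambda>r. real (\<Psi> i j r)"]
      system_busy_time(3)[OF sys t0, of 0] st by (simp add: \<tau>_def)
  have \<tau>_abs: "\<bar>\<tau> j t - \<tau> j s\<bar> \<le> L * n" for j
    using \<tau>_range[of t j] \<tau>_range[of s j] st by auto
  define eA where "eA = real (A i t) - real (A i s) - la i * (t - s)"
  define eS where "eS j = real (S i j (\<tau> j t)) - real (S i j (\<tau> j s)) - me i j * (\<tau> j t - \<tau> j s)" for j
  define eI where "eI j = \<tau> j t - \<tau> j s - n * p i j * (t - s) + a * sg i j * U" for j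
  have eA: "\<bar>eA\<bar> \<le> 2 * b"
    using A[of t i] A[of s i] st unfolding eA_def right_diff_distrib by linarith
  have eS: "\<bar>eS j\<bar> \<le> 2 * b" for j
    using S[of "\<tau> j t" i j] S[of "\<tau> j s" i j] \<tau>_range[of t j] \<tau>_range[of s j] st
    unfolding eS_def right_diff_distrib by linarith
  have eI: "\<bar>eI j\<bar> \<le> Ca * H" for j
    unfolding eI_def \<tau>_incr U_def H_def
  proof (rule integral_allocation_error[OF st(1,2) nonneg(4) system_busy_time(3)[OF sys t0 st(1)] u_int h_int h0])
    fix r assume r: "s \<le> r" "r < t"
    then have "steering_allocation p sg Ca n \<theta> a (\<lambda>i. X i r) (\<lambda>i j. \<Psi> i j r)"
      using near st by (intro steer) auto
    then have "\<bar>real (\<Psi> i j r) - n * p i j + (if (\<Sum>k\<in>UNIV. d r k) > - \<theta> then a * sg i j else 0)\<bar> \<le> Ca * h r"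
      unfolding steering_allocation_def d_def h_def by blast
    then show "\<bar>real (\<Psi> i j r) - n * p i j + a * sg i j * u r\<bar> \<le> Ca * h r"
      by (simp add: u_def split: if_splits)
  qed
  have split: "d t i - d s i = (la i * (t - s) + eA) - (\<Sum>j\<in>UNIV. eS j + me i j * (\<tau> j t - \<tau> j s))"
    unfolding d_def deviation_def system_equations_real[OF sys t0] system_equations_real[OF sys st(1)] eA_def eS_def
    by (simp add: \<tau>_def sum_subtractf)
  have main: "n * lam i * (t - s) = (\<Sum>j\<in>UNIV. mu i j * (\<tau> j t - \<tau> j s)) - (\<Sum>j\<in>UNIV. mu i j * eI j)
      + a * (\<Sum>j\<in>UNIV. mu i j * sg i j) * U"
  proof -
    have "n * lam i * (t - s) = (\<Sum>j\<in>UNIV. mu i j * (n * p i j * (t - s)))"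
      unfolding balance by (simp add: sum_distrib_left sum_distrib_right mult_ac)
    also have "\<dots> = (\<Sum>j\<in>UNIV. mu i j * (\<tau> j t - \<tau> j s) - mu i j * eI j + a * (mu i j * sg i j) * U)"
      by (intro sum.cong refl) (simp add: eI_def algebra_simps)
    finally show ?thesis by (simp add: sum.distrib sum_subtractf sum_distrib_left sum_distrib_right)
  qed
  have "d t i - d s i - a * (\<Sum>j\<in>UNIV. mu i j * sg i j) * U
     = (la i - n * lam i) * (t - s) + eA - (\<Sum>j\<in>UNIV. eS j) - (\<Sum>j\<in>UNIV. (me i j - mu i j) * (\<tau> j t - \<tau> j s))
       - (\<Sum>j\<in>UNIV. mu i j * eI j)"
    using split main by (simp add: sum.distrib sum_subtractf left_diff_distrib)
  also have "\<bar>\<dots>\<bar> \<le> b * T + 2 * b + ?J * (2 * b) + ?J * (b * L) + Ca * ?mm * H"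
  proof -
    have 1: "\<bar>(la i - n * lam i) * (t - s)\<bar> \<le> b * T"
      unfolding abs_mult using la[of i] st nonneg by (intro mult_mono) auto
    have 2: "\<bar>\<Sum>j\<in>UNIV. eS j\<bar> \<le> ?J * (2 * b)"
      by (rule abs_sum_le_card) (rule eS)
    have 3: "\<bar>\<Sum>j\<in>UNIV. (me i j - mu i j) * (\<tau> j t - \<tau> j s)\<bar> \<le> ?J * (b * L)"
    proof -
      have "\<bar>(me i j - mu i j) * (\<tau> j t - \<tau> j s)\<bar> \<le> b * L" for j
      proof -
        have "\<bar>(me i j - mu i j) * (\<tau> j t - \<tau> j s)\<bar> \<le> \<bar>me i j - mu i j\<bar> * (L * n)"
          unfolding abs_mult using \<tau>_abs by (intro mult_left_mono) auto
        also have "\<dots> = \<bar>me i j - mu i j\<bar> * n * L" by simp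
        also have "\<dots> \<le> b * L" using me nonneg by (intro mult_right_mono) auto
        finally show ?thesis .
      qed
      then show ?thesis by (rule abs_sum_le_card)
    qed
    have 4: "\<bar>\<Sum>j\<in>UNIV. mu i j * eI j\<bar> \<le> Ca * ?mm * H"
    proof -
      have "\<bar>\<Sum>j\<in>UNIV. mu i j * eI j\<bar> \<le> (\<Sum>j\<in>UNIV. mu i j * (Ca * H))"
        using mu eI by (intro order_trans[OF sum_abs] sum_mono) (simp add: abs_mult mult_left_mono)
      also have "\<dots> = (\<Sum>j\<in>UNIV. mu i j) * (Ca * H)" by (simp add: sum_distrib_right)
      also have "\<dots> \<le> ?mm * (Ca * H)"
        using nonneg H0 mu
        by (intro mult_right_mono member_le_sum[of i UNIV "\<lambda>i. \<Sum>j\<in>UNIV. mu i j"]) (auto intro: sum_nonneg)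
      finally show ?thesis by (simp add: mult_ac)
    qed
    show ?thesis using 1 2 3 4 eA by linarith
  qed
  also have "\<dots> = (2 + T + ?J * (2 + L)) * b + (Ca * ?mm) * H" by (simp add: algebra_simps)
  also have "\<dots> \<le> (2 + T + ?J * (2 + L) + Ca * ?mm) * (b + H)"
  proof -
    have cross: "v * b + w * H \<le> (v + w) * (b + H)" if "0 \<le> v" "0 \<le> w" for v w
      using mult_nonneg_nonneg[OF that(1) H0] mult_nonneg_nonneg[OF that(2) nonneg(1)]
      by (simp add: algebra_simps)
    have "0 \<le> Ca * ?mm" using nonneg mu by (intro mult_nonneg_nonneg sum_nonneg) auto
    moreover have "0 \<le> 2 + T + ?J * (2 + L)" using nonneg st by simp
    ultimately show ?thesis by (rule cross[rotated])
  qed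
  finally show "\<bar>d t i - d s i - a * (\<Sum>j\<in>UNIV. mu i j * sg i j) *
      integral {s..t} (\<lambda>r. if (\<Sum>k\<in>UNIV. d r k) > - \<theta> then 1 else 0)\<bar>
    \<le> (2 + T + ?J * (2 + L) + Ca * ?mm) * (b + integral {s..t} (\<lambda>r. (\<Sum>k\<in>UNIV. \<bar>d r k\<bar>) + \<theta>))"
    unfolding U_def H_def u_def[abs_def] h_def[abs_def] .
qed

lemma system_initial_deviation:
  fixes X :: "'i::finite \<Rightarrow> real \<Rightarrow> nat" and \<Psi> :: "'i \<Rightarrow> 'j::finite \<Rightarrow> real \<Rightarrow> nat" and b :: real
  assumes sys: "system_equations E N X0 A S X Y Z \<Psi>"
    and A: "\<bar>real (A i 0)\<bar> \<le> b" and S: "\<And>j. \<bar>real (S i j 0)\<bar> \<le> b"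
    and X0: "\<bar>real (X0 i) - n * (\<Sum>j\<in>UNIV. p i j)\<bar> \<le> b"
  shows "\<bar>deviation p n (\<lambda>i. X i 0) i\<bar> \<le> (2 + real CARD('j)) * b"
proof -
  have "real (X i 0) = real (X0 i) + real (A i 0) - (\<Sum>j\<in>UNIV. real (S i j 0))"
    using system_equations_real[OF sys, of 0 i] by simp
  moreover have "\<bar>\<Sum>j\<in>UNIV. real (S i j 0)\<bar> \<le> CARD('j) * b"
    by (rule abs_sum_le_card) (rule S)
  ultimately show ?thesis using A X0 unfolding deviation_def distrib_right by linarith
qed

section \<open>Null controllability\<close>

text \<open>
  Effort at rate zero could be dropped without losing feasibility or optimality, against uniqueness.
\<close>

lemma heavy_traffic_zero_rate:
  assumes ht: "heavy_traffic lam mu nu xi \<rho>" and "mu i j = 0"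
  shows "xi i j = 0"
proof -
  have opt: "lp_optimal lam mu nu xi \<rho>"
    and uniq: "\<And>xi' \<rho>'. lp_optimal lam mu nu xi' \<rho>' \<Longrightarrow> xi' = xi"
    using ht by (auto simp: heavy_traffic_def)
  define xi' where "xi' k l = (if k = i \<and> l = j then 0 else xi k l)" for k l
  have nonneg: "0 \<le> xi k l" for k l using opt by (simp add: lp_optimal_def lp_feasible_def)
  have "(nu l * mu k l) * xi' k l = (nu l * mu k l) * xi k l" for k l
    using assms(2) by (simp add: xi'_def)
  then have row: "(\<Sum>l\<in>UNIV. (nu l * mu k l) * xi' k l) = lam k" for k
    using opt by (simp only: lp_optimal_def lp_feasible_def)
  have "(\<Sum>k\<in>UNIV. xi' k l) \<le> (\<Sum>k\<in>UNIV. xi k l)" for l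
    using nonneg by (intro sum_mono) (simp add: xi'_def)
  then have col: "(\<Sum>k\<in>UNIV. xi' k l) \<le> \<rho>" for l
    using opt unfolding lp_optimal_def lp_feasible_def by (meson order_trans)
  have "0 \<le> xi' k l" for k l using nonneg by (simp add: xi'_def)
  then have "lp_feasible lam mu nu xi' \<rho>"
    using opt row col by (simp add: lp_optimal_def lp_feasible_def)
  then have "lp_optimal lam mu nu xi' \<rho>" using opt by (simp add: lp_optimal_def)
  then have "xi' = xi" by (rule uniq)
  then have "xi i j = xi' i j" by simp
  then show ?thesis by (simp add: xi'_def)
qed

text \<open>
  Queue paths are right-continuous step paths almost surely, so that rational times decide; completeness of
  the measure disposes of the exceptional outcomes.
\<close>

lemma sets_queues_empty:
  assumes "complete_measure M" and "0 < \<epsilon>" "\<epsilon> < T"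
    and ctrl: "controlled_process M E N X0 A S f X Y Z \<Psi>"
  shows "{\<omega>\<in>space M. \<forall>t\<in>{\<epsilon>..T}. \<forall>i. Y i t \<omega> = 0} \<in> sets M"
proof -
  interpret complete_measure M by fact
  define Q where "Q = insert T (\<rat> \<inter> {\<epsilon>..T})"
  have Q: "countable Q" "Q \<subseteq> {\<epsilon>..T}"
    using assms by (auto simp: Q_def intro: countable_Int1 countable_rat)
  have Y_meas: "Y i t \<in> M \<rightarrow>\<^sub>M count_space UNIV" if "0 \<le> t" for i t
    using ctrl that by (simp add: controlled_process_def)
  have "{\<omega>\<in>space M. \<forall>i. Y i t \<omega> = 0} \<in> sets M" if "t \<in> Q" for t
  proof -
    have [measurable]: "Y i t \<in> M \<rightarrow>\<^sub>M count_space UNIV" for i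
      using that Q(2) assms by (intro Y_meas) auto
    show ?thesis by measurable
  qed
  then have "(\<Inter>t\<in>Q. {\<omega>\<in>space M. \<forall>i. Y i t \<omega> = 0}) \<in> sets M"
    using Q(1) by (intro sets.countable_INT') (auto simp: Q_def)
  moreover have "(\<Inter>t\<in>Q. {\<omega>\<in>space M. \<forall>i. Y i t \<omega> = 0}) = {\<omega>\<in>space M. \<forall>t\<in>Q. \<forall>i. Y i t \<omega> = 0}"
    by (auto simp: Q_def)
  ultimately have meas: "{\<omega>\<in>space M. \<forall>t\<in>Q. \<forall>i. Y i t \<omega> = 0} \<in> sets M" by simp
  have ae: "AE \<omega> in M. \<omega> \<in> {\<omega>\<in>space M. \<forall>t\<in>Q. \<forall>i. Y i t \<omega> = 0} \<longleftrightarrow>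
      \<omega> \<in> {\<omega>\<in>space M. \<forall>t\<in>{\<epsilon>..T}. \<forall>i. Y i t \<omega> = 0}"
  proof -
    have "AE \<omega> in M. system_equations E N X0 (\<lambda>i t. A i t \<omega>) (\<lambda>i j t. S i j t \<omega>)
          (\<lambda>i t. X i t \<omega>) (\<lambda>i t. Y i t \<omega>) (\<lambda>j t. Z j t \<omega>) (\<lambda>i j t. \<Psi> i j t \<omega>) \<and>
        (\<forall>t\<ge>0. \<forall>i j. \<Psi> i j t \<omega> = f (\<lambda>i'. X i' t \<omega>) i j)"
      using ctrl unfolding controlled_process_def by blast
    then show ?thesis
    proof eventually_elim
      case (elim \<omega>)
      then have Y_step: "step_path (\<lambda>t. Y i t \<omega>)" for i
        by (simp add: system_equations_def cadlag_nat_iff_step_path)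
      have "Y i t \<omega> = 0" if z: "\<forall>t\<in>Q. \<forall>i. Y i t \<omega> = 0" and t: "t \<in> {\<epsilon>..T}" for i t
      proof (cases "t = T")
        case True
        then show ?thesis using z by (simp add: Q_def)
      next
        case False
        have "\<forall>\<^sub>F s in at_right t. Y i s \<omega> = Y i t \<omega>"
          using Y_step[of i] t assms by (auto simp: step_path_def)
        then obtain c where c: "t < c" "\<And>s. t < s \<Longrightarrow> s < c \<Longrightarrow> Y i s \<omega> = Y i t \<omega>"
          by (auto simp: eventually_at_right_field)
        obtain q where q: "q \<in> \<rat>" "t < q" "q < min c T"
          using Rats_dense_in_real[of t "min c T"] c(1) t False by auto
        then have "q \<in> Q" using t by (auto simp: Q_def)
        then show ?thesis using z c(2)[of q] q by auto
      qed
      then show ?case using Q(2) by blast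
    qed
  qed
  show ?thesis by (rule in_sets_AE[OF ae meas]) blast
qed

lemma prob_tendsto_1:
  assumes "prob_space M" and W: "\<And>n. W n \<in> sets M"
    and B: "\<And>n. B n \<in> sets M" "(\<lambda>n. measure M (B n)) \<longlonglongrightarrow> 0"
    and sub: "\<forall>\<^sub>F n in sequentially. AE \<omega> in M. \<omega> \<notin> B n \<longrightarrow> \<omega> \<in> W n"
  shows "(\<lambda>n. measure M (W n)) \<longlonglongrightarrow> 1"
proof -
  interpret prob_space M by fact
  show ?thesis
  proof (rule tendsto_sandwich[of "\<lambda>n. 1 - measure M (B n)" _ _ "\<lambda>_. 1"])
    show "\<forall>\<^sub>F n in sequentially. 1 - measure M (B n) \<le> measure M (W n)"
      using sub
    proof eventually_elim
      case (elim n)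
      have "1 - measure M (B n) = measure M (space M - B n)" by (simp add: prob_compl B)
      also have "\<dots> \<le> measure M (W n)"
        using elim W by (intro finite_measure_mono_AE) auto
      finally show ?case .
    qed
    show "(\<lambda>n. 1 - measure M (B n)) \<longlonglongrightarrow> 1" using tendsto_diff[OF tendsto_const B(2), of 1] by simp
  qed auto
qed

theorem theorem2p3:
  fixes E :: "('i::finite \<times> 'j::finite) set"
    and lamn :: "nat \<Rightarrow> 'i \<Rightarrow> real" and mun :: "nat \<Rightarrow> 'i \<Rightarrow> 'j \<Rightarrow> real" and Nn :: "nat \<Rightarrow> 'j \<Rightarrow> nat"
    and lam lamhat :: "'i \<Rightarrow> real" and mu muhat :: "'i \<Rightarrow> 'j \<Rightarrow> real" and nu :: "'j \<Rightarrow> real"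
    and xi :: "'i \<Rightarrow> 'j \<Rightarrow> real" and \<rho> :: real
    and M :: "'w measure"
    and U :: "'i \<Rightarrow> nat \<Rightarrow> 'w \<Rightarrow> real"
    and A :: "nat \<Rightarrow> 'i \<Rightarrow> real \<Rightarrow> 'w \<Rightarrow> nat"
    and S :: "nat \<Rightarrow> 'i \<Rightarrow> 'j \<Rightarrow> real \<Rightarrow> 'w \<Rightarrow> nat"
    and X0 :: "nat \<Rightarrow> 'i \<Rightarrow> nat" and x :: "'i \<Rightarrow> real"
  assumes "CARD('i) \<ge> 2" and "CARD('j) \<ge> 2"
    and "rate_asymptotics E lamn mun Nn lam mu nu lamhat muhat"
    and "heavy_traffic lam mu nu xi \<rho>"
    and "is_tree (basic_activities E xi)"
    and "prob_space M" and "complete_measure M"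
    and "interarrival_times M U"
    and "\<And>n i t \<omega>. A n i t \<omega> = arrivals (U i) (lamn n i) t \<omega>"
    and "\<And>n i j. poisson_process M (mun n i j) (S n i j)"
    and "\<And>n. independent_primitives M (A n) (S n)"
    and "\<And>i. (\<lambda>n. (real (X0 n i) - real n * fluid_state nu xi i) / sqrt (real n)) \<longlonglongrightarrow> x i"
    and "\<exists>c \<in> simple_cycles E (basic_activities E xi). (\<chi> i. 1) \<bullet> cycle_vec mu c < 0"
  shows "\<exists>f :: nat \<Rightarrow> ('i \<Rightarrow> nat) \<Rightarrow> 'i \<Rightarrow> 'j \<Rightarrow> nat.
    (\<forall>n. P_SCP M E (Nn n) (X0 n) (A n) (S n) (f n)) \<and>
    (\<forall>X Y Z \<Psi>.
       (\<forall>n. controlled_process M E (Nn n) (X0 n) (A n) (S n) (f n) (X n) (Y n) (Z n) (\<Psi> n)) \<longrightarrow>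
       (\<forall>\<epsilon> T :: real. 0 < \<epsilon> \<longrightarrow> \<epsilon> < T \<longrightarrow>
          (\<lambda>n. measure M {\<omega> \<in> space M. \<forall>t\<in>{\<epsilon>..T}. \<forall>i. Y n i t \<omega> = 0}) \<longlonglongrightarrow> 1))"
proof -
  interpret prob_space M by fact
  let ?Eb = "basic_activities E xi"
  let ?J = "real CARD('j)" and ?I = "real CARD('i)"
  note ra = assms(3)[unfolded rate_asymptotics_def]
  have lamn: "0 < lamn n i" and mun: "0 \<le> mun n i j" and nu: "0 < nu j" for n i j
    using ra by blast+
  have mu: "0 \<le> mu i j" and mu_E: "(i, j) \<notin> E \<Longrightarrow> mu i j = 0" for i j
    using ra by (auto intro: less_imp_le split: if_splits) (metis less_imp_le order_refl)+
  have lim: "(\<lambda>n. lamn n i / real n) \<longlonglongrightarrow> lam i" "(\<lambda>n. mun n i j) \<longlonglongrightarrow> mu i j"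
    "(\<lambda>n. sqrt (real n) * (lamn n i / real n - lam i)) \<longlonglongrightarrow> lamhat i"
    "(\<lambda>n. sqrt (real n) * (mun n i j - mu i j)) \<longlonglongrightarrow> muhat i j"
    "(\<lambda>n. sqrt (real n) * (real (Nn n j) / real n - nu j)) \<longlonglongrightarrow> 0" for i j
    using ra by blast+
  define p where "p i j = xi i j * nu j" for i j
  have feas: "lp_feasible lam mu nu xi \<rho>" and xi_sum: "(\<Sum>i\<in>UNIV. xi i j) = 1" for j
    using assms(4) by (auto simp: heavy_traffic_def lp_optimal_def)
  have xi0: "0 \<le> xi i j" for i j using feas by (simp add: lp_feasible_def)
  have balance: "lam i = (\<Sum>j\<in>UNIV. mu i j * p i j)" for i
    using feas by (simp add: lp_feasible_def p_def mult_ac)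
  have p_zero: "p i j = 0" if "(i, j) \<notin> ?Eb" for i j
  proof -
    have "xi i j = 0"
    proof (cases "(i, j) \<in> E")
      case True
      then show ?thesis using that xi0[of i j] by (simp add: basic_activities_def)
    next
      case False
      then show ?thesis using heavy_traffic_zero_rate[OF assms(4)] mu_E by blast
    qed
    then show ?thesis by (simp add: p_def)
  qed
  have p_col: "(\<Sum>i\<in>UNIV. p i j) = nu j" for j
    using xi_sum[of j] by (simp add: p_def flip: sum_distrib_right)
  obtain \<delta> where \<delta>: "0 < \<delta>" "\<And>i j. (i, j) \<in> ?Eb \<Longrightarrow> \<delta> \<le> p i j"
  proof
    \<comment> \<open>the element \<open>1\<close> makes the set nonempty\<close>
    let ?P = "insert 1 ((\<lambda>(i, j). p i j) ` ?Eb)"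
    have "\<forall>x\<in>?P. 0 < x" using nu by (auto simp: basic_activities_def p_def)
    then show "0 < Min ?P" by (subst Min_gr_iff) auto
    show "Min ?P \<le> p i j" if "(i, j) \<in> ?Eb" for i j
      using that by (intro Min_le) force+
  qed
  obtain c where c: "c \<in> simple_cycles E ?Eb" "(\<chi> i. 1) \<bullet> cycle_vec mu c < 0" using assms(13) by blast
  define sg where "sg = cycle_sign c"
  define m where "m i = (\<Sum>j\<in>UNIV. mu i j * sg i j)" for i
  define \<kappa> where "\<kappa> = - (\<Sum>i\<in>UNIV. m i)"
  have cyc: "is_cycle E c" "cycle_edges c - ?Eb = {hd c}" using c(1) by (auto simp: simple_cycles_def)
  have m: "(\<Sum>i\<in>UNIV. m i) = - \<kappa>" "0 < \<kappa>"
    using c(2) by (simp_all add: \<kappa>_def m_def sg_def inner_vec_def cycle_vec_eq_cycle_sign mult.commute)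
  have sg_supp: "sg i j = 0" if "(i, j) \<notin> E" for i j
    using that cyc(1) by (auto simp: sg_def cycle_sign_def is_cycle_def)
  have sg_row: "(\<Sum>j\<in>UNIV. sg i j) = 0" for i by (simp add: sg_def cycle_sign_row_sum[OF cyc(1)])
  have sg_col: "(\<Sum>i\<in>UNIV. sg i j) = 0" for j by (simp add: sg_def cycle_sign_column_sum[OF cyc(1)])
  have sg_le: "sg i j \<le> 1" for i j by (simp add: sg_def cycle_sign_def edge_sign_def)
  have sg_neg: "sg i j \<le> 0" if "(i, j) \<notin> ?Eb" for i j
  proof (cases "(i, j) \<in> cycle_edges c")
    case True
    then have "(i, j) = hd c" using that cyc(2) by auto
    moreover have "0 < length c" using cyc(1) by (auto simp: is_cycle_def)
    ultimately have "(i, j) \<in> forward_edges c"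
      unfolding forward_edges_def by (auto simp: hd_conv_nth intro!: exI[of _ 0])
    then show ?thesis by (simp add: sg_def cycle_sign_def edge_sign_def)
  qed (simp add: sg_def cycle_sign_def)
  have "\<forall>u v. (u, v) \<in> (adjacency ?Eb)\<^sup>*" using assms(5) by (simp add: is_tree_def)
  from balanced_flow_exists[OF this] obtain F :: "('i \<Rightarrow> real) \<Rightarrow> 'i \<Rightarrow> 'j \<Rightarrow> real" and Cf where
    Cf: "0 \<le> Cf" and F: "\<And>d i j. (i, j) \<notin> ?Eb \<Longrightarrow> F d i j = 0"
      "\<And>d i. (\<Sum>j\<in>UNIV. F d i j) = d i"
      "\<And>d j. (\<Sum>i\<in>UNIV. F d i j) = (\<Sum>i\<in>UNIV. d i) / ?J"
      "\<And>d i j. \<bar>F d i j\<bar> \<le> Cf * (\<Sum>i\<in>UNIV. \<bar>d i\<bar>)"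
    by blast
  \<comment> \<open>noise, threshold and control strength, in well separated orders of magnitude\<close>
  define b \<theta> a :: "nat \<Rightarrow> real" where
    "b n = real n powr (12 / 16)" and "\<theta> n = real n powr (13 / 16)" and "a n = real n powr (15 / 16)" for n
  have ev_le: "\<forall>\<^sub>F n in sequentially. K * b n \<le> \<theta> n" "\<forall>\<^sub>F n in sequentially. K * \<theta> n \<le> a n"
    "\<forall>\<^sub>F n in sequentially. K * a n \<le> real n" for K
    unfolding b_def \<theta>_def a_def
    using powr_eventually_le[of "12/16" "13/16" K] powr_eventually_le[of "13/16" "15/16" K]
      powr_eventually_le[of "15/16" 1 K] by simp_all
  define Ca where "Ca = 2 * Cf + ?J"
  define ok where "ok n x \<Psi> \<longleftrightarrow> feasible_allocation E (Nn n) x \<Psi> \<and>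
      steering_allocation p sg Ca (real n) (\<theta> n) (a n) x \<Psi>" for n x \<Psi>
  \<comment> \<open>in states too far from the fluid state, and in small systems, nobody is served; such states are not reached
    with probability tending to \<open>1\<close>\<close>
  define f where "f n x = (if \<exists>\<Psi>. ok n x \<Psi> then SOME \<Psi>. ok n x \<Psi> else (\<lambda>_ _. 0))" for n x
  have f_ok: "ok n x (f n x)" if "\<exists>\<Psi>. ok n x \<Psi>" for n x
    using someI_ex[OF that] that by (simp add: f_def)
  have f_feasible: "feasible_allocation E (Nn n) x (f n x)" for n x
  proof (cases "\<exists>\<Psi>. ok n x \<Psi>")
    case True
    then show ?thesis using f_ok by (simp add: ok_def)
  next
    case False
    then show ?thesis by (simp add: f_def feasible_allocation_def)
  qed
  have lam_near: "\<forall>\<^sub>F n in sequentially. \<forall>i. \<bar>lamn n i - real n * lam i\<bar> \<le> b n"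
    using fraction_scale_eventually_le[OF lim(3)] by (intro eventually_all_finite) (simp add: b_def)
  have mu_near: "\<forall>\<^sub>F n in sequentially. \<forall>i j. \<bar>mun n i j - mu i j\<bar> * real n \<le> b n"
    using rate_scale_eventually_le[OF lim(4)] by (intro eventually_all_finite) (simp add: b_def)
  have N_near: "\<forall>\<^sub>F n in sequentially. \<forall>j. \<bar>real (Nn n j) - real n * nu j\<bar> \<le> b n"
    using fraction_scale_eventually_le[OF lim(5)] by (intro eventually_all_finite) (simp add: b_def)
  have X0_near: "\<forall>\<^sub>F n in sequentially. \<forall>i. \<bar>real (X0 n i) - real n * (\<Sum>j\<in>UNIV. p i j)\<bar> \<le> b n"
    using sqrt_scale_eventually_le[OF assms(12)]
    by (intro eventually_all_finite) (simp add: b_def fluid_state_def p_def)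
  have b_pos: "\<forall>\<^sub>F n in sequentially. 1 \<le> b n"
    using eventually_ge_at_top[of 1]
    by eventually_elim (simp add: b_def ge_one_powr_ge_zero)
  have steer: "\<forall>\<^sub>F n in sequentially. \<forall>x. (\<Sum>i\<in>UNIV. \<bar>deviation p (real n) x i\<bar>) \<le> a n \<longrightarrow> ok n x (f n x)"
    using b_pos N_near ev_le(1)[of 1] ev_le(2)[of 1] ev_le(1)[of "2 * ?J * (1 + ?I * ?J)"]
      ev_le(3)[of "(3 * Cf + 1) / \<delta>"]
  proof eventually_elim
    case (elim n)
    show ?case
    proof (intro allI impI f_ok)
      fix x assume near: "(\<Sum>i\<in>UNIV. \<bar>deviation p (real n) x i\<bar>) \<le> a n"
      show "\<exists>\<Psi>. ok n x \<Psi>"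
      proof -
        have \<theta>1: "1 \<le> \<theta> n" and a0: "0 \<le> a n" using elim by (simp_all add: a_def)
        have big: "Cf * (2 * a n + \<theta> n) + a n \<le> real n * \<delta>"
        proof -
          have "Cf * (2 * a n + \<theta> n) \<le> Cf * (3 * a n)" using Cf elim by (intro mult_left_mono) auto
          moreover have "(3 * Cf + 1) * a n \<le> real n * \<delta>"
            using elim \<delta>(1) by (simp add: pos_divide_le_eq)
          ultimately show ?thesis by (simp add: algebra_simps)
        qed
        have servers: "real n * nu j \<le> real (Nn n j) + b n" for j
          using elim(2)[rule_format, of j] by linarith
        have slack: "b n + ?I * ?J \<le> \<theta> n / (2 * ?J)"
        proof -
          have "b n + ?I * ?J \<le> b n + ?I * ?J * b n"
            using mult_left_mono[of 1 "b n" "?I * ?J"] elim(1) by simp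
          also have "\<dots> = (1 + ?I * ?J) * b n" by (simp add: algebra_simps)
          finally have "(b n + ?I * ?J) * (2 * ?J) \<le> (1 + ?I * ?J) * b n * (2 * ?J)" by (intro mult_right_mono) auto
          also have "\<dots> \<le> \<theta> n" using elim by (simp add: mult_ac)
          finally show ?thesis by (simp add: pos_le_divide_eq)
        qed
        have "?Eb \<subseteq> E" by (auto simp: basic_activities_def)
        from steering_allocation_exists[OF F Cf this \<delta>(2) p_zero p_col sg_row sg_col sg_supp sg_neg sg_le
            of_nat_0_le_iff \<theta>1 a0 big servers slack near]
        show ?thesis unfolding ok_def Ca_def .
      qed
    qed
  qed
  have A_eq: "A n i t = arrivals (U i) (lamn n i) t" for n i t using assms(9) by (simp add: fun_eq_iff)
  have U_rv: "U i k \<in> borel_measurable M" if "k \<ge> 1" for i k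
    using assms(8) that unfolding interarrival_times_def by (meson borel_measurable_integrable)
  show ?thesis
  proof (rule exI[of _ f], intro conjI allI impI)
    fix n
    show "P_SCP M E (Nn n) (X0 n) (A n) (S n) (f n)"
    proof (rule feasible_policy_is_P_SCP)
      show "feasible_allocation E (Nn n) x (f n x)" for x by (rule f_feasible)
      show "A n i t \<in> M \<rightarrow>\<^sub>M count_space UNIV" for i t
        unfolding A_eq by (rule measurable_arrivals) (rule U_rv)
      show "S n i j t \<in> M \<rightarrow>\<^sub>M count_space UNIV" if "0 \<le> t" for i j t
        using assms(10)[of n i j] that by (simp add: poisson_process_def)
      have "AE \<omega> in M. \<forall>i. counting_path (\<lambda>t. A n i t \<omega>)"
      proof (rule eventually_all_finite)
        fix i
        show "AE \<omega> in M. counting_path (\<lambda>t. A n i t \<omega>)"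
          using interarrival_AE_regular[OF assms(6,8), of i]
          by eventually_elim (simp only: A_eq, rule counting_path_arrivals, assumption, rule lamn)
      qed
      moreover have "AE \<omega> in M. \<forall>i j. counting_path (\<lambda>t. S n i j t \<omega>) \<and> unit_jumps (\<lambda>t. S n i j t \<omega>) \<and> S n i j 0 \<omega> = 0"
        by (intro eventually_all_finite poisson_process_AE_paths[OF assms(6) assms(10) mun])
      ultimately show "AE \<omega> in M. (\<forall>i. counting_path (\<lambda>t. A n i t \<omega>)) \<and>
        (\<forall>i j. counting_path (\<lambda>t. S n i j t \<omega>) \<and> unit_jumps (\<lambda>t. S n i j t \<omega>) \<and> S n i j 0 \<omega> = 0)"
        by (rule eventually_conj)
    qed
  next
    fix X Y Z \<Psi> and \<epsilon> T :: real
    assume ctrl: "\<forall>n. controlled_process M E (Nn n) (X0 n) (A n) (S n) (f n) (X n) (Y n) (Z n) (\<Psi> n)"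
      and \<epsilon>: "0 < \<epsilon>" "\<epsilon> < T"
    \<comment> \<open>for large \<open>n\<close> no station accumulates by time \<open>T\<close> more than \<open>L n\<close> units of work time\<close>
    define L where "L = ((\<Sum>j\<in>UNIV. nu j) + 1) * T"
    have nu_le: "nu j \<le> (\<Sum>j\<in>UNIV. nu j)" for j
      using nu by (intro member_le_sum) (auto intro: less_imp_le)
    have "0 \<le> (\<Sum>j\<in>UNIV. nu j)" using nu by (intro sum_nonneg) (auto intro: less_imp_le)
    then have L: "0 < L" using \<epsilon> unfolding L_def by (intro mult_pos_pos) auto
    define C where "C = 2 + T + ?J * (2 + L) + Ca * (\<Sum>i\<in>UNIV. \<Sum>j\<in>UNIV. mu i j)"
    have Ca: "0 \<le> Ca" using Cf by (simp add: Ca_def)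
    have C_ge: "2 + ?J \<le> C"
    proof -
      have "0 \<le> Ca * (\<Sum>i\<in>UNIV. \<Sum>j\<in>UNIV. mu i j)" using Ca mu by (intro mult_nonneg_nonneg sum_nonneg) auto
      moreover have "?J * 1 \<le> ?J * (2 + L)" using L by (intro mult_left_mono) auto
      ultimately show ?thesis using \<epsilon> unfolding C_def by linarith
    qed
    then have "0 < C" by (smt (verit) of_nat_0_le_iff)
    have "0 < T" using \<epsilon> by simp
    from control_drives_total_negative[OF m \<open>0 < C\<close> \<open>0 < T\<close> \<epsilon>(1)] obtain K where K: "0 < K" and
      steered: "\<And>(d :: real \<Rightarrow> 'i \<Rightarrow> real) b \<theta> a. step_path d \<Longrightarrow> 0 < b \<Longrightarrow> K * b \<le> \<theta> \<Longrightarrow> K * \<theta> \<le> a \<Longrightarrow>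
        (\<forall>i. \<bar>d 0 i\<bar> \<le> C * b) \<Longrightarrow>
        steered_increments m C T b \<theta> a d \<Longrightarrow>
        (\<forall>t\<in>{\<epsilon>..T}. (\<Sum>k\<in>UNIV. d t k) \<le> - \<theta> / 2 \<and> (\<Sum>k\<in>UNIV. \<bar>d t k\<bar>) \<le> a)"
      by blast
    have "\<forall>i. \<exists>B. negligible_deviation M (\<lambda>n. arrivals (U i) (lamn n i)) (\<lambda>n. lamn n i) (\<lambda>_. T) B"
      by (intro allI arrival_noise_negligible[OF assms(6,8) lamn lim(1) \<open>0 < T\<close>])
    then obtain BA where
      BA': "\<And>i. negligible_deviation M (\<lambda>n. arrivals (U i) (lamn n i)) (\<lambda>n. lamn n i) (\<lambda>_. T) (BA i)"
      by metis
    have BA: "\<And>i n. BA i n \<in> sets M" "\<And>i. (\<lambda>n. measure M (BA i n)) \<longlonglongrightarrow> 0"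
      using BA' unfolding negligible_deviation_def by blast+
    have "\<forall>i j. \<exists>B. negligible_deviation M (\<lambda>n. S n i j) (\<lambda>n. mun n i j) (\<lambda>n. L * real n) B"
      by (intro allI service_noise_negligible[OF assms(6) assms(10) mun lim(2) L])
    then obtain BS where
      BS': "\<And>i j. negligible_deviation M (\<lambda>n. S n i j) (\<lambda>n. mun n i j) (\<lambda>n. L * real n) (BS i j)"
      by metis
    have BS: "\<And>i j n. BS i j n \<in> sets M" "\<And>i j. (\<lambda>n. measure M (BS i j n)) \<longlonglongrightarrow> 0"
      using BS' unfolding negligible_deviation_def by blast+
    define B where "B n = (\<Union>i. BA i n) \<union> (\<Union>i. \<Union>j. BS i j n)" for n
    have B_sets: "B n \<in> sets M" for n unfolding B_def using BA(1) BS(1) by auto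
    have B_lim: "(\<lambda>n. measure M (B n)) \<longlonglongrightarrow> 0"
    proof (rule tendsto_sandwich[of "\<lambda>_. 0" _ _ "\<lambda>n. (\<Sum>i\<in>UNIV. measure M (BA i n)) + (\<Sum>i\<in>UNIV. \<Sum>j\<in>UNIV. measure M (BS i j n))"])
      have "measure M (B n) \<le> (\<Sum>i\<in>UNIV. measure M (BA i n)) + (\<Sum>i\<in>UNIV. \<Sum>j\<in>UNIV. measure M (BS i j n))" for n
      proof -
        have "measure M (B n) \<le> measure M (\<Union>i. BA i n) + measure M (\<Union>i. \<Union>j. BS i j n)"
          unfolding B_def using BA(1) BS(1) by (intro measure_Un_le) auto
        also have "measure M (\<Union>i. BA i n) \<le> (\<Sum>i\<in>UNIV. measure M (BA i n))"
          using BA(1) by (intro finite_measure_subadditive_finite) auto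
        also have "measure M (\<Union>i. \<Union>j. BS i j n) \<le> (\<Sum>i\<in>UNIV. measure M (\<Union>j. BS i j n))"
          using BS(1) by (intro finite_measure_subadditive_finite) auto
        also have "\<dots> \<le> (\<Sum>i\<in>UNIV. \<Sum>j\<in>UNIV. measure M (BS i j n))"
          using BS(1) by (intro sum_mono finite_measure_subadditive_finite) auto
        finally show ?thesis by simp
      qed
      then show "\<forall>\<^sub>F n in sequentially. measure M (B n)
        \<le> (\<Sum>i\<in>UNIV. measure M (BA i n)) + (\<Sum>i\<in>UNIV. \<Sum>j\<in>UNIV. measure M (BS i j n))" by simp
      have "(\<lambda>n. (\<Sum>i\<in>UNIV. measure M (BA i n)) + (\<Sum>i\<in>UNIV. \<Sum>j\<in>UNIV. measure M (BS i j n)))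
          \<longlonglongrightarrow> (\<Sum>i\<in>(UNIV::'i set). 0) + (\<Sum>i\<in>(UNIV::'i set). \<Sum>j\<in>(UNIV::'j set). 0)"
        by (intro tendsto_add tendsto_sum BA(2) BS(2))
      then show "(\<lambda>n. (\<Sum>i\<in>UNIV. measure M (BA i n)) + (\<Sum>i\<in>UNIV. \<Sum>j\<in>UNIV. measure M (BS i j n))) \<longlonglongrightarrow> 0"
        by simp
    qed auto
    have A_good: "\<forall>\<^sub>F n in sequentially. \<forall>i. \<forall>\<omega>\<in>space M - BA i n. \<forall>t. 0 \<le> t \<longrightarrow> t \<le> T \<longrightarrow>
         \<bar>real (arrivals (U i) (lamn n i) t \<omega>) - lamn n i * t\<bar> \<le> real n powr (3 / 4)"
      using BA' unfolding negligible_deviation_def by (intro eventually_all_finite) blast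
    have S_good: "\<forall>\<^sub>F n in sequentially. \<forall>i j. \<forall>\<omega>\<in>space M - BS i j n. \<forall>t. 0 \<le> t \<longrightarrow> t \<le> L * real n \<longrightarrow>
         \<bar>real (S n i j t \<omega>) - mun n i j * t\<bar> \<le> real n powr (3 / 4)"
      using BS' unfolding negligible_deviation_def by (intro eventually_all_finite) blast
    show "(\<lambda>n. measure M {\<omega>\<in>space M. \<forall>t\<in>{\<epsilon>..T}. \<forall>i. Y n i t \<omega> = 0}) \<longlonglongrightarrow> 1"
    proof (rule prob_tendsto_1[OF assms(6) _ B_sets B_lim])
      show "{\<omega>\<in>space M. \<forall>t\<in>{\<epsilon>..T}. \<forall>i. Y n i t \<omega> = 0} \<in> sets M" for n
        by (rule sets_queues_empty[OF assms(7) \<epsilon> ctrl[rule_format, of n]])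
      show "\<forall>\<^sub>F n in sequentially. AE \<omega> in M. \<omega> \<notin> B n \<longrightarrow>
          \<omega> \<in> {\<omega>\<in>space M. \<forall>t\<in>{\<epsilon>..T}. \<forall>i. Y n i t \<omega> = 0}"
        using A_good S_good lam_near mu_near N_near X0_near b_pos steer ev_le(1)[of K] ev_le(2)[of K]
          ev_le(1)[of 1] ev_le(2)[of 1] ev_le(3)[of 1]
      proof eventually_elim
        case (elim n)
        note A_n = elim(1) and S_n = elim(2) and lam_n = elim(3) and mu_n = elim(4) and N_n = elim(5)
          and X0_n = elim(6) and b_n = elim(7) and steer_n = elim(8) and K_n = elim(9,10)
        have bn: "b n \<le> real n" using elim(11-13) by simp
        have "AE \<omega> in M. system_equations E (Nn n) (X0 n) (\<lambda>i t. A n i t \<omega>) (\<lambda>i j t. S n i j t \<omega>)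
            (\<lambda>i t. X n i t \<omega>) (\<lambda>i t. Y n i t \<omega>) (\<lambda>j t. Z n j t \<omega>) (\<lambda>i j t. \<Psi> n i j t \<omega>) \<and>
          (\<forall>t\<ge>0. \<forall>i j. \<Psi> n i j t \<omega> = f n (\<lambda>i'. X n i' t \<omega>) i j)"
          using ctrl[rule_format, of n] unfolding controlled_process_def by blast
        then show ?case
          using AE_space
        proof eventually_elim
          case (elim \<omega>)
          then have sys: "system_equations E (Nn n) (X0 n) (\<lambda>i t. A n i t \<omega>) (\<lambda>i j t. S n i j t \<omega>)
              (\<lambda>i t. X n i t \<omega>) (\<lambda>i t. Y n i t \<omega>) (\<lambda>j t. Z n j t \<omega>) (\<lambda>i j t. \<Psi> n i j t \<omega>)"
            and pol: "\<And>t. 0 \<le> t \<Longrightarrow> (\<lambda>i j. \<Psi> n i j t \<omega>) = f n (\<lambda>i. X n i t \<omega>)"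
            and \<omega>: "\<omega> \<in> space M" by (auto simp: fun_eq_iff)
          define d where "d r = deviation p (real n) (\<lambda>i. X n i r \<omega>)" for r
          show ?case
          proof
            assume "\<omega> \<notin> B n"
            then have \<omega>B: "\<omega> \<in> space M - BA i n" "\<omega> \<in> space M - BS i j n" for i j
              using \<omega> by (auto simp: B_def)
            have A_dev: "\<bar>real (A n i t \<omega>) - lamn n i * t\<bar> \<le> b n" if "0 \<le> t" "t \<le> T" for i t
              using A_n \<omega>B that by (simp add: A_eq b_def)
            have S_dev: "\<bar>real (S n i j t \<omega>) - mun n i j * t\<bar> \<le> b n" if "0 \<le> t" "t \<le> L * real n" for i j t
              using S_n \<omega>B that by (simp add: b_def)
            have steer_d: "steering_allocation p sg Ca (real n) (\<theta> n) (a n) (\<lambda>i. X n i r \<omega>) (\<lambda>i j. \<Psi> n i j r \<omega>)"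
              if "0 \<le> r" "(\<Sum>k\<in>UNIV. \<bar>d r k\<bar>) \<le> a n" for r
              using steer_n that by (simp add: pol ok_def d_def)
            have drained: "\<forall>t\<in>{\<epsilon>..T}. (\<Sum>k\<in>UNIV. d t k) \<le> - \<theta> n / 2 \<and> (\<Sum>k\<in>UNIV. \<bar>d t k\<bar>) \<le> a n"
            proof (rule steered[of d "b n" "\<theta> n" "a n"])
              have "step_path (\<lambda>t i. X n i t \<omega>)"
                by (rule step_path_family) (use sys in \<open>simp add: system_equations_def cadlag_nat_iff_step_path\<close>)
              from step_path_comp[OF this] show "step_path d" unfolding d_def .
              show "0 < b n" "K * b n \<le> \<theta> n" "K * \<theta> n \<le> a n" using b_n K_n by auto
              show "\<forall>i. \<bar>d 0 i\<bar> \<le> C * b n"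
              proof
                fix i
                have "\<bar>d 0 i\<bar> \<le> (2 + ?J) * b n"
                  unfolding d_def
                proof (rule system_initial_deviation[OF sys])
                  show "\<bar>real (A n i 0 \<omega>)\<bar> \<le> b n" using A_dev[of 0 i] \<open>0 < T\<close> by simp
                  show "\<bar>real (S n i j 0 \<omega>)\<bar> \<le> b n" for j using S_dev[of 0 i j] L by simp
                  show "\<bar>real (X0 n i) - real n * (\<Sum>j\<in>UNIV. p i j)\<bar> \<le> b n" using X0_n by simp
                qed
                also have "\<dots> \<le> C * b n" using C_ge b_n by (intro mult_right_mono) auto
                finally show "\<bar>d 0 i\<bar> \<le> C * b n" .
              qed
              show "steered_increments m C T (b n) (\<theta> n) (a n) d"
                unfolding C_def m_def[abs_def] d_def[abs_def]
              proof (rule system_increment[OF sys A_dev S_dev])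
                show "\<bar>lamn n i - real n * lam i\<bar> \<le> b n" for i using lam_n by simp
                show "\<bar>mun n i j - mu i j\<bar> * real n \<le> b n" for i j using mu_n by simp
                show "real (Nn n j) * T \<le> L * real n" for j
                proof -
                  have "real (Nn n j) \<le> real n * nu j + b n" using N_n[rule_format, of j] by linarith
                  also have "\<dots> \<le> real n * (\<Sum>j\<in>UNIV. nu j) + real n"
                    using bn nu_le[of j] by (intro add_mono mult_left_mono) auto
                  finally have "real (Nn n j) * T \<le> (real n * (\<Sum>j\<in>UNIV. nu j) + real n) * T"
                    using \<open>0 < T\<close> by (intro mult_right_mono) auto
                  then show ?thesis by (simp add: L_def algebra_simps)
                qed
              qed (use balance mu b_n L Ca steer_d in \<open>auto simp: \<theta>_def d_def\<close>)
            qed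
            have "Y n i t \<omega> = 0" if t: "t \<in> {\<epsilon>..T}" for i t
            proof -
              have t0: "0 \<le> t" using t \<epsilon> by simp
              have "steering_allocation p sg Ca (real n) (\<theta> n) (a n) (\<lambda>i. X n i t \<omega>) (\<lambda>i j. \<Psi> n i j t \<omega>)"
                using drained t by (intro steer_d t0) auto
              moreover have "(\<Sum>k\<in>UNIV. deviation p (real n) (\<lambda>i. X n i t \<omega>) k) \<le> - \<theta> n / 2"
                using drained t unfolding d_def by blast
              ultimately have "(\<Sum>j\<in>UNIV. \<Psi> n i j t \<omega>) = X n i t \<omega>"
                unfolding steering_allocation_def by blast
              moreover have "Y n i t \<omega> + (\<Sum>j\<in>UNIV. \<Psi> n i j t \<omega>) = X n i t \<omega>"
                using sys t0 unfolding system_equations_def by blast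
              ultimately show ?thesis by simp
            qed
            then show "\<omega> \<in> {\<omega>\<in>space M. \<forall>t\<in>{\<epsilon>..T}. \<forall>i. Y n i t \<omega> = 0}" using \<omega> by simp
          qed
        qed
      qed
    qed
  qed
qed

end
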